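(* Let $X$ be a set, $G\subseteq\mathrm{Sym}(X)$ an oligomorphic permutation group with a measure $\mu$ taking values in $\mathbb{C}$, and let $Y$ be an infinite, smooth and orbit-finite $G$-set. With respect to the $\mathfrak{sl}_2(\mathbb{C})$-action on the orbit algebra $\mathsf{H}^{\star}_{G,Y}$ defined from $\mu$ in the context, $\mathsf{H}^{\star}_{G,Y}$ has a (finite or countably infinite) ascending filtration by $\mathfrak{sl}_2(\mathbb{C})$-subrepresentations $$0=\mathcal{F}_0\subseteq\mathcal{F}_1\subseteq\mathcal{F}_2\subseteq\cdots\subseteq\mathcal{F}_n\subseteq\cdots\subseteq\mathsf{H}^{\star}_{G,Y},\qquad \bigcup_n\mathcal{F}_n=\mathsf{H}^{\star}_{G,Y},$$ such that each quotient $\mathcal{F}_{n+1}/\mathcal{F}_n$ is isomorphic to a lowest weight Verma module $M^-(\lambda_n)$ for some $\lambda_n\in\mathbb{C}$. In particular the integer sequence $\left(\left|G\backslash\binom{Y}{n}\right|\right)_{n\ge0}$ is a sum of (shifted) constant sequences $1,1,1,\dots$, i.e. of sequences of the form $0,\dots,0,1,1,1,\dots$.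
   Context: Oligomorphic groups. A subgroup $G\subseteq \mathrm{Sym}(X)$ is oligomorphic if $G$ has finitely many orbits on $X^n$ for all $n\ge 0$. $G$ carries the pointwise convergence topology, whose basic open sets are $\{g\in G\mid gx_i=x_i',\ i=1,\dots,n\}$ for $x_i,x_i'\in X$; a subgroup is open iff it contains the pointwise stabilizer of some finite subset of $X$. For an open subgroup $U\subseteq G$, a $U$-set is smooth if all point stabilizers are open, and orbit-finite if it has finitely many orbits. $\hat G$-sets. A $\hat G$-set is a set $Z$ with a smooth, orbit-finite action of some open subgroup $U\subseteq G$; shrinking $U$ does not change the $\hat G$-set (so an isomorphism of $\hat G$-sets is a bijection equivariant under some open subgroup). Measures. A measure on $G$ with values in a field $k$ assigns to each $\hat G$-set $Z$ an element $\mu(Z)\in k$ such that: (i) $\mu(Z_1)=\mu(Z_2)$ if $Z_1\cong Z_2$; (ii) $\mu(\{\mathrm{pt}\})=1$; (iii) $\mu(Z^g)=\mu(Z)$ for all $g\in G$, where $Z^g$ is $Z$ with the action conjugated by $g$; (iv) $\mu(Z_1)=\mu(f^{-1}(z))\,\mu(Z_2)$ for every homomorphism $f\colon Z_1\to Z_2$ of transitive smooth $U$-sets ($U\subseteq G$ an open subgroup) and $z\in Z_2$; (v) $\mu(Z_1\sqcup Z_2)=\mu(Z_1)+\mu(Z_2)$. Orbit algebra and $\mathfrak{sl}_2$-action. $\binom Yn$ is the set of $n$-element subsets of $Y$, and $\mathsf{H}^{\star}_{G,Y}=\bigoplus_{n\ge0}\mathsf{H}^n_{G,Y}$ with $\mathsf{H}^n_{G,Y}=\mathrm{Maps}\big(\binom{Y}{n},\mathbb{C}\big)^G$.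 With $e=\begin{pmatrix}0&1\\0&0\end{pmatrix}$, $f=\begin{pmatrix}0&0\\1&0\end{pmatrix}$, $h=\begin{pmatrix}1&0\\0&-1\end{pmatrix}$, the algebra $\mathfrak{sl}_2(\mathbb{C})$ acts as follows. For $v\in\mathsf{H}^n_{G,Y}$: $e v\in\mathsf{H}^{n+1}_{G,Y}$, $(ev)(T)=\sum_{y\in T}v(T\setminus\{y\})$; $f v\in\mathsf{H}^{n-1}_{G,Y}$ (zero if $n=0$), $(fv)(S)=\sum_{t}\mu(O_t)\,v(S\cup\{y_t\})$, where $O_1,\dots,O_s$ are the orbits on $Y\setminus S$ of an open subgroup $U\subseteq G$ stabilizing $S$ and $y_t\in O_t$ (independent of choices); $hv=(n-\mu(Y\setminus S))v=(2n-\mu(Y))v$, where $S$ is any $n$-element subset of $Y$. The lowest weight Verma module $M^-(\lambda)$, $\lambda\in\mathbb{C}$, is $U(\mathfrak{sl}_2)\otimes_{U(\mathfrak b^-)}\mathbb{C}_\lambda$, where $\mathfrak b^-=\mathrm{span}(h,f)$, $f$ acts on $\mathbb{C}_\lambda$ by $0$ and $h$ by $\lambda$. *)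

theory Defs
  imports
    "HOL-Analysis.Analysis"
    "HOL-Library.Poly_Mapping"
    "HOL-Library.Ramsey"
    "HOL-Library.Extended_Nat"
    "HOL-Algebra.Group_Action"
    "HOL-Algebra.QuotRing"
    "HOL-Algebra.Module"
    "HOL-Algebra.Generated_Groups"
    "HOL-Algebra.Free_Abelian_Groups"
begin

section \<open>Oligomorphic groups\<close>

text \<open>\<^term>\<open>BijGroup X\<close> is the symmetric group of \<open>X\<close>; its elements are extensional functions.\<close>

abbreviation perm_group :: "'x set \<Rightarrow> ('x \<Rightarrow> 'x) set \<Rightarrow> ('x \<Rightarrow> 'x) monoid" where
  "perm_group X U \<equiv> (BijGroup X)\<lparr>carrier := U\<rparr>"

definition oligomorphic :: "'x set \<Rightarrow> ('x \<Rightarrow> 'x) set \<Rightarrow> bool" where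
  "oligomorphic X G \<longleftrightarrow> subgroup G (BijGroup X) \<and>
     (\<forall>n. finite (orbits (perm_group X G) {xs. set xs \<subseteq> X \<and> length xs = n} map))"

definition pointwise_topology :: "'x set \<Rightarrow> ('x \<Rightarrow> 'x) set \<Rightarrow> ('x \<Rightarrow> 'x) topology" where
  "pointwise_topology X G = topology_generated_by
     {{g \<in> G. \<forall>(x, x') \<in> P. g x = x'} | P. finite P \<and> P \<subseteq> X \<times> X}"

definition open_subgroup :: "'x set \<Rightarrow> ('x \<Rightarrow> 'x) set \<Rightarrow> ('x \<Rightarrow> 'x) set \<Rightarrow> bool" where
  "open_subgroup X G U \<longleftrightarrow>
     subgroup U (perm_group X G) \<and> openin (pointwise_topology X G) U"


lemma perm_group_simps:
  assumes "subgroup G (BijGroup X)"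
  shows "group (perm_group X G)" "subgroup U (perm_group X G) \<longleftrightarrow> subgroup U (BijGroup X) \<and> U \<subseteq> G"
    "U \<subseteq> G \<Longrightarrow> perm_group X U = perm_group X G \<lparr>carrier := U\<rparr>"
  subgoal using assms group.subgroup_imp_group group_BijGroup by blast
  subgoal using assms group_BijGroup
    by (metis group.incl_subgroup group.subgroup_incl partial_object.select_convs(1) partial_object.surjective partial_object.update_convs(1) subgroup.subset)
  subgoal by simp
  done

lemma BijGroup_mult: "g \<in> Bij X \<Longrightarrow> h \<in> Bij X \<Longrightarrow> x \<in> X \<Longrightarrow> (g \<otimes>\<^bsub>BijGroup X\<^esub> h) x = g (h x)"
  by (simp add: BijGroup_def compose_def)

lemma BijGroup_inv: "g \<in> Bij X \<Longrightarrow> x \<in> X \<Longrightarrow> (inv\<^bsub>BijGroup X\<^esub> g) (g x) = x"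
  using Bij_imp_funcset[of g X] by (auto simp: inv_BijGroup Bij_def bij_betw_def inv_into_f_f)

lemma pointwise_topology_nbhd:
  assumes "openin (pointwise_topology X G) W" "g \<in> W"
  shows "g \<in> G \<and> (\<exists>A. finite A \<and> A \<subseteq> X \<and> {h \<in> G. \<forall>x \<in> A. h x = g x} \<subseteq> W)"
proof -
  have "generate_topology_on {{g \<in> G. \<forall>(x, x') \<in> P. g x = x'} | P. finite P \<and> P \<subseteq> X \<times> X} W"
    using assms(1) unfolding pointwise_topology_def openin_topology_generated_by_iff .
  then show ?thesis using assms(2)
  proof (induction arbitrary: g)
    case Empty then show ?case by simp
  next
    case (Int a b)
    obtain A where A: "finite A" "A \<subseteq> X" "{h \<in> G. \<forall>x \<in> A. h x = g x} \<subseteq> a" "g \<in> G"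
      using Int.IH(1)[of g] Int.prems by auto
    obtain B where B: "finite B" "B \<subseteq> X" "{h \<in> G. \<forall>x \<in> B. h x = g x} \<subseteq> b"
      using Int.IH(2)[of g] Int.prems by auto
    have "{h \<in> G. \<forall>x \<in> A \<union> B. h x = g x} \<subseteq> a \<inter> b" using A(3) B(3) by blast
    moreover have "finite (A \<union> B)" "A \<union> B \<subseteq> X" using A B by auto
    ultimately show ?case using A(4) by meson
  next
    case (UN K)
    then obtain k where k: "k \<in> K" "g \<in> k" by blast
    from UN.IH[OF this] obtain A where
      "g \<in> G" "finite A" "A \<subseteq> X" "{h \<in> G. \<forall>x \<in> A. h x = g x} \<subseteq> k" by auto
    moreover from this(4) k(1) have "{h \<in> G. \<forall>x \<in> A. h x = g x} \<subseteq> \<Union>K" by blast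
    ultimately show ?case by meson
  next
    case (Basis s)
    then obtain P where P: "s = {g \<in> G. \<forall>(x, x') \<in> P. g x = x'}" "finite P" "P \<subseteq> X \<times> X"
      by blast
    have gP: "g \<in> G" "\<And>x x'. (x, x') \<in> P \<Longrightarrow> g x = x'" using Basis.prems P(1) by auto
    have "{h \<in> G. \<forall>x \<in> fst ` P. h x = g x} \<subseteq> s"
    proof
      fix h assume h: "h \<in> {h \<in> G. \<forall>x \<in> fst ` P. h x = g x}"
      have "h x = x'" if "(x, x') \<in> P" for x x'
      proof -
        have "x \<in> fst ` P" using that by (rule rev_image_eqI) simp
        then have "h x = g x" using h by blast
        then show ?thesis using gP(2)[OF that] by simp
      qed
      then show "h \<in> s" using h P(1) by blast
    qed
    moreover have "finite (fst ` P)" using P(2) by simp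
    moreover have "fst ` P \<subseteq> X" using P(3) by auto
    ultimately show ?case using gP(1) by meson
  qed
qed

lemma pointwise_topology_openI:
  assumes GX: "\<And>g. g \<in> G \<Longrightarrow> g \<in> X \<rightarrow> X" and WG: "W \<subseteq> G"
    and nb: "\<And>g. g \<in> W \<Longrightarrow> \<exists>A. finite A \<and> A \<subseteq> X \<and> {h \<in> G. \<forall>x \<in> A. h x = g x} \<subseteq> W"
  shows "openin (pointwise_topology X G) W"
proof (subst openin_subopen, intro ballI)
  fix g assume g: "g \<in> W"
  then obtain A where A: "finite A" "A \<subseteq> X" "{h \<in> G. \<forall>x \<in> A. h x = g x} \<subseteq> W"
    using nb by meson
  let ?P = "(\<lambda>x. (x, g x)) ` A"
  have "finite ?P" using A(1) by simp
  moreover have "?P \<subseteq> X \<times> X" using A(2) GX g WG by blast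
  ultimately have "openin (pointwise_topology X G) {h \<in> G. \<forall>(x, x') \<in> ?P. h x = x'}"
    unfolding pointwise_topology_def openin_topology_generated_by_iff
    by (intro generate_topology_on.Basis) blast
  moreover have "{h \<in> G. \<forall>(x, x') \<in> ?P. h x = x'} = {h \<in> G. \<forall>x \<in> A. h x = g x}" by simp
  ultimately have op: "openin (pointwise_topology X G) {h \<in> G. \<forall>x \<in> A. h x = g x}" by simp
  show "\<exists>T. openin (pointwise_topology X G) T \<and> g \<in> T \<and> T \<subseteq> W"
  proof (intro exI conjI)
    show "openin (pointwise_topology X G) {h \<in> G. \<forall>x \<in> A. h x = g x}" by (rule op)
    show "g \<in> {h \<in> G. \<forall>x \<in> A. h x = g x}" using g WG by blast
    show "{h \<in> G. \<forall>x \<in> A. h x = g x} \<subseteq> W" by (rule A(3))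
  qed
qed

lemma open_subgroup_iff:
  assumes G: "subgroup G (BijGroup X)"
  shows "open_subgroup X G U \<longleftrightarrow>
    subgroup U (perm_group X G) \<and> (\<exists>A. finite A \<and> A \<subseteq> X \<and> {g \<in> G. \<forall>x \<in> A. g x = x} \<subseteq> U)"
proof (cases "subgroup U (perm_group X G)")
  case True
  then have U: "subgroup U (BijGroup X)" "U \<subseteq> G" using perm_group_simps(2)[OF G] by auto
  have GB: "G \<subseteq> Bij X" using subgroup.subset[OF G] by (simp add: BijGroup_def)
  have "openin (pointwise_topology X G) U \<longleftrightarrow>
      (\<exists>A. finite A \<and> A \<subseteq> X \<and> {g \<in> G. \<forall>x \<in> A. g x = x} \<subseteq> U)"
  proof
    assume op: "openin (pointwise_topology X G) U"
    have "\<one>\<^bsub>BijGroup X\<^esub> \<in> U" using U(1) by (rule subgroup.one_closed)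
    from pointwise_topology_nbhd[OF op this] obtain A where
      A: "finite A" "A \<subseteq> X" "{h \<in> G. \<forall>x \<in> A. h x = \<one>\<^bsub>BijGroup X\<^esub> x} \<subseteq> U" by blast
    have "\<one>\<^bsub>BijGroup X\<^esub> x = x" if "x \<in> A" for x
      using A(2) that by (auto simp: BijGroup_def)
    then have "{g \<in> G. \<forall>x \<in> A. g x = x} \<subseteq> U" using A(3) by simp
    then show "\<exists>A. finite A \<and> A \<subseteq> X \<and> {g \<in> G. \<forall>x \<in> A. g x = x} \<subseteq> U" using A(1,2) by meson
  next
    assume "\<exists>A. finite A \<and> A \<subseteq> X \<and> {g \<in> G. \<forall>x \<in> A. g x = x} \<subseteq> U"
    then obtain A where A: "finite A" "A \<subseteq> X" "{g \<in> G. \<forall>x \<in> A. g x = x} \<subseteq> U" by meson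
    show "openin (pointwise_topology X G) U"
    proof (rule pointwise_topology_openI)
      show "g \<in> X \<rightarrow> X" if "g \<in> G" for g using that GB Bij_imp_funcset by blast
      show "U \<subseteq> G" by (rule U(2))
      fix g assume g: "g \<in> U"
      have "h \<in> U" if h: "h \<in> G" "\<forall>x \<in> A. h x = g x" for h
      proof -
        have gB: "g \<in> Bij X" "h \<in> Bij X" using g h U(2) GB by auto
        let ?k = "inv\<^bsub>BijGroup X\<^esub> g \<otimes>\<^bsub>BijGroup X\<^esub> h"
        have iU: "inv\<^bsub>BijGroup X\<^esub> g \<in> U" using U(1) g by (rule subgroup.m_inv_closed)
        then have iB: "inv\<^bsub>BijGroup X\<^esub> g \<in> Bij X" using U(2) GB by auto
        have kG: "?k \<in> G" using iU U(2) h(1) G by (simp add: subgroup.m_closed subsetD)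
        have "?k x = x" if "x \<in> A" for x
        proof -
          have xX: "x \<in> X" using that A(2) by blast
          show ?thesis
            using BijGroup_mult[OF iB gB(2) xX] BijGroup_inv[OF gB(1) xX] h(2) that by simp
        qed
        then have "?k \<in> U" using A(3) kG by blast
        then have "g \<otimes>\<^bsub>BijGroup X\<^esub> ?k \<in> U" using U(1) g by (simp add: subgroup.m_closed)
        moreover have "g \<otimes>\<^bsub>BijGroup X\<^esub> ?k = h"
        proof -
          have c: "g \<in> carrier (BijGroup X)" "h \<in> carrier (BijGroup X)"
            using gB by (simp_all add: BijGroup_def)
          interpret B: Group.group "BijGroup X" by (rule group_BijGroup)
          show ?thesis using c by (simp add: B.m_assoc[symmetric])
        qed
        ultimately show ?thesis by simp
      qed
      then show "\<exists>A. finite A \<and> A \<subseteq> X \<and> {h \<in> G. \<forall>x \<in> A. h x = g x} \<subseteq> U"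
        using A(1,2) by blast
    qed
  qed
  with True show ?thesis by (simp add: open_subgroup_def)
qed (simp add: open_subgroup_def)

lemma open_subgroup_Int:
  assumes G: "subgroup G (BijGroup X)" and "open_subgroup X G U" "open_subgroup X G V"
  shows "open_subgroup X G (U \<inter> V)"
proof -
  obtain A B where *: "finite A" "A \<subseteq> X" "{g \<in> G. \<forall>x \<in> A. g x = x} \<subseteq> U"
     "finite B" "B \<subseteq> X" "{g \<in> G. \<forall>x \<in> B. g x = x} \<subseteq> V"
    using assms unfolding open_subgroup_iff[OF G] by blast
  have "subgroup (U \<inter> V) (perm_group X G)"
    using assms group.subgroups_Inter_pair perm_group_simps(1)[OF G] unfolding open_subgroup_def by blast
  moreover have "{g \<in> G. \<forall>x \<in> A \<union> B. g x = x} \<subseteq> U \<inter> V" using *(3,6) by blast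
  ultimately show ?thesis
    unfolding open_subgroup_iff[OF G] using *(1,2,4,5)
    by (intro conjI exI[of _ "A \<union> B"]) simp_all
qed


section \<open>Sets with an action of an open subgroup\<close>

record ('x, 'z) gset =
  gs_grp :: "('x \<Rightarrow> 'x) set"
  gs_pts :: "'z set"
  gs_act :: "('x \<Rightarrow> 'x) \<Rightarrow> 'z \<Rightarrow> 'z"

definition smooth_gset :: "'x set \<Rightarrow> ('x \<Rightarrow> 'x) set \<Rightarrow> ('x, 'z) gset \<Rightarrow> bool" where
  "smooth_gset X G Z \<longleftrightarrow>
     open_subgroup X G (gs_grp Z) \<and>
     group_action (perm_group X (gs_grp Z)) (gs_pts Z) (gs_act Z) \<and>
     (\<forall>z \<in> gs_pts Z. open_subgroup X G (stabilizer (perm_group X (gs_grp Z)) (gs_act Z) z))"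

definition ghat_set :: "'x set \<Rightarrow> ('x \<Rightarrow> 'x) set \<Rightarrow> ('x, 'z) gset \<Rightarrow> bool" where
  "ghat_set X G Z \<longleftrightarrow>
     smooth_gset X G Z \<and> finite (orbits (perm_group X (gs_grp Z)) (gs_pts Z) (gs_act Z))"

definition ghat_iso ::
    "'x set \<Rightarrow> ('x \<Rightarrow> 'x) set \<Rightarrow> ('x, 'z) gset \<Rightarrow> ('x, 'w) gset \<Rightarrow> bool" where
  "ghat_iso X G Z Z' \<longleftrightarrow>
     (\<exists>\<beta> V. bij_betw \<beta> (gs_pts Z) (gs_pts Z') \<and>
        open_subgroup X G V \<and> V \<subseteq> gs_grp Z \<inter> gs_grp Z' \<and>
        (\<forall>g \<in> V. \<forall>z \<in> gs_pts Z. \<beta> (gs_act Z g z) = gs_act Z' g (\<beta> z)))"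

text \<open>The subset \<open>A\<close> of \<open>Z\<close>, on which the subgroup \<open>U\<close> of the group of \<open>Z\<close> acts.\<close>

definition sub_gset :: "('x \<Rightarrow> 'x) set \<Rightarrow> 'z set \<Rightarrow> ('x, 'z) gset \<Rightarrow> ('x, 'z) gset" where
  "sub_gset U A Z = \<lparr>gs_grp = U, gs_pts = A, gs_act = (\<lambda>g. restrict (gs_act Z g) A)\<rparr>"

definition conj_gset :: "'x set \<Rightarrow> ('x \<Rightarrow> 'x) \<Rightarrow> ('x, 'z) gset \<Rightarrow> ('x, 'z) gset" where
  "conj_gset X g Z =
     \<lparr>gs_grp = (\<lambda>u. g \<otimes>\<^bsub>BijGroup X\<^esub> u \<otimes>\<^bsub>BijGroup X\<^esub> inv\<^bsub>BijGroup X\<^esub> g) ` gs_grp Z,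
      gs_pts = gs_pts Z,
      gs_act = (\<lambda>h. gs_act Z (inv\<^bsub>BijGroup X\<^esub> g \<otimes>\<^bsub>BijGroup X\<^esub> h \<otimes>\<^bsub>BijGroup X\<^esub> g))\<rparr>"


lemma smooth_gset_act_closed:
  assumes "smooth_gset X G Z" "g \<in> gs_grp Z" "z \<in> gs_pts Z"
  shows "gs_act Z g z \<in> gs_pts Z"
  using group_action.element_image[of "perm_group X (gs_grp Z)" "gs_pts Z" "gs_act Z"] assms
  by (auto simp: smooth_gset_def)

lemma ghat_iso_sym:
  assumes "smooth_gset X G Z" "ghat_iso X G Z Z'"
  shows "ghat_iso X G Z' Z"
proof -
  obtain \<beta> V where *: "bij_betw \<beta> (gs_pts Z) (gs_pts Z')" "open_subgroup X G V"
      "V \<subseteq> gs_grp Z \<inter> gs_grp Z'"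
      "\<forall>g \<in> V. \<forall>z \<in> gs_pts Z. \<beta> (gs_act Z g z) = gs_act Z' g (\<beta> z)"
    using assms(2) unfolding ghat_iso_def by blast
  let ?b = "inv_into (gs_pts Z) \<beta>"
  have "?b (gs_act Z' g w) = gs_act Z g (?b w)" if g: "g \<in> V" and w: "w \<in> gs_pts Z'" for g w
  proof -
    obtain z where z: "z \<in> gs_pts Z" "w = \<beta> z" using *(1) w by (auto simp: bij_betw_def)
    have "gs_act Z g z \<in> gs_pts Z" using smooth_gset_act_closed[OF assms(1) _ z(1)] g *(3) by blast
    then show ?thesis using *(1,4) z g by (metis bij_betw_inv_into_left)
  qed
  then show ?thesis unfolding ghat_iso_def using *(1-3) bij_betw_inv_into by blast
qed

lemma ghat_iso_trans:
  assumes G: "subgroup G (BijGroup X)" and "ghat_iso X G Z Z'" "ghat_iso X G Z' Z''"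
  shows "ghat_iso X G Z Z''"
proof -
  obtain \<beta> V where 1: "bij_betw \<beta> (gs_pts Z) (gs_pts Z')" "open_subgroup X G V"
      "V \<subseteq> gs_grp Z \<inter> gs_grp Z'"
      "\<forall>g \<in> V. \<forall>z \<in> gs_pts Z. \<beta> (gs_act Z g z) = gs_act Z' g (\<beta> z)"
    using assms(2) unfolding ghat_iso_def by blast
  obtain \<gamma> W where 2: "bij_betw \<gamma> (gs_pts Z') (gs_pts Z'')" "open_subgroup X G W"
      "W \<subseteq> gs_grp Z' \<inter> gs_grp Z''"
      "\<forall>g \<in> W. \<forall>z \<in> gs_pts Z'. \<gamma> (gs_act Z' g z) = gs_act Z'' g (\<gamma> z)"
    using assms(3) unfolding ghat_iso_def by blast
  have "\<forall>g \<in> V \<inter> W. \<forall>z \<in> gs_pts Z. (\<gamma> \<circ> \<beta>) (gs_act Z g z) = gs_act Z'' g ((\<gamma> \<circ> \<beta>) z)"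
    using bij_betwE[OF 1(1)] 1(4) 2(4) by simp
  moreover have "V \<inter> W \<subseteq> gs_grp Z \<inter> gs_grp Z''" using 1(3) 2(3) by blast
  ultimately show ?thesis
    unfolding ghat_iso_def using bij_betw_trans[OF 1(1) 2(1)] open_subgroup_Int[OF G 1(2) 2(2)] by blast
qed

lemma ghat_set_transport:
  assumes Z: "ghat_set X G Z" and inj: "inj_on \<beta> (gs_pts Z)"
  defines "Z' \<equiv> \<lparr>gs_grp = gs_grp Z, gs_pts = \<beta> ` gs_pts Z,
     gs_act = (\<lambda>g. \<lambda>w \<in> \<beta> ` gs_pts Z. \<beta> (gs_act Z g (inv_into (gs_pts Z) \<beta> w)))\<rparr>"
  shows "ghat_set X G Z' \<and> ghat_iso X G Z Z'"
proof -
  let ?U = "perm_group X (gs_grp Z)"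
  let ?P = "gs_pts Z"
  have sm: "smooth_gset X G Z" using Z by (simp add: ghat_set_def)
  interpret A: group_action ?U ?P "gs_act Z" using sm by (simp add: smooth_gset_def)
  have act: "gs_act Z' g (\<beta> z) = \<beta> (gs_act Z g z)" if "z \<in> ?P" for g z
    using that inj by (simp add: Z'_def)
  have mem: "gs_act Z g z \<in> ?P" if "g \<in> gs_grp Z" "z \<in> ?P" for g z
    using smooth_gset_act_closed[OF sm that] .
  have bij: "gs_act Z' g \<in> Bij (\<beta> ` ?P)" if g: "g \<in> gs_grp Z" for g
  proof -
    have b: "bij_betw (gs_act Z g) ?P ?P"
      using A.bij_prop0[of g] g by (simp add: Bij_def)
    have "bij_betw (\<beta> \<circ> (gs_act Z g \<circ> inv_into ?P \<beta>)) (\<beta> ` ?P) (\<beta> ` ?P)"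
      using inj b by (intro bij_betw_trans) (auto intro: bij_betw_inv_into inj_on_imp_bij_betw)
    then have "bij_betw (gs_act Z' g) (\<beta> ` ?P) (\<beta> ` ?P)"
      by (rule bij_betw_cong[THEN iffD1, rotated]) (simp add: Z'_def)
    then show ?thesis by (simp add: Bij_def Z'_def)
  qed
  have grp: "group ?U" using A.group_hom group_hom.axioms(1) by blast
  have "gs_act Z' (g \<otimes>\<^bsub>?U\<^esub> h) = gs_act Z' g \<otimes>\<^bsub>BijGroup (\<beta> ` ?P)\<^esub> gs_act Z' h"
    if gh: "g \<in> gs_grp Z" "h \<in> gs_grp Z" for g h
  proof (rule extensionalityI[of _ "\<beta> ` ?P"])
    show "gs_act Z' (g \<otimes>\<^bsub>?U\<^esub> h) \<in> extensional (\<beta> ` ?P)" by (simp add: Z'_def)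
    show "gs_act Z' g \<otimes>\<^bsub>BijGroup (\<beta> ` ?P)\<^esub> gs_act Z' h \<in> extensional (\<beta> ` ?P)"
      using bij[OF gh(1)] bij[OF gh(2)] by (simp add: BijGroup_def)
    fix w assume "w \<in> \<beta> ` ?P"
    then obtain z where z: "z \<in> ?P" "w = \<beta> z" by blast
    have c: "gs_act Z (g \<otimes>\<^bsub>?U\<^esub> h) z = gs_act Z g (gs_act Z h z)"
      using A.composition_rule[OF z(1)] gh by simp
    have "gs_act Z' (g \<otimes>\<^bsub>?U\<^esub> h) w = \<beta> (gs_act Z g (gs_act Z h z))"
      using act[OF z(1)] z(2) c by simp
    then show "gs_act Z' (g \<otimes>\<^bsub>?U\<^esub> h) w = (gs_act Z' g \<otimes>\<^bsub>BijGroup (\<beta> ` ?P)\<^esub> gs_act Z' h) w"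
      using BijGroup_mult[OF bij[OF gh(1)] bij[OF gh(2)]] z act mem[OF gh(2) z(1)] by simp
  qed
  then have ga: "group_action ?U (\<beta> ` ?P) (gs_act Z')"
    unfolding group_action_def group_hom_def group_hom_axioms_def
    using grp group_BijGroup bij by (auto simp: hom_def BijGroup_def)
  have st: "stabilizer ?U (gs_act Z') (\<beta> z) = stabilizer ?U (gs_act Z) z" if "z \<in> ?P" for z
    using act[OF that] mem[OF _ that] inj that by (auto simp: stabilizer_def inj_on_eq_iff)
  have orb: "orbit ?U (gs_act Z') (\<beta> z) = \<beta> ` orbit ?U (gs_act Z) z" if "z \<in> ?P" for z
    using act[OF that] by (auto simp: orbit_def)
  have "orbits ?U (\<beta> ` ?P) (gs_act Z') = (`) \<beta> ` orbits ?U ?P (gs_act Z)"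
  proof -
    have "orbits ?U (\<beta> ` ?P) (gs_act Z') = (\<lambda>z. orbit ?U (gs_act Z') (\<beta> z)) ` ?P"
      by (auto simp: orbits_def)
    also have "\<dots> = (\<lambda>z. \<beta> ` orbit ?U (gs_act Z) z) ` ?P" using orb by simp
    finally show ?thesis by (auto simp: orbits_def)
  qed
  then have "ghat_set X G Z'"
    using Z ga st by (auto simp: ghat_set_def smooth_gset_def Z'_def)
  moreover have "ghat_iso X G Z Z'"
    unfolding ghat_iso_def using inj sm act
    by (intro exI[of _ \<beta>] exI[of _ "gs_grp Z"])
       (auto simp: Z'_def smooth_gset_def inj_on_imp_bij_betw)
  ultimately show ?thesis by blast
qed


section \<open>Measures\<close>

text \<open>
  Since the sets with an action of an open subgroup form a proper class, a measure is given by its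
  values on those whose points lie in a fixed type that contains a copy of each of them: every
  orbit is a coset space of an open subgroup, and there are finitely many orbits (lemma
  \<open>ghat_set_has_copy\<close>).  The values on all others are determined by isomorphism invariance
  (\<open>measure_of_gset\<close>).
\<close>

type_synonym 'x gset_univ = "nat \<times> ('x \<Rightarrow> 'x) set"

lemma ghat_set_has_copy:
  assumes Z: "ghat_set X G Z"
  shows "\<exists>Z' :: ('x, 'x gset_univ) gset. ghat_set X G Z' \<and> ghat_iso X G Z Z'"
proof -
  let ?U = "perm_group X (gs_grp Z)"
  let ?O = "orbits ?U (gs_pts Z) (gs_act Z)"
  interpret A: group_action ?U "gs_pts Z" "gs_act Z"
    using Z by (simp add: ghat_set_def smooth_gset_def)
  obtain num :: "'a set \<Rightarrow> nat" where num: "inj_on num ?O"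
    using Z finite_imp_inj_to_nat_seg[of ?O] by (auto simp: ghat_set_def)
  let ?o = "orbit ?U (gs_act Z)"
  let ?r = "\<lambda>z. SOME y. y \<in> ?o z"
  let ?\<beta> = "\<lambda>z. (num (?o z), {g \<in> gs_grp Z. gs_act Z g (?r z) = z})"
  have "inj_on ?\<beta> (gs_pts Z)"
  proof (rule inj_onI)
    fix y z assume y: "y \<in> gs_pts Z" and z: "z \<in> gs_pts Z" and eq: "?\<beta> y = ?\<beta> z"
    have "?o y = ?o z"
      using eq num y z by (auto simp: orbits_def inj_on_def)
    then have r: "?r y = ?r z" by simp
    have "y \<in> ?o y" using A.orbit_refl[OF y] .
    then have ry: "?r y \<in> ?o y" by (rule someI)
    then have "?r y \<in> gs_pts Z" using A.element_image[OF _ y] by (auto simp: orbit_def)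
    then have "y \<in> ?o (?r y)" using A.orbit_sym[OF y _ ry] by blast
    then obtain g where "g \<in> gs_grp Z" "gs_act Z g (?r y) = y" by (auto simp: orbit_def)
    then show "y = z" using eq r by auto
  qed
  from ghat_set_transport[OF Z this] show ?thesis by blast
qed

definition ghat_measure ::
    "'x set \<Rightarrow> ('x \<Rightarrow> 'x) set \<Rightarrow> (('x, 'x gset_univ) gset \<Rightarrow> 'k::field) \<Rightarrow> bool" where
  "ghat_measure X G \<mu> \<longleftrightarrow>
     (\<forall>Z Z'. ghat_set X G Z \<and> ghat_set X G Z' \<and> ghat_iso X G Z Z' \<longrightarrow> \<mu> Z = \<mu> Z') \<and>
     (\<forall>Z p. ghat_set X G Z \<and> gs_pts Z = {p} \<longrightarrow> \<mu> Z = 1) \<and>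
     (\<forall>Z. \<forall>g \<in> G. ghat_set X G Z \<longrightarrow> \<mu> (conj_gset X g Z) = \<mu> Z) \<and>
     (\<forall>U Z1 Z2 f z.
        gs_grp Z1 = U \<and> smooth_gset X G Z1 \<and>
        transitive_action (perm_group X U) (gs_pts Z1) (gs_act Z1) \<and>
        gs_grp Z2 = U \<and> smooth_gset X G Z2 \<and>
        transitive_action (perm_group X U) (gs_pts Z2) (gs_act Z2) \<and>
        f \<in> gs_pts Z1 \<rightarrow> gs_pts Z2 \<and>
        (\<forall>g \<in> U. \<forall>x \<in> gs_pts Z1. f (gs_act Z1 g x) = gs_act Z2 g (f x)) \<and>
        z \<in> gs_pts Z2 \<longrightarrow>
        \<mu> Z1 = \<mu> (sub_gset (stabilizer (perm_group X U) (gs_act Z2) z)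
                     {x \<in> gs_pts Z1. f x = z} Z1) * \<mu> Z2) \<and>
     (\<forall>Z A B.
        ghat_set X G Z \<and> gs_pts Z = A \<union> B \<and> A \<inter> B = {} \<and>
        (\<forall>g \<in> gs_grp Z. gs_act Z g ` A \<subseteq> A \<and> gs_act Z g ` B \<subseteq> B) \<longrightarrow>
        \<mu> Z = \<mu> (sub_gset (gs_grp Z) A Z) + \<mu> (sub_gset (gs_grp Z) B Z))"

definition measure_of_gset ::
    "'x set \<Rightarrow> ('x \<Rightarrow> 'x) set \<Rightarrow> (('x, 'x gset_univ) gset \<Rightarrow> 'k::field) \<Rightarrow> ('x, 'z) gset \<Rightarrow> 'k" where
  "measure_of_gset X G \<mu> Z = (THE c. \<exists>Z'. ghat_set X G Z' \<and> ghat_iso X G Z Z' \<and> c = \<mu> Z')"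


lemma measure_of_gset_eq:
  assumes G: "subgroup G (BijGroup X)" and \<mu>: "ghat_measure X G \<mu>"
    and Z: "ghat_set X G Z" and Z': "ghat_set X G Z'" "ghat_iso X G Z Z'"
  shows "measure_of_gset X G \<mu> Z = \<mu> Z'"
  unfolding measure_of_gset_def
proof (rule the_equality)
  show "\<exists>Z''. ghat_set X G Z'' \<and> ghat_iso X G Z Z'' \<and> \<mu> Z' = \<mu> Z''" using Z' by blast
next
  fix c assume "\<exists>Z''. ghat_set X G Z'' \<and> ghat_iso X G Z Z'' \<and> c = \<mu> Z''"
  then obtain Z'' where Z'': "ghat_set X G Z''" "ghat_iso X G Z Z''" "c = \<mu> Z''" by blast
  have "ghat_iso X G Z'' Z'"
    using ghat_iso_trans[OF G ghat_iso_sym Z'(2)] Z Z''(2) by (auto simp: ghat_set_def)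
  moreover have "\<forall>Z Z'. ghat_set X G Z \<and> ghat_set X G Z' \<and> ghat_iso X G Z Z' \<longrightarrow> \<mu> Z = \<mu> Z'"
    using \<mu> unfolding ghat_measure_def by (elim conjE)
  ultimately show "c = \<mu> Z'" using Z''(1,3) Z'(1) by simp
qed


section \<open>Representations of \<open>sl\<^sub>2(\<complex>)\<close>\<close>

definition complex_field :: "complex ring" where
  "complex_field = \<lparr>carrier = UNIV, monoid.mult = (*), one = 1, ring.zero = 0, add = (+)\<rparr>"

definition mat_scale :: "complex \<Rightarrow> complex^2^2 \<Rightarrow> complex^2^2" where
  "mat_scale c A = (\<chi> i j. c * A $ i $ j)"

definition sl2 :: "(complex^2^2) set" where
  "sl2 = {A. trace A = 0}"

definition lie_bracket :: "complex^2^2 \<Rightarrow> complex^2^2 \<Rightarrow> complex^2^2" where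
  "lie_bracket A B = A ** B - B ** A"

definition mat_e :: "complex^2^2" where
  "mat_e = vector [vector [0, 1], vector [0, 0]]"

definition mat_f :: "complex^2^2" where
  "mat_f = vector [vector [0, 0], vector [1, 0]]"

definition mat_h :: "complex^2^2" where
  "mat_h = vector [vector [1, 0], vector [0, -1]]"

lemma sl2_basis: "A \<in> sl2 \<longleftrightarrow>
    A = mat_scale (A $ 1 $ 2) mat_e + mat_scale (A $ 2 $ 1) mat_f + mat_scale (A $ 1 $ 1) mat_h"
  by (auto simp: sl2_def trace_def mat_scale_def mat_e_def mat_f_def mat_h_def vec_eq_iff
      forall_2 UNIV_2 add_eq_0_iff)

lemma sl2_brackets:
  "lie_bracket mat_e mat_f = mat_h"
  "lie_bracket mat_h mat_e = mat_scale 2 mat_e"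
  "lie_bracket mat_h mat_f = mat_scale (-2) mat_f"
  by (auto simp: lie_bracket_def matrix_matrix_mult_def mat_scale_def mat_e_def mat_f_def
      mat_h_def vec_eq_iff forall_2 UNIV_2)

text \<open>The fields \<^const>\<open>monoid.mult\<close> and \<^const>\<open>monoid.one\<close>, which HOL-Algebra modules inherit
  from rings, are not used.\<close>

record 'v sl2_rep = "(complex, 'v) module" +
  rep_act :: "complex^2^2 \<Rightarrow> 'v \<Rightarrow> 'v"

definition sl2_module :: "'v sl2_rep \<Rightarrow> bool" where
  "sl2_module M \<longleftrightarrow>
     Module.module complex_field M \<and>
     (\<forall>A \<in> sl2. \<forall>v \<in> carrier M. rep_act M A v \<in> carrier M) \<and>
     (\<forall>A \<in> sl2. \<forall>v \<in> carrier M. \<forall>w \<in> carrier M.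
        rep_act M A (v \<oplus>\<^bsub>M\<^esub> w) = rep_act M A v \<oplus>\<^bsub>M\<^esub> rep_act M A w) \<and>
     (\<forall>A \<in> sl2. \<forall>c. \<forall>v \<in> carrier M.
        rep_act M A (c \<odot>\<^bsub>M\<^esub> v) = c \<odot>\<^bsub>M\<^esub> rep_act M A v) \<and>
     (\<forall>A \<in> sl2. \<forall>B \<in> sl2. \<forall>v \<in> carrier M.
        rep_act M (A + B) v = rep_act M A v \<oplus>\<^bsub>M\<^esub> rep_act M B v) \<and>
     (\<forall>c. \<forall>A \<in> sl2. \<forall>v \<in> carrier M.
        rep_act M (mat_scale c A) v = c \<odot>\<^bsub>M\<^esub> rep_act M A v) \<and>
     (\<forall>A \<in> sl2. \<forall>B \<in> sl2. \<forall>v \<in> carrier M.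
        rep_act M (lie_bracket A B) v =
          rep_act M A (rep_act M B v) \<ominus>\<^bsub>M\<^esub> rep_act M B (rep_act M A v))"

definition sl2_subrep :: "'v set \<Rightarrow> 'v sl2_rep \<Rightarrow> bool" where
  "sl2_subrep W M \<longleftrightarrow>
     sl2_module M \<and> submodule W complex_field M \<and>
     (\<forall>A \<in> sl2. \<forall>w \<in> W. rep_act M A w \<in> W)"

definition sl2_iso :: "'v sl2_rep \<Rightarrow> 'w sl2_rep \<Rightarrow> bool" where
  "sl2_iso M N \<longleftrightarrow>
     (\<exists>\<theta>. bij_betw \<theta> (carrier M) (carrier N) \<and>
        (\<forall>v \<in> carrier M. \<forall>w \<in> carrier M. \<theta> (v \<oplus>\<^bsub>M\<^esub> w) = \<theta> v \<oplus>\<^bsub>N\<^esub> \<theta> w) \<and>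
        (\<forall>c. \<forall>v \<in> carrier M. \<theta> (c \<odot>\<^bsub>M\<^esub> v) = c \<odot>\<^bsub>N\<^esub> \<theta> v) \<and>
        (\<forall>A \<in> sl2. \<forall>v \<in> carrier M. \<theta> (rep_act M A v) = rep_act N A (\<theta> v)))"

text \<open>The quotient \<open>M/W\<close>, whose elements are the cosets of \<open>W\<close>.  An additive operator \<open>t\<close> that
  preserves \<open>W\<close> sends the coset \<open>C = W + v\<close> to \<open>W + t(C) = W + t(v)\<close>.\<close>

definition quot_rep :: "'v sl2_rep \<Rightarrow> 'v set \<Rightarrow> ('v set) sl2_rep" where
  "quot_rep M W =
     \<lparr>carrier = a_rcosets\<^bsub>M\<^esub> W, monoid.mult = undefined, one = undefined,
      ring.zero = W, add = set_add M,
      smult = (\<lambda>c C. W <+>\<^bsub>M\<^esub> ((\<lambda>v. c \<odot>\<^bsub>M\<^esub> v) ` C)),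
      rep_act = (\<lambda>A C. W <+>\<^bsub>M\<^esub> (rep_act M A ` C))\<rparr>"


section \<open>The enveloping algebra and lowest weight Verma modules\<close>

text \<open>With concatenation as addition, lists form the free monoid, so that the convolution ring of
  finitely supported functions on lists is the free associative algebra.\<close>

instantiation list :: (type) monoid_add
begin

definition zero_list :: "'a list" where
  "zero_list = []"

definition plus_list :: "'a list \<Rightarrow> 'a list \<Rightarrow> 'a list" where
  "plus_list xs ys = xs @ ys"

instance
  by standard (simp_all add: zero_list_def plus_list_def)

end

type_synonym free_elt = "(complex^2^2) list \<Rightarrow>\<^sub>0 complex"

definition free_alg :: "free_elt ring" where
  "free_alg = \<lparr>carrier = {p. \<forall>w \<in> Poly_Mapping.keys p. set w \<subseteq> sl2},
     monoid.mult = (*), one = 1, ring.zero = 0, add = (+)\<rparr>"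

definition free_gen :: "complex^2^2 \<Rightarrow> free_elt" where
  "free_gen A = Poly_Mapping.single [A] 1"

text \<open>The first two families of relations turn the free algebra on the set underlying
  \<open>sl\<^sub>2(\<complex>)\<close> into the tensor algebra of the vector space.\<close>

definition env_rels :: "free_elt set" where
  "env_rels =
     {free_gen (A + B) - free_gen A - free_gen B | A B. A \<in> sl2 \<and> B \<in> sl2} \<union>
     {free_gen (mat_scale c A) - Poly_Mapping.single [A] c | c A. A \<in> sl2} \<union>
     {free_gen A * free_gen B - free_gen B * free_gen A - free_gen (lie_bracket A B)
        | A B. A \<in> sl2 \<and> B \<in> sl2}"

definition env_ideal :: "free_elt set" where
  "env_ideal = Idl\<^bsub>free_alg\<^esub> env_rels"

definition env_alg :: "(free_elt set) ring" where
  "env_alg = free_alg Quot env_ideal"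

definition env_class :: "free_elt \<Rightarrow> free_elt set" where
  "env_class p = env_ideal +>\<^bsub>free_alg\<^esub> p"

definition borel_minus :: "(complex^2^2) set" where
  "borel_minus = {mat_scale a mat_h + mat_scale b mat_f | a b. True}"

text \<open>The scalar by which an element of \<^const>\<open>borel_minus\<close> acts on \<open>\<complex>\<^sub>\<lambda>\<close>: the matrix \<open>a h + b f\<close>,
  whose upper left entry is \<open>a\<close>, acts by \<open>a \<lambda>\<close>.\<close>

definition borel_weight :: "complex \<Rightarrow> complex^2^2 \<Rightarrow> complex" where
  "borel_weight l A = l * A $ 1 $ 1"

text \<open>The tensor product over \<open>U(b\<^sup>-)\<close> is the free abelian group on \<open>U(sl\<^sub>2) \<times> \<complex>\<close> modulo
  biadditivity and balancing.  Balancing is imposed for the multiples \<open>c b\<^sub>1 \<cdots> b\<^sub>k\<close> of monomials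
  in elements of \<open>b\<^sup>-\<close>, which act on \<open>\<complex>\<^sub>\<lambda>\<close> by \<open>c\<close> times the product of the weights of the
  \<open>b\<^sub>i\<close> and generate \<open>U(b\<^sup>-)\<close> additively; \<open>k = 0\<close> gives the scalars.\<close>

definition verma_rels :: "complex \<Rightarrow> ((free_elt set \<times> complex) \<Rightarrow>\<^sub>0 int) set" where
  "verma_rels l =
     {frag_of (u \<oplus>\<^bsub>env_alg\<^esub> u', z) - frag_of (u, z) - frag_of (u', z)
        | u u' z. u \<in> carrier env_alg \<and> u' \<in> carrier env_alg} \<union>
     {frag_of (u, z + z') - frag_of (u, z) - frag_of (u, z')
        | u z z'. u \<in> carrier env_alg} \<union>
     {frag_of (u \<otimes>\<^bsub>env_alg\<^esub> env_class (Poly_Mapping.single bs c), z)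
        - frag_of (u, c * prod_list (map (borel_weight l) bs) * z)
        | u bs c z. u \<in> carrier env_alg \<and> set bs \<subseteq> borel_minus}"

text \<open>\<open>c\<close> and \<open>A\<close> act by left multiplication on the first factor.  Before passing to the quotient
  this is only additive.\<close>

definition verma_cover :: "((free_elt set \<times> complex) \<Rightarrow>\<^sub>0 int) sl2_rep" where
  "verma_cover =
     \<lparr>carrier = carrier (free_Abelian_group (carrier env_alg \<times> UNIV)),
      monoid.mult = undefined, one = undefined, ring.zero = 0, add = (+),
      smult = (\<lambda>c. frag_extend (\<lambda>(u, z).
        frag_of (env_class (Poly_Mapping.single [] c) \<otimes>\<^bsub>env_alg\<^esub> u, z))),
      rep_act = (\<lambda>A. frag_extend (\<lambda>(u, z).
        frag_of (env_class (free_gen A) \<otimes>\<^bsub>env_alg\<^esub> u, z)))\<rparr>"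

definition verma_minus :: "complex \<Rightarrow> (((free_elt set \<times> complex) \<Rightarrow>\<^sub>0 int) set) sl2_rep" where
  "verma_minus l = quot_rep verma_cover
     (generate (free_Abelian_group (carrier env_alg \<times> UNIV)) (verma_rels l))"


section \<open>The orbit algebra\<close>

text \<open>A map on the \<open>n\<close>-element subsets of \<open>Y\<close> is extended by \<open>0\<close> to all sets, so that the direct
  sum over \<open>n\<close> becomes a sum of functions with disjoint supports.\<close>

definition orbit_comp :: "('x, 'y) gset \<Rightarrow> nat \<Rightarrow> ('y set \<Rightarrow> complex) set" where
  "orbit_comp Y n = {v.
     (\<forall>T. T \<notin> nsets (gs_pts Y) n \<longrightarrow> v T = 0) \<and>
     (\<forall>g \<in> gs_grp Y. \<forall>T \<in> nsets (gs_pts Y) n. v (gs_act Y g ` T) = v T)}"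

definition orbit_algebra :: "('x, 'y) gset \<Rightarrow> ('y set \<Rightarrow> complex) set" where
  "orbit_algebra Y = {\<lambda>T. \<Sum>n\<le>N. v n T | N v. \<forall>n. v n \<in> orbit_comp Y n}"

definition orbit_e :: "('x, 'y) gset \<Rightarrow> ('y set \<Rightarrow> complex) \<Rightarrow> 'y set \<Rightarrow> complex" where
  "orbit_e Y v T = (if finite T \<and> T \<subseteq> gs_pts Y then \<Sum>y\<in>T. v (T - {y}) else 0)"

definition set_stab :: "('x, 'y) gset \<Rightarrow> 'y set \<Rightarrow> ('x \<Rightarrow> 'x) set" where
  "set_stab Y S = {g \<in> gs_grp Y. gs_act Y g ` S = S}"

text \<open>The open subgroup stabilizing \<open>S\<close> is taken to be the largest one, the setwise stabilizer;
  the value depends neither on this choice nor on the points chosen in the orbits.\<close>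

definition orbit_f :: "'x set \<Rightarrow> ('x \<Rightarrow> 'x) set \<Rightarrow> (('x, 'x gset_univ) gset \<Rightarrow> complex) \<Rightarrow>
    ('x, 'y) gset \<Rightarrow> ('y set \<Rightarrow> complex) \<Rightarrow> 'y set \<Rightarrow> complex" where
  "orbit_f X G \<mu> Y v S =
     (if finite S \<and> S \<subseteq> gs_pts Y
      then \<Sum>Q \<in> orbits (perm_group X (set_stab Y S)) (gs_pts Y - S) (gs_act Y).
             measure_of_gset X G \<mu> (sub_gset (set_stab Y S) Q Y) * v (S \<union> {SOME y. y \<in> Q})
      else 0)"

definition orbit_h :: "'x set \<Rightarrow> ('x \<Rightarrow> 'x) set \<Rightarrow> (('x, 'x gset_univ) gset \<Rightarrow> complex) \<Rightarrow>
    ('x, 'y) gset \<Rightarrow> ('y set \<Rightarrow> complex) \<Rightarrow> 'y set \<Rightarrow> complex" where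
  "orbit_h X G \<mu> Y v S = (2 * of_nat (card S) - measure_of_gset X G \<mu> Y) * v S"

text \<open>A traceless matrix \<open>A\<close> equals \<open>A\<^sub>1\<^sub>2 e + A\<^sub>2\<^sub>1 f + A\<^sub>1\<^sub>1 h\<close>.\<close>

definition orbit_rep :: "'x set \<Rightarrow> ('x \<Rightarrow> 'x) set \<Rightarrow> (('x, 'x gset_univ) gset \<Rightarrow> complex) \<Rightarrow>
    ('x, 'y) gset \<Rightarrow> ('y set \<Rightarrow> complex) sl2_rep" where
  "orbit_rep X G \<mu> Y =
     \<lparr>carrier = orbit_algebra Y, monoid.mult = undefined, one = undefined,
      ring.zero = (\<lambda>T. 0), add = (\<lambda>v w T. v T + w T), smult = (\<lambda>c v T. c * v T),
      rep_act = (\<lambda>A v T. A $ 1 $ 2 * orbit_e Y v T + A $ 2 $ 1 * orbit_f X G \<mu> Y v T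
                       + A $ 1 $ 1 * orbit_h X G \<mu> Y v T)\<rparr>"

definition subset_orbits :: "'x set \<Rightarrow> ('x, 'y) gset \<Rightarrow> nat \<Rightarrow> 'y set set set" where
  "subset_orbits X Y n =
     orbits (perm_group X (gs_grp Y)) (nsets (gs_pts Y) n) (\<lambda>g T. gs_act Y g ` T)"

definition shifted_ones :: "nat \<Rightarrow> nat \<Rightarrow> nat" where
  "shifted_ones d n = (if n < d then 0 else 1)"

end

theory Submission
  imports
    Defs
    "HOL-Computational_Algebra.Polynomial"
    "HOL-Library.Function_Algebras"
begin

text \<open>
  Since \<open>Y\<close> is infinite, \<open>e\<close> is injective, so the orbit algebra is a free graded \<open>\<complex>[e]\<close>-module with
  parts of finite dimension.  Choose a homogeneous basis \<open>v\<^sub>0, v\<^sub>1, \<dots>\<close> of it, ordered by degree, and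
  let \<open>F\<^sub>m\<close> be spanned by all \<open>e\<^sup>k v\<^sub>i\<close> with \<open>i < m\<close>.  Because \<open>F\<^sub>m\<close> contains everything of degree less
  than that of \<open>v\<^sub>m\<close>, the vector \<open>f v\<^sub>m\<close> lies in \<open>F\<^sub>m\<close>; hence the \<open>F\<^sub>m\<close> are subrepresentations, and
  \<open>F\<^sub>m\<^sub>+\<^sub>1/F\<^sub>m\<close> is generated freely over \<open>\<complex>[e]\<close> by a lowest weight vector.

  The measure enters only through \<open>[e, f] = h\<close>: the value of \<open>f v\<close> at \<open>S\<close> is an integral over
  \<open>Y - S\<close> with respect to a finitely additive and \<open>G\<close>-invariant measure on the subsets of \<open>Y\<close> that
  have an open stabilizer.
\<close>

section \<open>Quotients by additive subgroups\<close>

text \<open>A vector killed by \<open>f\<close> generates only a quotient of a Verma module, and for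
  a weight in {0, -1, -2, ...} there are nonzero proper quotients, on which \<open>e\<close> is
  nilpotent. So it is the injectivity of \<open>e\<close>, and through it the infinity of
  \<open>Y\<close>, that yields Verma modules for every value of the measure. The target poses a
  problem of its own: \<open>verma_minus\<close> is a quotient of a free abelian group by relations,
  over an algebra that is again given by relations, and it might be smaller than it looks. The
  explicit action of sl_2 on polynomials in one variable bounds it from below and so does the work
  of the Poincare-Birkhoff-Witt theorem; rewriting words bounds it from above. The bases of the
  graded pieces are indexed so that \<open>e\<close> keeps the index. An index then stands for a
  generator, and the number of indices present in degree \<open>n\<close> is both a dimension and a
  number of orbits, which gives the statement on sequences along with the filtration.\<close>

definition add_subgrp :: "'a::ab_group_add set \<Rightarrow> bool" where
  "add_subgrp W \<longleftrightarrow> 0 \<in> W \<and> (\<forall>x\<in>W. \<forall>y\<in>W. x - y \<in> W)"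

definition coset :: "'a::ab_group_add set \<Rightarrow> 'a \<Rightarrow> 'a set" where
  "coset W x = (\<lambda>w. w + x) ` W"

lemma add_subgrp_add:
  assumes "add_subgrp W" "x \<in> W" "y \<in> W"
  shows "x + y \<in> W"
proof -
  have "0 - y \<in> W" using assms by (auto simp: add_subgrp_def simp del: diff_0)
  then have "x - (0 - y) \<in> W" using assms by (metis add_subgrp_def)
  then show ?thesis by simp
qed

lemma coset_eq_iff:
  assumes "add_subgrp W"
  shows "coset W x = coset W y \<longleftrightarrow> x - y \<in> W"
proof
  assume "coset W x = coset W y"
  moreover have "x \<in> coset W x" using assms by (force simp: add_subgrp_def coset_def)
  ultimately show "x - y \<in> W" by (auto simp: coset_def)
next
  assume d: "x - y \<in> W"
  have "coset W u \<subseteq> coset W v" if "u - v \<in> W" for u v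
  proof
    fix z assume "z \<in> coset W u"
    then obtain w where w: "w \<in> W" "z = w + u" by (auto simp: coset_def)
    then have "w + (u - v) \<in> W" "z = (w + (u - v)) + v"
      using add_subgrp_add[OF assms w(1) that] by simp_all
    then show "z \<in> coset W v" unfolding coset_def by blast
  qed
  moreover have "y - x \<in> W"
  proof -
    have "0 - (x - y) \<in> W" using assms d unfolding add_subgrp_def by blast
    then show ?thesis by simp
  qed
  ultimately show "coset W x = coset W y" using d by blast
qed

lemma set_add_plus: "add M = (+) \<Longrightarrow> H <+>\<^bsub>M\<^esub> K = (\<Union>h\<in>H. \<Union>k\<in>K. {h + k})"
  by (simp add: set_add_def set_mult_def)

lemma set_add_coset:
  assumes "add_subgrp W" "add M = (+)"
  shows "coset W x <+>\<^bsub>M\<^esub> coset W y = coset W (x + y)"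
proof -
  have "w + x + (w' + y) \<in> coset W (x + y)" if "w \<in> W" "w' \<in> W" for w w'
    using add_subgrp_add[OF assms(1) that] unfolding coset_def
    by (intro image_eqI[of _ _ "w + w'"]) (auto simp: algebra_simps)
  moreover have "\<exists>w'\<in>W. \<exists>w''\<in>W. w + (x + y) = w' + x + (w'' + y)" if "w \<in> W" for w
    using assms(1) that by (intro bexI[of _ w] bexI[of _ 0]) (auto simp: add_subgrp_def algebra_simps)
  ultimately show ?thesis unfolding set_add_plus[OF assms(2)] coset_def by auto
qed

text \<open>This lets the operations of \<open>quot_rep\<close> be computed on representatives.
  Additivity is asked only for sums with a summand in \<open>W\<close>, because some of the
  operators are known to be additive on a carrier and not on the whole type.\<close>

lemma set_add_image_coset:
  assumes W: "add_subgrp W" and M: "add M = (+)"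
    and t: "\<And>w. w \<in> W \<Longrightarrow> t (w + x) = t w + t x" "t ` W \<subseteq> W"
  shows "W <+>\<^bsub>M\<^esub> (t ` coset W x) = coset W (t x)"
proof -
  have "w + t (w' + x) \<in> coset W (t x)" if "w \<in> W" "w' \<in> W" for w w'
    using add_subgrp_add[OF W that(1), of "t w'"] t that unfolding coset_def
    by (intro image_eqI[of _ _ "w + t w'"]) (auto simp: algebra_simps)
  moreover have "\<exists>w'\<in>W. \<exists>w''\<in>W. w + t x = w' + t (w'' + x)" if w: "w \<in> W" for w
  proof -
    have 0: "0 \<in> W" using W by (simp add: add_subgrp_def)
    then have "t 0 \<in> W" using t(2) by blast
    then have "w - t 0 \<in> W" using W w by (simp add: add_subgrp_def)
    moreover have "w + t x = (w - t 0) + t (0 + x)" using t(1)[OF 0] by (simp add: algebra_simps)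
    ultimately show ?thesis using 0 by blast
  qed
  ultimately show ?thesis unfolding set_add_plus[OF M] coset_def by auto
qed

lemma quot_rep_simps:
  assumes "add M = (+)"
  shows "carrier (quot_rep M W) = coset W ` carrier M"
    "add (quot_rep M W) = set_add M"
    "smult (quot_rep M W) c C = W <+>\<^bsub>M\<^esub> ((\<lambda>v. c \<odot>\<^bsub>M\<^esub> v) ` C)"
    "rep_act (quot_rep M W) A C = W <+>\<^bsub>M\<^esub> (rep_act M A ` C)"
proof -
  have "(\<Union>h\<in>W. {h + x}) = coset W x" for x by (auto simp: coset_def)
  then show "carrier (quot_rep M W) = coset W ` carrier M"
    by (auto simp: quot_rep_def A_RCOSETS_def RCOSETS_def r_coset_def assms)
qed (simp_all add: quot_rep_def)

lemma sl2_iso_trans: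
  assumes "sl2_iso L M" "sl2_iso M N"
  shows "sl2_iso L N"
proof -
  obtain \<theta> where \<theta>: "bij_betw \<theta> (carrier L) (carrier M)"
    "\<forall>v\<in>carrier L. \<forall>w\<in>carrier L. \<theta> (v \<oplus>\<^bsub>L\<^esub> w) = \<theta> v \<oplus>\<^bsub>M\<^esub> \<theta> w"
    "\<forall>c. \<forall>v\<in>carrier L. \<theta> (c \<odot>\<^bsub>L\<^esub> v) = c \<odot>\<^bsub>M\<^esub> \<theta> v"
    "\<forall>A\<in>sl2. \<forall>v\<in>carrier L. \<theta> (rep_act L A v) = rep_act M A (\<theta> v)"
    using assms(1) unfolding sl2_iso_def by blast
  obtain \<eta> where \<eta>: "bij_betw \<eta> (carrier M) (carrier N)"
    "\<forall>v\<in>carrier M. \<forall>w\<in>carrier M. \<eta> (v \<oplus>\<^bsub>M\<^esub> w) = \<eta> v \<oplus>\<^bsub>N\<^esub> \<eta> w"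
    "\<forall>c. \<forall>v\<in>carrier M. \<eta> (c \<odot>\<^bsub>M\<^esub> v) = c \<odot>\<^bsub>N\<^esub> \<eta> v"
    "\<forall>A\<in>sl2. \<forall>v\<in>carrier M. \<eta> (rep_act M A v) = rep_act N A (\<eta> v)"
    using assms(2) unfolding sl2_iso_def by blast
  have "\<theta> v \<in> carrier M" if "v \<in> carrier L" for v using that \<theta>(1) bij_betwE by blast
  then show ?thesis unfolding sl2_iso_def
    using bij_betw_trans[OF \<theta>(1) \<eta>(1)] \<theta>(2-) \<eta>(2-) by (intro exI[of _ "\<eta> \<circ> \<theta>"]) simp
qed

text \<open>First isomorphism theorem. The hypotheses are just the laws that make the coset
  operations well defined, so that it applies to a structure obtained by replacing a
  carrier.\<close>

lemma sl2_iso_quot_rep: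
  fixes M :: "'v::ab_group_add sl2_rep" and N :: "'w::ab_group_add sl2_rep"
  assumes M: "add M = (+)" and N: "add N = (+)"
    and sub: "add_subgrp (carrier M)"
    and sm: "\<And>c v. v \<in> carrier M \<Longrightarrow> c \<odot>\<^bsub>M\<^esub> v \<in> carrier M"
      "\<And>c v w. v \<in> carrier M \<Longrightarrow> w \<in> carrier M \<Longrightarrow> c \<odot>\<^bsub>M\<^esub> (v + w) = c \<odot>\<^bsub>M\<^esub> v + c \<odot>\<^bsub>M\<^esub> w"
    and ac: "\<And>A v. A \<in> sl2 \<Longrightarrow> v \<in> carrier M \<Longrightarrow> rep_act M A v \<in> carrier M"
      "\<And>A v w. A \<in> sl2 \<Longrightarrow> v \<in> carrier M \<Longrightarrow> w \<in> carrier M \<Longrightarrow>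
         rep_act M A (v + w) = rep_act M A v + rep_act M A w"
    and T: "T ` carrier M = carrier N"
      "\<And>v w. v \<in> carrier M \<Longrightarrow> w \<in> carrier M \<Longrightarrow> T (v + w) = T v + T w"
      "\<And>c v. v \<in> carrier M \<Longrightarrow> T (c \<odot>\<^bsub>M\<^esub> v) = c \<odot>\<^bsub>N\<^esub> T v"
      "\<And>A v. A \<in> sl2 \<Longrightarrow> v \<in> carrier M \<Longrightarrow> T (rep_act M A v) = rep_act N A (T v)"
    and W: "W = {v \<in> carrier M. T v = 0}"
    and N0: "\<And>c. c \<odot>\<^bsub>N\<^esub> 0 = 0" "\<And>A. A \<in> sl2 \<Longrightarrow> rep_act N A 0 = 0"
  shows "sl2_iso (quot_rep M W) N"
proof -
  have 0: "0 \<in> carrier M" using sub by (simp add: add_subgrp_def)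
  have T0: "T 0 = 0" using T(2)[OF 0 0] by simp
  have Tdiff: "T (v - w) = T v - T w" if "v \<in> carrier M" "w \<in> carrier M" for v w
  proof -
    have "v - w \<in> carrier M" using that sub by (simp add: add_subgrp_def)
    from T(2)[OF this that(2)] show ?thesis by (simp add: algebra_simps)
  qed
  have Wsub: "add_subgrp W"
    using sub Tdiff T0 unfolding add_subgrp_def W by auto
  have WM: "W \<subseteq> carrier M" by (auto simp: W)
  \<comment> \<open>\<open>T\<close> is constant on each coset of its kernel, so the image of a
    coset is a singleton.\<close>
  define \<theta> where "\<theta> C = the_elem (T ` C)" for C
  have \<theta>: "\<theta> (coset W x) = T x" if "x \<in> carrier M" for x
  proof -
    have "T (w + x) = T x" if "w \<in> W" for w
      using that \<open>x \<in> carrier M\<close> T(2)[of w x] by (auto simp: W)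
    moreover have "W \<noteq> {}" using Wsub by (auto simp: add_subgrp_def)
    ultimately have "T ` coset W x = {T x}" by (auto simp: coset_def image_image)
    then show ?thesis by (simp add: \<theta>_def)
  qed
  have smW: "c \<odot>\<^bsub>quot_rep M W\<^esub> coset W x = coset W (c \<odot>\<^bsub>M\<^esub> x)" if "x \<in> carrier M" for c x
    unfolding quot_rep_simps[OF M]
    using sm WM T(3) N0 that by (intro set_add_image_coset[OF Wsub M]) (auto simp: W)
  have acW: "rep_act (quot_rep M W) A (coset W x) = coset W (rep_act M A x)"
    if "A \<in> sl2" "x \<in> carrier M" for A x
    unfolding quot_rep_simps[OF M]
    using ac WM T(4) N0 that by (intro set_add_image_coset[OF Wsub M]) (auto simp: W)
  have adW: "coset W x \<oplus>\<^bsub>quot_rep M W\<^esub> coset W y = coset W (x + y)" for x y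
    unfolding quot_rep_simps[OF M] using set_add_coset[OF Wsub M] .
  have inj: "inj_on \<theta> (coset W ` carrier M)"
  proof (rule inj_onI, clarify)
    fix x y assume xy: "x \<in> carrier M" "y \<in> carrier M" "\<theta> (coset W x) = \<theta> (coset W y)"
    have "x - y \<in> carrier M" using xy(1,2) sub by (simp add: add_subgrp_def)
    then have "x - y \<in> W" using xy \<theta> Tdiff by (simp add: W)
    then show "coset W x = coset W y" by (simp add: coset_eq_iff[OF Wsub])
  qed
  have "bij_betw \<theta> (carrier (quot_rep M W)) (carrier N)"
    unfolding bij_betw_def quot_rep_simps[OF M] using inj T(1) \<theta> by (auto simp: image_image)
  moreover have "x + y \<in> carrier M" if "x \<in> carrier M" "y \<in> carrier M" for x y
    using add_subgrp_add[OF sub that] .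
  ultimately show ?thesis unfolding sl2_iso_def
    by (intro exI[of _ \<theta>] conjI ballI allI)
      (auto simp: quot_rep_simps(1)[OF M] smW acW adW \<theta> T(2-) N sm ac)
qed

lemma keys_induct [consumes 1, case_names zero single add]:
  fixes p :: "'a \<Rightarrow>\<^sub>0 'b::comm_monoid_add"
  assumes "Poly_Mapping.keys p \<subseteq> S"
    and 0: "P 0" and 1: "\<And>k c. k \<in> S \<Longrightarrow> P (Poly_Mapping.single k c)"
    and add: "\<And>p q. Poly_Mapping.keys p \<subseteq> S \<Longrightarrow> Poly_Mapping.keys q \<subseteq> S \<Longrightarrow> P p \<Longrightarrow> P q \<Longrightarrow> P (p + q)"
  shows "P p"
proof -
  let ?f = "\<lambda>k. Poly_Mapping.single k (Poly_Mapping.lookup p k)"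
  have "P (\<Sum>k\<in>K. ?f k) \<and> Poly_Mapping.keys (\<Sum>k\<in>K. ?f k) \<subseteq> S" if "finite K" "K \<subseteq> S" for K
    using that
  proof induction
    case empty then show ?case using 0 by simp
  next
    case (insert k K)
    then show ?case using add[of "?f k" "\<Sum>k\<in>K. ?f k"] 1[of k] keys_add[of "?f k" "\<Sum>k\<in>K. ?f k"]
      by (auto split: if_splits)
  qed
  moreover have "(\<Sum>k\<in>Poly_Mapping.keys p. ?f k) = p"
    by (rule poly_mapping_eqI)
      (auto simp: lookup_sum lookup_single when_def in_keys_iff)
  ultimately show ?thesis using assms(1) finite_keys[of p] by metis
qed

section \<open>The polynomial model of the Verma module\<close>

abbreviation psmult :: "'a::comm_semiring_0 \<Rightarrow> 'a poly \<Rightarrow> 'a poly" where "psmult \<equiv> Polynomial.smult"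

lemma sl2_entries: "A \<in> sl2 \<Longrightarrow> A $ 2 $ 2 = - A $ 1 $ 1"
  by (simp add: sl2_def trace_def UNIV_2 add_eq_0_iff2)

lemma lie_bracket_entries:
  "lie_bracket A B $ i $ j = A $ i $ 1 * B $ 1 $ j + A $ i $ 2 * B $ 2 $ j
     - (B $ i $ 1 * A $ 1 $ j + B $ i $ 2 * A $ 2 $ j)"
  by (simp add: lie_bracket_def matrix_matrix_mult_def UNIV_2)

lemma sl2_closed:
  "mat_e \<in> sl2" "mat_f \<in> sl2" "mat_h \<in> sl2" "A \<in> sl2 \<Longrightarrow> B \<in> sl2 \<Longrightarrow> A + B \<in> sl2"
  "A \<in> sl2 \<Longrightarrow> mat_scale c A \<in> sl2" "A \<in> sl2 \<Longrightarrow> B \<in> sl2 \<Longrightarrow> lie_bracket A B \<in> sl2"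
  by (auto simp: sl2_def trace_def UNIV_2 mat_e_def mat_f_def mat_h_def mat_scale_def
      lie_bracket_entries add_eq_0_iff2)

lemma mat_entries:
  "mat_e $ 1 $ 1 = 0" "mat_e $ 1 $ 2 = 1" "mat_e $ 2 $ 1 = 0"
  "mat_f $ 1 $ 1 = 0" "mat_f $ 1 $ 2 = 0" "mat_f $ 2 $ 1 = 1"
  "mat_h $ 1 $ 1 = 1" "mat_h $ 1 $ 2 = 0" "mat_h $ 2 $ 1 = 0"
  "mat_scale c A $ i $ j = c * A $ i $ j"
  by (simp_all add: mat_e_def mat_f_def mat_h_def mat_scale_def)

text \<open>The bracket is bilinear, so the relations between basis elements suffice. They are
  assumed at the single vector \<open>v\<close>, since linearity never moves them to another one; in
  the orbit algebra they will hold on a subspace of all functions only.\<close>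

lemma sl2_comb_bracket:
  fixes scale' :: "complex \<Rightarrow> 'b::ab_group_add \<Rightarrow> 'b"
  assumes "Vector_Spaces.linear scale' scale' e" "Vector_Spaces.linear scale' scale' f"
    "Vector_Spaces.linear scale' scale' h"
    and rel: "e (f v) - f (e v) = h v" "h (e v) - e (h v) = scale' 2 (e v)"
      "h (f v) - f (h v) = scale' (- 2) (f v)"
    and AB: "A \<in> sl2" "B \<in> sl2"
  defines "\<rho> \<equiv> \<lambda>A v. scale' (A $ 1 $ 2) (e v) + scale' (A $ 2 $ 1) (f v) + scale' (A $ 1 $ 1) (h v)"
  shows "\<rho> (lie_bracket A B) v = \<rho> A (\<rho> B v) - \<rho> B (\<rho> A v)"
proof -
  interpret E: Vector_Spaces.linear scale' scale' e by fact
  interpret F: Vector_Spaces.linear scale' scale' f by fact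
  interpret H: Vector_Spaces.linear scale' scale' h by fact
  note sc = E.vs1.scale_left_distrib E.vs1.scale_right_distrib E.vs1.scale_left_diff_distrib
    E.vs1.scale_right_diff_distrib E.vs1.scale_minus_left E.vs1.scale_minus_right
  have two: "scale' 2 x = x + x" "scale' (- 2) x = - x - x" "scale' (2 * c) x = scale' c x + scale' c x" for x c
    using E.vs1.scale_left_distrib[of 1 1 x] E.vs1.scale_left_distrib[of c c x]
    by (simp_all add: E.vs1.scale_minus_left)
  have r: "e (f v) = f (e v) + h v" "h (e v) = e (h v) + e v + e v"
    "h (f v) = f (h v) - f v - f v"
    using rel by (simp_all add: two algebra_simps)
  show ?thesis
    by (simp add: \<rho>_def lie_bracket_entries sl2_entries AB E.add F.add H.add E.scale F.scale
        H.scale r sc two algebra_simps)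
qed

text \<open>The monomial \<open>x^k\<close> plays the role of \<open>e^k \<otimes> 1\<close>, so that \<open>e\<close> is multiplication by \<open>x\<close>,
  \<open>h x^k = (l + 2 k) x^k\<close> and \<open>f x^k = - k (l + k - 1) x^(k - 1)\<close>.\<close>

definition verma_h :: "complex \<Rightarrow> complex poly \<Rightarrow> complex poly" where
  "verma_h l p = psmult l p + psmult 2 (pCons 0 (pderiv p))"

definition verma_f :: "complex \<Rightarrow> complex poly \<Rightarrow> complex poly" where
  "verma_f l p = - psmult l (pderiv p) - pCons 0 (pderiv (pderiv p))"

definition poly_act :: "complex \<Rightarrow> complex^2^2 \<Rightarrow> complex poly \<Rightarrow> complex poly" where
  "poly_act l A p =
     psmult (A $ 1 $ 2) (pCons 0 p) + psmult (A $ 2 $ 1) (verma_f l p) + psmult (A $ 1 $ 1) (verma_h l p)"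

definition poly_rep :: "complex \<Rightarrow> complex poly sl2_rep" where
  "poly_rep l = \<lparr>carrier = UNIV, monoid.mult = undefined, one = undefined, ring.zero = 0,
     add = (+), smult = psmult, rep_act = poly_act l\<rparr>"

lemma vector_space_smult: "vector_space (psmult :: 'a::field \<Rightarrow> 'a poly \<Rightarrow> 'a poly)"
  by unfold_locales (simp_all add: smult_add_right smult_add_left)

lemma linear_smultI:
  fixes g :: "complex poly \<Rightarrow> complex poly"
  assumes "\<And>p q. g (p + q) = g p + g q" "\<And>c p. g (psmult c p) = psmult c (g p)"
  shows "Vector_Spaces.linear psmult psmult g"
  using assms vector_space_smult by (simp add: Vector_Spaces.linear_iff)

lemma linear_verma:
  "Vector_Spaces.linear psmult psmult (pCons (0::complex))"
  "Vector_Spaces.linear psmult psmult (verma_f l)"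
  "Vector_Spaces.linear psmult psmult (verma_h l)"
  by (auto intro!: linear_smultI simp: verma_f_def verma_h_def pderiv_add pderiv_smult
      smult_add_right smult_diff_right algebra_simps)

lemma poly_act_add: "poly_act l A (p + q) = poly_act l A p + poly_act l A q"
  by (simp add: poly_act_def verma_f_def verma_h_def pderiv_add smult_add_right smult_diff_right
      algebra_simps)

lemma poly_act_smult: "poly_act l A (psmult c p) = psmult c (poly_act l A p)"
  by (simp add: poly_act_def verma_f_def verma_h_def pderiv_smult smult_add_right smult_diff_right
      algebra_simps)

lemma poly_act_0: "poly_act l A 0 = 0"
  using poly_act_smult[of l A 0 0] by simp

text \<open>The factor \<open>(n + 1) (l + n)\<close> is the sum of the weights
  \<open>l + 2 j\<close> for \<open>j \<le> n\<close>, which \<open>h\<close> contributes when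
  \<open>f\<close> is moved past \<open>n + 1\<close> copies of \<open>e\<close>. On coefficients
  the sl_2 relations become arithmetic.\<close>

lemma coeff_verma:
  "coeff (verma_f l p) n = - of_nat (Suc n) * (l + of_nat n) * coeff p (Suc n)"
  "coeff (verma_h l p) n = (l + 2 * of_nat n) * coeff p n"
  by (cases n; simp add: verma_f_def verma_h_def coeff_pderiv algebra_simps)+

lemma verma_rels_poly:
  "pCons 0 (verma_f l p) - verma_f l (pCons 0 p) = verma_h l p"
  "verma_h l (pCons 0 p) - pCons 0 (verma_h l p) = psmult 2 (pCons 0 p)"
  "verma_h l (verma_f l p) - verma_f l (verma_h l p) = psmult (- 2) (verma_f l p)"
proof -
  show "pCons 0 (verma_f l p) - verma_f l (pCons 0 p) = verma_h l p"
    by (rule poly_eqI, case_tac n) (simp_all add: coeff_verma algebra_simps)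
  show "verma_h l (pCons 0 p) - pCons 0 (verma_h l p) = psmult 2 (pCons 0 p)"
    by (rule poly_eqI, case_tac n) (simp_all add: coeff_verma algebra_simps)
  show "verma_h l (verma_f l p) - verma_f l (verma_h l p) = psmult (- 2) (verma_f l p)"
    by (rule poly_eqI, case_tac n) (simp_all add: coeff_verma algebra_simps)
qed

lemma poly_act_bracket:
  assumes "A \<in> sl2" "B \<in> sl2"
  shows "poly_act l (lie_bracket A B) p = poly_act l A (poly_act l B p) - poly_act l B (poly_act l A p)"
  using sl2_comb_bracket[where e = "pCons 0" and f = "verma_f l" and h = "verma_h l" and v = p
      and scale' = psmult, OF linear_verma(1) linear_verma(2,3) verma_rels_poly assms]
  unfolding poly_act_def by simp

section \<open>The free algebra acting on polynomials\<close>

definition word_act :: "complex \<Rightarrow> free_elt \<Rightarrow> complex poly \<Rightarrow> complex poly" where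
  "word_act l p q = (\<Sum>w\<in>Poly_Mapping.keys p. psmult (Poly_Mapping.lookup p w) (foldr (poly_act l) w q))"

lemma word_act_plus: "word_act l (p + p') q = word_act l p q + word_act l p' q"
  unfolding word_act_def by (rule setsum_keys_plus_distrib) (simp_all add: smult_add_left)

lemma word_act_zero [simp]: "word_act l 0 q = 0"
  by (simp add: word_act_def)

lemma word_act_single: "word_act l (Poly_Mapping.single w c) q = psmult c (foldr (poly_act l) w q)"
  by (simp add: word_act_def)

lemma word_act_minus: "word_act l (p - p') q = word_act l p q - word_act l p' q"
  using word_act_plus[of l "p - p'" p' q] by simp

lemma foldr_poly_act:
  "foldr (poly_act l) w (p + q) = foldr (poly_act l) w p + foldr (poly_act l) w q"
  "foldr (poly_act l) w (psmult c q) = psmult c (foldr (poly_act l) w q)"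
  by (induction w) (simp_all add: poly_act_add poly_act_smult)

lemma psmult_sum: "psmult c (sum f S) = (\<Sum>i\<in>S. psmult c (f i))"
  by (induction S rule: infinite_finite_induct) (simp_all add: smult_add_right)

lemma word_act_linear:
  "word_act l p (q + q') = word_act l p q + word_act l p q'"
  "word_act l p (psmult c q) = psmult c (word_act l p q)"
  by (simp_all add: word_act_def foldr_poly_act smult_add_right sum.distrib psmult_sum mult.commute)

lemma word_act_zero_right [simp]: "word_act l p 0 = 0"
  using word_act_linear(2)[of l p 0 0] by simp

text \<open>The last letter of a word acts first, so concatenation of words is composition of
  operators.\<close>

lemma word_act_mult: "word_act l (p * p') q = word_act l p (word_act l p' q)"
  using subset_UNIV
proof (induction p rule: keys_induct)
  case (single w c)
  show ?case using subset_UNIV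
    by (induction p' rule: keys_induct)
      (simp_all add: mult_single word_act_single plus_list_def foldr_poly_act distrib_left
        word_act_plus word_act_linear smult_add_right mult.commute)
qed (simp_all add: distrib_right word_act_plus)

section \<open>The enveloping algebra as a quotient of the free algebra\<close>

lemma carrier_free_alg: "p \<in> carrier free_alg \<longleftrightarrow> Poly_Mapping.keys p \<subseteq> {w. set w \<subseteq> sl2}"
  by (auto simp: free_alg_def)

lemma free_alg_simps [simp]:
  "\<zero>\<^bsub>free_alg\<^esub> = 0" "\<one>\<^bsub>free_alg\<^esub> = 1" "p \<oplus>\<^bsub>free_alg\<^esub> q = p + q" "p \<otimes>\<^bsub>free_alg\<^esub> q = p * q"
  by (simp_all add: free_alg_def)

lemma free_alg_closed:
  "0 \<in> carrier free_alg" "1 \<in> carrier free_alg"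
  "p \<in> carrier free_alg \<Longrightarrow> q \<in> carrier free_alg \<Longrightarrow> p + q \<in> carrier free_alg"
  "p \<in> carrier free_alg \<Longrightarrow> q \<in> carrier free_alg \<Longrightarrow> p - q \<in> carrier free_alg"
  "p \<in> carrier free_alg \<Longrightarrow> - p \<in> carrier free_alg"
  "p \<in> carrier free_alg \<Longrightarrow> q \<in> carrier free_alg \<Longrightarrow> p * q \<in> carrier free_alg"
  "set w \<subseteq> sl2 \<Longrightarrow> Poly_Mapping.single w c \<in> carrier free_alg"
proof -
  have k: "Poly_Mapping.keys (p - q) \<subseteq> Poly_Mapping.keys p \<union> Poly_Mapping.keys q" for p q :: free_elt
    by (auto simp: in_keys_iff lookup_minus)
  have m: "Poly_Mapping.keys (- p) = Poly_Mapping.keys p" for p :: free_elt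
    by (auto simp: in_keys_iff)
  show "p \<in> carrier free_alg \<Longrightarrow> q \<in> carrier free_alg \<Longrightarrow> p + q \<in> carrier free_alg"
    using keys_add[of p q] by (auto simp: carrier_free_alg)
  show "p \<in> carrier free_alg \<Longrightarrow> q \<in> carrier free_alg \<Longrightarrow> p - q \<in> carrier free_alg"
    using k[of p q] by (auto simp: carrier_free_alg)
  show "p \<in> carrier free_alg \<Longrightarrow> - p \<in> carrier free_alg"
    using m[of p] by (auto simp: carrier_free_alg)
  show "p \<in> carrier free_alg \<Longrightarrow> q \<in> carrier free_alg \<Longrightarrow> p * q \<in> carrier free_alg"
    using keys_mult[of p q] by (fastforce simp: carrier_free_alg plus_list_def)
qed (auto simp: carrier_free_alg zero_list_def)

lemma free_gen_closed: "A \<in> sl2 \<Longrightarrow> free_gen A \<in> carrier free_alg"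
  by (simp add: free_gen_def free_alg_closed)

lemma ring_free_alg: "ring free_alg"
proof (rule ringI)
  show "abelian_group free_alg"
  proof (rule abelian_groupI)
    fix x assume "x \<in> carrier free_alg"
    then show "\<exists>y\<in>carrier free_alg. y \<oplus>\<^bsub>free_alg\<^esub> x = \<zero>\<^bsub>free_alg\<^esub>"
      by (intro bexI[of _ "- x"]) (simp_all add: free_alg_closed)
  qed (simp_all add: free_alg_closed algebra_simps)
  show "Group.monoid free_alg"
    by (rule monoidI) (simp_all add: free_alg_closed algebra_simps)
qed (simp_all add: algebra_simps)

lemma env_rels_closed: "env_rels \<subseteq> carrier free_alg"
  unfolding env_rels_def
  by (auto intro!: free_alg_closed free_gen_closed sl2_closed)

lemma ideal_env_ideal: "ideal env_ideal free_alg"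
  unfolding env_ideal_def by (rule ring.genideal_ideal[OF ring_free_alg env_rels_closed])

lemma env_ideal_mult:
  "p \<in> env_ideal \<Longrightarrow> q \<in> carrier free_alg \<Longrightarrow> p * q \<in> env_ideal"
  "p \<in> env_ideal \<Longrightarrow> q \<in> carrier free_alg \<Longrightarrow> q * p \<in> env_ideal"
  using ideal.I_r_closed[OF ideal_env_ideal] ideal.I_l_closed[OF ideal_env_ideal] by auto

lemma env_ideal_closed: "p \<in> env_ideal \<Longrightarrow> p \<in> carrier free_alg"
  using ideal.Icarr[OF ideal_env_ideal] .

lemma ring_env_alg: "ring env_alg"
  unfolding env_alg_def by (rule ideal.quotient_is_ring[OF ideal_env_ideal])

lemma env_rels_ideal: "r \<in> env_rels \<Longrightarrow> r \<in> env_ideal"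
  unfolding env_ideal_def using ring.genideal_self[OF ring_free_alg env_rels_closed] by blast

lemma add_subgrp_env_ideal: "add_subgrp env_ideal"
proof -
  have "0 \<in> env_ideal"
    using additive_subgroup.zero_closed[OF ideal.axioms(1)[OF ideal_env_ideal]] by simp
  moreover have "x - y \<in> env_ideal" if "x \<in> env_ideal" "y \<in> env_ideal" for x y
  proof -
    have "(-1) * y \<in> env_ideal"
      using that by (intro env_ideal_mult) (simp_all add: free_alg_closed)
    then have "x \<oplus>\<^bsub>free_alg\<^esub> ((-1) * y) \<in> env_ideal"
      using additive_subgroup.a_closed[OF ideal.axioms(1)[OF ideal_env_ideal]] that by blast
    then show ?thesis by simp
  qed
  ultimately show ?thesis by (auto simp: add_subgrp_def)
qed

lemma env_class_coset: "env_class p = coset env_ideal p"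
  by (auto simp: env_class_def coset_def a_r_coset_def')

lemma env_class_eq_iff: "env_class p = env_class q \<longleftrightarrow> p - q \<in> env_ideal"
  by (simp add: env_class_coset coset_eq_iff[OF add_subgrp_env_ideal])

lemma carrier_env_alg: "carrier env_alg = env_class ` carrier free_alg"
  by (auto simp: env_alg_def FactRing_def A_RCOSETS_def RCOSETS_def env_class_def a_r_coset_def simp del: free_alg_simps)

lemma env_class_ring_hom: "env_class \<in> ring_hom free_alg env_alg"
proof -
  have "env_class = (+>\<^bsub>free_alg\<^esub>) env_ideal" by (simp add: fun_eq_iff env_class_def)
  then show ?thesis using ideal.rcos_ring_hom[OF ideal_env_ideal] by (simp add: env_alg_def)
qed

lemma env_class_add:
  "p \<in> carrier free_alg \<Longrightarrow> q \<in> carrier free_alg \<Longrightarrow>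
     env_class p \<oplus>\<^bsub>env_alg\<^esub> env_class q = env_class (p + q)"
  using ring_hom_add[OF env_class_ring_hom] by simp

lemma env_class_mult:
  "p \<in> carrier free_alg \<Longrightarrow> q \<in> carrier free_alg \<Longrightarrow>
     env_class p \<otimes>\<^bsub>env_alg\<^esub> env_class q = env_class (p * q)"
  using ring_hom_mult[OF env_class_ring_hom] by simp

lemma env_class_closed: "p \<in> carrier free_alg \<Longrightarrow> env_class p \<in> carrier env_alg"
  by (simp add: carrier_env_alg)

lemma borel_minus_sl2: "borel_minus \<subseteq> sl2"
  by (auto simp: borel_minus_def intro!: sl2_closed)

text \<open>The commutator relations die because the polynomials form a representation, the other
  two families because \<open>poly_act\<close> is linear in the matrix.\<close>

lemma word_act_env_rels: "r \<in> env_rels \<Longrightarrow> word_act l r q = 0"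
  unfolding env_rels_def
  by (auto simp: word_act_minus word_act_mult free_gen_def word_act_single poly_act_bracket)
    (auto simp: poly_act_def mat_entries algebra_simps smult_add_left smult_add_right)

lemma word_act_env_ideal:
  assumes "p \<in> env_ideal"
  shows "word_act l p q = 0"
proof -
  \<comment> \<open>Annihilating every polynomial, and not merely 1, makes \<open>?K\<close> closed
    under multiplication from both sides.\<close>
  let ?K = "{p \<in> carrier free_alg. \<forall>q. word_act l p q = 0}"
  interpret ring free_alg by (rule ring_free_alg)
  have "ideal ?K free_alg"
  proof (rule idealI[OF ring_free_alg])
    show "subgroup ?K (add_monoid free_alg)"
    proof (rule add.subgroupI)
      fix a assume a: "a \<in> ?K"
      have "\<ominus>\<^bsub>free_alg\<^esub> a = - a"
        by (rule minus_equality) (use a in \<open>simp_all add: free_alg_closed\<close>)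
      then show "\<ominus>\<^bsub>free_alg\<^esub> a \<in> ?K"
        using a word_act_minus[of l 0 a] by (simp add: free_alg_closed)
    qed (auto simp: free_alg_closed word_act_plus intro!: exI[of _ 0])
  qed (auto simp: free_alg_closed word_act_mult)
  moreover have "env_rels \<subseteq> ?K"
    using env_rels_closed word_act_env_rels by blast
  ultimately have "env_ideal \<subseteq> ?K" unfolding env_ideal_def by (rule genideal_minimal)
  then show ?thesis using assms by blast
qed

section \<open>Lower bound: evaluating the tensor product in polynomials\<close>

definition class_act :: "complex \<Rightarrow> free_elt set \<Rightarrow> complex poly" where
  "class_act l u = word_act l (SOME p. p \<in> u) 1"

lemma class_act: "class_act l (env_class p) = word_act l p 1"
proof -
  have "p \<in> env_class p"
    using add_subgrp_env_ideal by (force simp: env_class_coset coset_def add_subgrp_def)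
  then have "(SOME p'. p' \<in> env_class p) \<in> env_class p" by (rule someI)
  then obtain i where "i \<in> env_ideal" "(SOME p'. p' \<in> env_class p) = i + p"
    by (auto simp: env_class_coset coset_def)
  then show ?thesis by (simp add: class_act_def word_act_plus word_act_env_ideal)
qed

text \<open>The additive map that sends the generator \<open>(u, z)\<close> to \<open>z\<close>
  times the result of applying \<open>u\<close> to the polynomial 1. It vanishes on the relations
  and therefore separates elements of the Verma module.\<close>

definition verma_eval :: "complex \<Rightarrow> ((free_elt set \<times> complex) \<Rightarrow>\<^sub>0 int) \<Rightarrow> complex poly" where
  "verma_eval l x = (\<Sum>k\<in>Poly_Mapping.keys x.
     psmult (of_int (Poly_Mapping.lookup x k) * snd k) (class_act l (fst k)))"

lemma verma_eval_add: "verma_eval l (x + y) = verma_eval l x + verma_eval l y"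
  unfolding verma_eval_def
  by (rule setsum_keys_plus_distrib) (simp_all add: smult_add_left algebra_simps)

lemma verma_eval_0 [simp]: "verma_eval l 0 = 0"
  by (simp add: verma_eval_def)

lemma verma_eval_diff: "verma_eval l (x - y) = verma_eval l x - verma_eval l y"
  using verma_eval_add[of l "x - y" y] by simp

lemma verma_eval_frag_of: "verma_eval l (frag_of (env_class p, z)) = psmult z (word_act l p 1)"
  by (simp add: verma_eval_def class_act)

text \<open>Derivatives kill constants, so \<open>f\<close> acts on them by 0 and \<open>h\<close>
  by \<open>l\<close>: the constants are a copy of the one-dimensional representation that is
  induced up. This is what makes the evaluation respect balancing.\<close>

lemma foldr_poly_act_borel:
  assumes "set bs \<subseteq> borel_minus"
  shows "foldr (poly_act l) bs 1 = [:prod_list (map (borel_weight l) bs):]"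
  using assms
proof (induction bs)
  case (Cons b bs)
  then have "b $ 1 $ 2 = 0" by (auto simp: borel_minus_def mat_entries)
  then show ?case using Cons
    by (simp add: poly_act_def verma_f_def verma_h_def borel_weight_def pderiv_pCons)
qed (simp add: one_pCons)

abbreviation verma_group :: "((free_elt set \<times> complex) \<Rightarrow>\<^sub>0 int) monoid" where
  "verma_group \<equiv> free_Abelian_group (carrier env_alg \<times> UNIV)"

lemma verma_rels_closed: "verma_rels l \<subseteq> carrier verma_group"
proof -
  interpret ring env_alg by (rule ring_env_alg)
  have k: "Poly_Mapping.keys (frag_of a - frag_of b) \<subseteq> {a, b}"
    "Poly_Mapping.keys (frag_of a - frag_of b - frag_of c) \<subseteq> {a, b, c}"
    for a b c :: "free_elt set \<times> complex"
    by (auto simp: in_keys_iff lookup_minus split: if_splits)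
  have e: "set bs \<subseteq> borel_minus \<Longrightarrow> env_class (Poly_Mapping.single bs c) \<in> carrier env_alg" for bs c
    using borel_minus_sl2 by (intro env_class_closed free_alg_closed) auto
  show ?thesis
    unfolding verma_rels_def
    by (auto dest!: subsetD[OF k(1)] subsetD[OF k(2)] simp: e)
qed

definition verma_sub :: "complex \<Rightarrow> ((free_elt set \<times> complex) \<Rightarrow>\<^sub>0 int) set" where
  "verma_sub l = generate verma_group (verma_rels l)"

lemma verma_sub_keys: "x \<in> verma_sub l \<Longrightarrow> Poly_Mapping.keys x \<subseteq> carrier env_alg \<times> UNIV"
  using group.generate_in_carrier[OF group_free_Abelian_group verma_rels_closed, of x l]
  by (simp add: verma_sub_def)

lemma verma_sub_incl: "r \<in> verma_rels l \<Longrightarrow> r \<in> verma_sub l"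
  unfolding verma_sub_def by (rule generate.incl)

lemma add_subgrp_verma_sub: "add_subgrp (verma_sub l)"
proof -
  have s: "subgroup (verma_sub l) verma_group"
    unfolding verma_sub_def
    by (rule group.generate_is_subgroup[OF group_free_Abelian_group verma_rels_closed])
  have "x - y \<in> verma_sub l" if "x \<in> verma_sub l" "y \<in> verma_sub l" for x y
    using subgroup.m_closed[OF s that(1) subgroup.m_inv_closed[OF s that(2)]] verma_sub_keys[OF that(2)]
    by simp
  then show ?thesis using subgroup.one_closed[OF s] by (auto simp: add_subgrp_def)
qed

lemma verma_sub_induct [consumes 1, case_names rel zero add minus]:
  assumes "x \<in> verma_sub l"
    and "\<And>r. r \<in> verma_rels l \<Longrightarrow> P r" "P 0" "\<And>x y. P x \<Longrightarrow> P y \<Longrightarrow> P (x + y)" "\<And>x. P x \<Longrightarrow> P (- x)"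
  shows "P x"
  using assms(1) unfolding verma_sub_def
proof (induction rule: generate.induct)
  case (inv h)
  then have "Poly_Mapping.keys h \<subseteq> carrier env_alg \<times> UNIV"
    using subsetD[OF verma_rels_closed inv] by simp
  then show ?case using assms(2)[OF inv] assms(5) by simp
qed (use assms in auto)

lemma verma_eval_verma_sub:
  assumes "x \<in> verma_sub l"
  shows "verma_eval l x = 0"
  using assms
proof (induction rule: verma_sub_induct)
  case (rel r)
  have b: "set bs \<subseteq> borel_minus \<Longrightarrow> Poly_Mapping.single bs c \<in> carrier free_alg" for bs c
    using borel_minus_sl2 by (intro free_alg_closed) auto
  from rel show ?case
    unfolding verma_rels_def carrier_env_alg
    by (auto simp: verma_eval_diff verma_eval_frag_of env_class_add env_class_mult b word_act_plus
        word_act_mult word_act_single foldr_poly_act_borel smult_add_left smult_add_right)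
      (metis (no_types) mult.commute smult_1_left smult_smult word_act_linear(2) one_pCons smult_pCons smult_0_right mult.right_neutral diff_self)
next
  case (minus x)
  then show ?case using verma_eval_diff[of l 0 x] by simp
qed (simp_all add: verma_eval_add)

section \<open>The module structure on the quotient\<close>

definition left_mult :: "free_elt \<Rightarrow> ((free_elt set \<times> complex) \<Rightarrow>\<^sub>0 int) \<Rightarrow> ((free_elt set \<times> complex) \<Rightarrow>\<^sub>0 int)" where
  "left_mult a = frag_extend (\<lambda>(u, z). frag_of (env_class a \<otimes>\<^bsub>env_alg\<^esub> u, z))"

lemma verma_sub_rels:
  "u \<in> carrier env_alg \<Longrightarrow> u' \<in> carrier env_alg \<Longrightarrow>
     frag_of (u \<oplus>\<^bsub>env_alg\<^esub> u', z) - frag_of (u, z) - frag_of (u', z) \<in> verma_sub l"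
  "u \<in> carrier env_alg \<Longrightarrow> frag_of (u, z + z') - frag_of (u, z) - frag_of (u, z') \<in> verma_sub l"
  "u \<in> carrier env_alg \<Longrightarrow> set bs \<subseteq> borel_minus \<Longrightarrow>
     frag_of (u \<otimes>\<^bsub>env_alg\<^esub> env_class (Poly_Mapping.single bs c), z)
       - frag_of (u, c * prod_list (map (borel_weight l) bs) * z) \<in> verma_sub l"
  by (rule verma_sub_incl, unfold verma_rels_def, blast)+

text \<open>A left multiple of a relation is a relation of the same family, by distributivity and
  associativity. Hence left multiplication descends to the quotient.\<close>

lemma left_mult_verma_sub:
  assumes a: "a \<in> carrier free_alg" and x: "x \<in> verma_sub l"
  shows "left_mult a x \<in> verma_sub l"
  using x
proof (induction rule: verma_sub_induct)
  case (rel r)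
  interpret ring env_alg by (rule ring_env_alg)
  have e: "set bs \<subseteq> borel_minus \<Longrightarrow> env_class (Poly_Mapping.single bs c) \<in> carrier env_alg" for bs c
    using borel_minus_sl2 by (intro env_class_closed free_alg_closed) auto
  from rel show ?case
    unfolding verma_rels_def
    by (auto simp: left_mult_def frag_extend_diff r_distr e env_class_closed[OF a]
        simp flip: m_assoc intro!: verma_sub_rels)
next
  case zero
  then show ?case using add_subgrp_verma_sub by (simp add: left_mult_def add_subgrp_def)
next
  case (add x y)
  then show ?case using add_subgrp_add[OF add_subgrp_verma_sub]
    by (simp add: left_mult_def frag_extend_add)
next
  case (minus x)
  have "0 - left_mult a x \<in> verma_sub l"
    using add_subgrp_verma_sub[of l] minus unfolding add_subgrp_def by blast
  then show ?case by (simp add: left_mult_def frag_extend_minus)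
qed

abbreviation vcoset where "vcoset l \<equiv> coset (verma_sub l)"

definition verma_elt :: "complex \<Rightarrow> free_elt \<Rightarrow> ((free_elt set \<times> complex) \<Rightarrow>\<^sub>0 int) set" where
  "verma_elt l p = vcoset l (frag_of (env_class p, 1))"

lemma verma_coset_add:
  assumes "vcoset l x = vcoset l x'" "vcoset l y = vcoset l y'"
  shows "vcoset l (x + y) = vcoset l (x' + y')"
  using assms add_subgrp_add[OF add_subgrp_verma_sub, of "x - x'" l "y - y'"]
  unfolding coset_eq_iff[OF add_subgrp_verma_sub] by (simp add: algebra_simps)

lemma verma_coset_diff:
  assumes "vcoset l x = vcoset l x'" "vcoset l y = vcoset l y'"
  shows "vcoset l (x - y) = vcoset l (x' - y')"
proof -
  have "(x - x') - (y - y') \<in> verma_sub l"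
    using assms add_subgrp_verma_sub unfolding coset_eq_iff[OF add_subgrp_verma_sub] add_subgrp_def
    by blast
  then show ?thesis unfolding coset_eq_iff[OF add_subgrp_verma_sub] by (simp add: algebra_simps)
qed

lemma verma_elt_add:
  assumes "p \<in> carrier free_alg" "q \<in> carrier free_alg"
  shows "verma_elt l (p + q) =
    vcoset l (frag_of (env_class p, 1) + frag_of (env_class q, 1))"
  using verma_sub_rels(1)[OF env_class_closed env_class_closed, OF assms, of 1 l]
  by (simp add: verma_elt_def coset_eq_iff[OF add_subgrp_verma_sub] env_class_add assms diff_diff_eq)

lemma verma_elt_diff:
  assumes "p \<in> carrier free_alg" "q \<in> carrier free_alg"
  shows "verma_elt l (p - q) =
    vcoset l (frag_of (env_class p, 1) - frag_of (env_class q, 1))"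
proof -
  have "verma_elt l p = vcoset l (frag_of (env_class (p - q), 1) + frag_of (env_class q, 1))"
    using verma_elt_add[of "p - q" q l] assms by (simp add: free_alg_closed)
  from verma_coset_diff[OF this[unfolded verma_elt_def] refl, of "frag_of (env_class q, 1)"]
  show ?thesis by (simp add: verma_elt_def)
qed

text \<open>The left annihilator of \<open>1 \<otimes> 1\<close>: equalities in the Verma module become congruences modulo
  this left ideal of the free algebra.\<close>

definition verma_null :: "complex \<Rightarrow> free_elt set" where
  "verma_null l = {p \<in> carrier free_alg. verma_elt l p = verma_elt l 0}"

lemma verma_elt_eq_iff:
  assumes "p \<in> carrier free_alg" "q \<in> carrier free_alg"
  shows "verma_elt l p = verma_elt l q \<longleftrightarrow> p - q \<in> verma_null l"
proof -
  have "verma_elt l 0 = vcoset l 0"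
    using verma_elt_diff[of 0 0 l] by (simp add: free_alg_closed)
  then show ?thesis
    using assms by (simp add: verma_null_def verma_elt_diff free_alg_closed)
      (simp add: verma_elt_def coset_eq_iff[OF add_subgrp_verma_sub])
qed

lemma verma_null_add:
  assumes "p \<in> verma_null l" "q \<in> verma_null l"
  shows "p + q \<in> verma_null l" "p - q \<in> verma_null l"
  using assms verma_elt_diff[of p q l] verma_elt_add[of p q l]
    verma_elt_diff[of 0 0 l] verma_elt_add[of 0 0 l]
    verma_coset_add[of l "frag_of (env_class p, 1)" "frag_of (env_class 0, 1)" "frag_of (env_class q, 1)" "frag_of (env_class 0, 1)"]
    verma_coset_diff[of l "frag_of (env_class p, 1)" "frag_of (env_class 0, 1)" "frag_of (env_class q, 1)" "frag_of (env_class 0, 1)"]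
  by (auto simp: verma_null_def free_alg_closed verma_elt_def)

lemma left_mult_coset:
  assumes a: "a \<in> carrier free_alg" and "vcoset l x = vcoset l y"
  shows "vcoset l (left_mult a x) = vcoset l (left_mult a y)"
  using left_mult_verma_sub[OF a, of "x - y" l] assms(2)
  by (simp add: coset_eq_iff[OF add_subgrp_verma_sub] left_mult_def frag_extend_diff)

lemma left_mult_frag_of:
  "a \<in> carrier free_alg \<Longrightarrow> p \<in> carrier free_alg \<Longrightarrow>
     left_mult a (frag_of (env_class p, z)) = frag_of (env_class (a * p), z)"
  by (simp add: left_mult_def env_class_mult)

lemma verma_null_mult:
  assumes a: "a \<in> carrier free_alg" and p: "p \<in> verma_null l"
  shows "a * p \<in> verma_null l"
  using left_mult_coset[OF a, of l "frag_of (env_class p, 1)" "frag_of (env_class 0, 1)"] p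
  by (simp add: verma_null_def verma_elt_def left_mult_frag_of a free_alg_closed)

lemma verma_null_ideal:
  assumes "p \<in> env_ideal"
  shows "p \<in> verma_null l"
  using assms env_ideal_closed[OF assms] env_class_eq_iff[of p 0]
  by (simp add: verma_null_def verma_elt_def)

lemma verma_balance:
  assumes "p \<in> carrier free_alg" "set bs \<subseteq> borel_minus"
  shows "vcoset l (frag_of (env_class (p * Poly_Mapping.single bs c), z)) =
    vcoset l (frag_of (env_class p, c * prod_list (map (borel_weight l) bs) * z))"
proof -
  have "Poly_Mapping.single bs c \<in> carrier free_alg"
    using assms(2) borel_minus_sl2 by (intro free_alg_closed) auto
  then show ?thesis
    using verma_sub_rels(3)[OF env_class_closed, OF assms, of c z l]
    by (simp add: coset_eq_iff[OF add_subgrp_verma_sub] env_class_mult assms(1))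
qed

lemma verma_null_weight:
  assumes "b \<in> borel_minus"
  shows "free_gen b - Poly_Mapping.single [] (borel_weight l b) \<in> verma_null l"
proof -
  have b: "b \<in> sl2" using assms borel_minus_sl2 by blast
  have "verma_elt l (free_gen b) = verma_elt l (Poly_Mapping.single [] (borel_weight l b))"
    \<comment> \<open>The one-letter word turns \<open>b\<close> into its weight in the second
      factor; the empty word carries that scalar back into the first.\<close>
    using verma_balance[of 1 "[b]" l 1 1] verma_balance[of 1 "[]" l "borel_weight l b" 1] assms
    by (simp add: verma_elt_def free_gen_def free_alg_closed)
  then show ?thesis using b
    by (simp add: verma_elt_eq_iff free_gen_closed free_alg_closed)
qed

section \<open>Upper bound: reduction to polynomials in \<open>e\<close>\<close>

definition poly_word :: "complex poly \<Rightarrow> free_elt" where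
  "poly_word p = fold_coeffs (\<lambda>a q. Poly_Mapping.single [] a + free_gen mat_e * q) p 0"

lemma poly_word_0 [simp]: "poly_word 0 = 0"
  by (simp add: poly_word_def)

text \<open>Horner's rule for the substitution of \<open>e\<close> for the variable; it is the form
  that induction over \<open>pCons\<close> requires.\<close>

lemma poly_word_pCons: "poly_word (pCons a p) = Poly_Mapping.single [] a + free_gen mat_e * poly_word p"
  by (cases "a = 0 \<and> p = 0") (auto simp: poly_word_def fold_coeffs_pCons_not_0_0_eq fold_coeffs_pCons_coeff_not_0_eq)

lemma poly_word_closed: "poly_word p \<in> carrier free_alg"
  by (induction p) (simp_all add: poly_word_pCons free_alg_closed free_gen_closed sl2_closed)

lemma poly_word_add: "poly_word (p + q) = poly_word p + poly_word q"
  by (induction p q rule: poly_induct2) (simp_all add: poly_word_pCons single_add algebra_simps)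

lemma scalar_commute: "Poly_Mapping.single [] c * free_gen A = free_gen A * Poly_Mapping.single [] c"
  by (simp add: free_gen_def mult_single plus_list_def)

lemma scalar_left_commute:
  "free_gen A * (Poly_Mapping.single [] c * p) = Poly_Mapping.single [] c * (free_gen A * p)"
  by (simp add: mult.assoc[symmetric] scalar_commute)

lemma single_Nil_one: "Poly_Mapping.single [] 1 = (1 :: free_elt)"
  using single_one[where 'a = "(complex^2^2) list" and 'b = complex] by (simp add: zero_list_def)

lemma poly_word_smult: "poly_word (psmult c p) = Poly_Mapping.single [] c * poly_word p"
proof (induction p)
  case (pCons a p)
  then show ?case
    by (simp add: poly_word_pCons distrib_left mult_single plus_list_def scalar_left_commute)
qed simp

lemma poly_word_diff: "poly_word (p - q) = poly_word p - poly_word q"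
  using poly_word_add[of "p - q" q] by simp

text \<open>Hence distinct polynomials in \<open>e\<close> remain distinct in the Verma
  module.\<close>

lemma word_act_poly_word: "word_act l (poly_word p) 1 = p"
  by (induction p)
    (simp_all add: poly_word_pCons word_act_plus word_act_mult free_gen_def word_act_single
      poly_act_def mat_entries one_pCons)

lemma borel_basis:
  "mat_h \<in> borel_minus" "mat_f \<in> borel_minus"
  "borel_weight l mat_h = l" "borel_weight l mat_f = 0"
proof -
  have "mat_h = mat_scale 1 mat_h + mat_scale 0 mat_f" "mat_f = mat_scale 0 mat_h + mat_scale 1 mat_f"
    by (simp_all add: mat_scale_def vec_eq_iff)
  then show "mat_h \<in> borel_minus" "mat_f \<in> borel_minus" unfolding borel_minus_def by blast+
qed (simp_all add: borel_weight_def mat_entries)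

lemma commutator_ideal:
  assumes "A \<in> sl2" "B \<in> sl2" "lie_bracket A B = mat_scale c D" "D \<in> sl2"
  shows "free_gen A * free_gen B - free_gen B * free_gen A - Poly_Mapping.single [] c * free_gen D
    \<in> env_ideal"
proof -
  have "free_gen A * free_gen B - free_gen B * free_gen A - free_gen (lie_bracket A B) \<in> env_ideal"
    "free_gen (mat_scale c D) - Poly_Mapping.single [D] c \<in> env_ideal"
    using assms by (intro env_rels_ideal, unfold env_rels_def, blast)+
  from add_subgrp_add[OF add_subgrp_env_ideal this] show ?thesis
    by (simp add: assms(3) free_gen_def mult_single plus_list_def)
qed

text \<open>Induction on the degree: \<open>[h, e] = 2 e\<close> moves \<open>h\<close> past one
  factor \<open>e\<close>, and once no factor is left \<open>h\<close> acts on
  \<open>1 \<otimes> 1\<close> by \<open>l\<close>.\<close>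

lemma poly_word_verma_h:
  "free_gen mat_h * poly_word p - poly_word (verma_h l p) \<in> verma_null l"
proof (induction p)
  case 0
  show ?case by (simp add: verma_h_def verma_null_def free_alg_closed)
next
  case (pCons a p)
  let ?s = "\<lambda>c. Poly_Mapping.single [] c :: free_elt"
  let ?e = "free_gen mat_e" let ?h = "free_gen mat_h" let ?q = "poly_word p"
  note cl = free_alg_closed free_gen_closed sl2_closed poly_word_closed
  have v: "verma_h l (pCons a p) = [:l * a:] + (pCons 0 (verma_h l p) + psmult 2 (pCons 0 p))"
    by (rule poly_eqI, case_tac n) (simp_all add: coeff_verma algebra_simps)
  have "?h * ?e - ?e * ?h - ?s 2 * ?e \<in> env_ideal"
    by (rule commutator_ideal) (simp_all add: sl2_closed sl2_brackets)
  then have 1: "(?h * ?e - ?e * ?h - ?s 2 * ?e) * ?q \<in> verma_null l"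
    by (intro verma_null_ideal env_ideal_mult) (simp_all add: cl)
  have 2: "?e * (?h * ?q - poly_word (verma_h l p)) \<in> verma_null l"
    by (rule verma_null_mult[OF _ pCons.IH]) (simp add: cl)
  have 3: "?s a * (?h - ?s l) \<in> verma_null l"
    using verma_null_weight[OF borel_basis(1), of l]
    by (intro verma_null_mult) (simp_all add: cl borel_basis)
  have 4: "?h * ?s a - ?s (l * a) = ?s a * (?h - ?s l)"
    by (simp add: right_diff_distrib scalar_commute mult_single plus_list_def mult.commute)
  have "?h * poly_word (pCons a p) - poly_word (verma_h l (pCons a p)) =
    ?s a * (?h - ?s l) + ((?h * ?e - ?e * ?h - ?s 2 * ?e) * ?q + ?e * (?h * ?q - poly_word (verma_h l p)))"
    unfolding v 4[symmetric]
    by (simp add: poly_word_pCons poly_word_add poly_word_smult scalar_left_commute algebra_simps)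
  then show ?case using verma_null_add(1) 1 2 3 by simp
qed

lemma poly_word_verma_f:
  "free_gen mat_f * poly_word p - poly_word (verma_f l p) \<in> verma_null l"
proof (induction p)
  case 0
  show ?case by (simp add: verma_f_def verma_null_def free_alg_closed)
next
  case (pCons a p)
  let ?s = "\<lambda>c. Poly_Mapping.single [] c :: free_elt"
  let ?e = "free_gen mat_e" let ?h = "free_gen mat_h" let ?f = "free_gen mat_f" let ?q = "poly_word p"
  note cl = free_alg_closed free_gen_closed sl2_closed poly_word_closed
  \<comment> \<open>The polynomial counterpart of \<open>f e = e f - h\<close>; the constant
    \<open>a\<close> disappears because \<open>f\<close> kills the lowest weight vector. The case of
    \<open>h\<close> is thus used in the induction.\<close>
  have v: "verma_f l (pCons a p) = pCons 0 (verma_f l p) - verma_h l p"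
    by (rule poly_eqI, case_tac n) (simp_all add: coeff_verma algebra_simps)
  have "mat_h = mat_scale 1 mat_h" by (simp add: mat_scale_def vec_eq_iff)
  then have "?e * ?f - ?f * ?e - ?s 1 * ?h \<in> env_ideal"
    by (intro commutator_ideal) (simp_all add: sl2_closed sl2_brackets)
  then have "?e * ?f - ?f * ?e - ?h \<in> env_ideal" by (simp add: single_Nil_one)
  then have 1: "(?e * ?f - ?f * ?e - ?h) * ?q \<in> verma_null l"
    by (intro verma_null_ideal env_ideal_mult) (simp_all add: cl)
  have 2: "?e * (?f * ?q - poly_word (verma_f l p)) \<in> verma_null l"
    by (rule verma_null_mult[OF _ pCons.IH]) (simp add: cl)
  have 3: "?s a * ?f \<in> verma_null l"
    using verma_null_weight[OF borel_basis(2), of l]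
    by (intro verma_null_mult) (simp_all add: cl borel_basis)
  have "?f * poly_word (pCons a p) - poly_word (verma_f l (pCons a p)) =
    ?s a * ?f + (?e * (?f * ?q - poly_word (verma_f l p)) - (?h * ?q - poly_word (verma_h l p))
      - (?e * ?f - ?f * ?e - ?h) * ?q) - (?h * ?q - ?h * ?q)"
    unfolding v
    by (simp add: poly_word_pCons poly_word_diff algebra_simps scalar_commute)
  then show ?case using verma_null_add 1 2 3 poly_word_verma_h by simp
qed

lemma poly_word_poly_act:
  assumes A: "A \<in> sl2"
  shows "free_gen A * poly_word p - poly_word (poly_act l A p) \<in> verma_null l"
proof -
  let ?s = "\<lambda>c. Poly_Mapping.single [] c :: free_elt"
  let ?a = "A $ 1 $ 2" let ?b = "A $ 2 $ 1" let ?c = "A $ 1 $ 1"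
  let ?e = "free_gen mat_e" let ?h = "free_gen mat_h" let ?f = "free_gen mat_f" let ?q = "poly_word p"
  note cl = free_alg_closed free_gen_closed sl2_closed poly_word_closed
  have sm: "free_gen (mat_scale c B) - ?s c * free_gen B \<in> env_ideal" if "B \<in> sl2" for c B
    using that by (intro env_rels_ideal) (auto simp: env_rels_def free_gen_def mult_single plus_list_def)
  have ad: "free_gen (B + C) - free_gen B - free_gen C \<in> env_ideal" if "B \<in> sl2" "C \<in> sl2" for B C
    using that by (intro env_rels_ideal) (auto simp: env_rels_def)
  let ?E = "mat_scale ?a mat_e" let ?F = "mat_scale ?b mat_f" let ?H = "mat_scale ?c mat_h"
  \<comment> \<open>\<open>free_gen\<close> is not linear: \<open>A\<close> splits into multiples of
    \<open>e\<close>, \<open>f\<close>, \<open>h\<close> only modulo the relations for sums and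
    scalars.\<close>
  have eq: "A = ?E + ?F + ?H" using A sl2_basis by blast
  have "(free_gen (?E + ?F + ?H) - free_gen (?E + ?F) - free_gen ?H)
      + ((free_gen (?E + ?F) - free_gen ?E - free_gen ?F) + ((free_gen ?E - ?s ?a * ?e)
      + ((free_gen ?F - ?s ?b * ?f) + (free_gen ?H - ?s ?c * ?h)))) \<in> env_ideal"
    by (intro add_subgrp_add[OF add_subgrp_env_ideal] sm ad) (simp_all add: sl2_closed)
  then have "free_gen A - (?s ?a * ?e + ?s ?b * ?f + ?s ?c * ?h) \<in> env_ideal"
    by (subst eq) (simp add: algebra_simps)
  then have 1: "(free_gen A - (?s ?a * ?e + ?s ?b * ?f + ?s ?c * ?h)) * ?q \<in> verma_null l"
    by (intro verma_null_ideal env_ideal_mult) (simp_all add: cl)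
  have 2: "?s ?b * (?f * ?q - poly_word (verma_f l p)) \<in> verma_null l"
    "?s ?c * (?h * ?q - poly_word (verma_h l p)) \<in> verma_null l"
    by (intro verma_null_mult poly_word_verma_f poly_word_verma_h; simp add: cl)+
  have "free_gen A * ?q - poly_word (poly_act l A p) =
    (free_gen A - (?s ?a * ?e + ?s ?b * ?f + ?s ?c * ?h)) * ?q
    + (?s ?b * (?f * ?q - poly_word (verma_f l p)) + ?s ?c * (?h * ?q - poly_word (verma_h l p)))"
    by (simp add: poly_act_def poly_word_add poly_word_smult poly_word_pCons scalar_left_commute algebra_simps)
  then show ?thesis using verma_null_add(1) 1 2 by simp
qed

text \<open>The spanning half of a normal form theorem. A word is reduced from its right end: the
  reduced tail may be multiplied by the next letter because the annihilator is a left ideal, and the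
  product is then rewritten by \<open>poly_word_poly_act\<close>.\<close>

lemma free_elt_reduce:
  assumes "p \<in> carrier free_alg"
  shows "p - poly_word (word_act l p 1) \<in> verma_null l"
  using assms unfolding carrier_free_alg
proof (induction rule: keys_induct)
  case zero
  show ?case by (simp add: verma_null_def free_alg_closed)
next
  case (single w c)
  then show ?case
  proof (induction w)
    case Nil
    show ?case
      by (simp add: word_act_single poly_word_smult one_pCons poly_word_pCons mult_single plus_list_def
        verma_null_def free_alg_closed)
  next
    case (Cons A w)
    let ?q = "psmult c (foldr (poly_act l) w 1)"
    have "free_gen A * (Poly_Mapping.single w c - poly_word ?q)
        + (free_gen A * poly_word ?q - poly_word (poly_act l A ?q)) \<in> verma_null l"
      using Cons
      by (intro verma_null_add(1) verma_null_mult poly_word_poly_act free_gen_closed)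
        (simp_all add: word_act_single)
    then show ?case
      by (simp add: right_diff_distrib word_act_single poly_act_smult)
        (simp add: free_gen_def mult_single plus_list_def)
  qed
next
  case (add p q)
  then show ?case
    using verma_null_add(1)[OF add.IH]
    by (simp add: word_act_plus poly_word_add algebra_simps)
qed

text \<open>Balancing with the empty word moves each scalar into the first factor, so a formal
  combination of tensors becomes a single \<open>p \<otimes> 1\<close>, to which the reduction
  applies.\<close>

lemma verma_coset_surj:
  assumes "Poly_Mapping.keys x \<subseteq> carrier env_alg \<times> UNIV"
  shows "\<exists>p. vcoset l x = verma_elt l (poly_word p)"
proof -
  have "\<exists>p\<in>carrier free_alg. vcoset l x = verma_elt l p"
    using assms
  proof (induction rule: frag_induction)
    case zero
    show ?case using verma_elt_diff[of 0 0 l] by (intro bexI[of _ 0]) (simp_all add: free_alg_closed)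
  next
    case (one k)
    then obtain p z where k: "k = (env_class p, z)" "p \<in> carrier free_alg"
      by (auto simp: carrier_env_alg)
    have "vcoset l (frag_of k) = verma_elt l (p * Poly_Mapping.single [] z)"
      using verma_balance[OF k(2), of "[]" l z 1] by (simp add: verma_elt_def k)
    then show ?case using k(2)
      by (intro bexI[of _ "p * Poly_Mapping.single [] z"]) (simp_all add: free_alg_closed)
  next
    case (diff x y)
    then obtain p q where "p \<in> carrier free_alg" "q \<in> carrier free_alg"
      "vcoset l x = verma_elt l p" "vcoset l y = verma_elt l q" by blast
    then show ?case
      using verma_coset_diff[of l x "frag_of (env_class p, 1)" y "frag_of (env_class q, 1)"]
      by (intro bexI[of _ "p - q"]) (simp_all add: verma_elt_diff free_alg_closed, simp add: verma_elt_def)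
  qed
  then obtain p where p: "p \<in> carrier free_alg" "vcoset l x = verma_elt l p" by blast
  have "verma_elt l p = verma_elt l (poly_word (word_act l p 1))"
    using verma_elt_eq_iff[OF p(1) poly_word_closed] free_elt_reduce[OF p(1)] by blast
  then show ?thesis using p(2) by auto
qed

lemma sl2_iso_poly_rep_verma: "sl2_iso (poly_rep l) (verma_minus l)"
proof -
  have M: "add verma_cover = (+)" by (simp add: verma_cover_def)
  have V: "verma_minus l = quot_rep verma_cover (verma_sub l)"
    by (simp add: verma_minus_def verma_sub_def)
  have car: "carrier (verma_minus l) = vcoset l ` {x. Poly_Mapping.keys x \<subseteq> carrier env_alg \<times> UNIV}"
    unfolding V quot_rep_simps[OF M] by (auto simp: verma_cover_def)
  have L: "W <+>\<^bsub>verma_cover\<^esub> (left_mult a ` coset W x) = coset W (left_mult a x)"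
    if "W = verma_sub l" "a \<in> carrier free_alg" for W a x
    unfolding that(1) using left_mult_verma_sub[OF that(2)]
    by (intro set_add_image_coset[OF add_subgrp_verma_sub M])
      (auto simp: left_mult_def frag_extend_add)
  have act: "rep_act (verma_minus l) A (verma_elt l p) = verma_elt l (free_gen A * p)"
    if "A \<in> sl2" "p \<in> carrier free_alg" for A p
  proof -
    have "rep_act verma_cover A = left_mult (free_gen A)"
      by (simp add: verma_cover_def left_mult_def)
    then show ?thesis
      unfolding V quot_rep_simps[OF M] verma_elt_def
      using L[OF refl free_gen_closed[OF that(1)]] that
      by (simp add: left_mult_frag_of free_gen_closed)
  qed
  have sm: "c \<odot>\<^bsub>verma_minus l\<^esub> verma_elt l p = verma_elt l (Poly_Mapping.single [] c * p)"
    if "p \<in> carrier free_alg" for c p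
  proof -
    have "(\<lambda>x. c \<odot>\<^bsub>verma_cover\<^esub> x) = left_mult (Poly_Mapping.single [] c)"
      by (simp add: verma_cover_def left_mult_def)
    then show ?thesis
      unfolding V quot_rep_simps[OF M] verma_elt_def
      using L[OF refl, of "Poly_Mapping.single [] c"] that
      by (simp add: left_mult_frag_of free_alg_closed)
  qed
  have ad: "verma_elt l p \<oplus>\<^bsub>verma_minus l\<^esub> verma_elt l q = verma_elt l (p + q)"
    if "p \<in> carrier free_alg" "q \<in> carrier free_alg" for p q
    unfolding V quot_rep_simps[OF M] verma_elt_add[OF that]
    by (simp add: verma_elt_def set_add_coset[OF add_subgrp_verma_sub M])
  let ?\<theta> = "\<lambda>p. verma_elt l (poly_word p)"
  \<comment> \<open>\<open>verma_eval\<close> is a left inverse, and it is well defined since it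
    vanishes on \<open>verma_sub l\<close>.\<close>
  have "inj ?\<theta>"
  proof (rule injI)
    fix p q assume "?\<theta> p = ?\<theta> q"
    then have "verma_eval l (frag_of (env_class (poly_word p), 1) - frag_of (env_class (poly_word q), 1)) = 0"
      by (intro verma_eval_verma_sub) (simp add: verma_elt_def coset_eq_iff[OF add_subgrp_verma_sub])
    then show "p = q" by (simp add: verma_eval_diff verma_eval_frag_of word_act_poly_word)
  qed
  moreover have "range ?\<theta> = carrier (verma_minus l)"
  proof
    show "range ?\<theta> \<subseteq> carrier (verma_minus l)"
      unfolding car verma_elt_def by (auto simp: env_class_closed poly_word_closed)
    show "carrier (verma_minus l) \<subseteq> range ?\<theta>"
      unfolding car using verma_coset_surj[of _ l] by blast
  qed
  ultimately have "bij_betw ?\<theta> (carrier (poly_rep l)) (carrier (verma_minus l))"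
    by (simp add: bij_betw_def poly_rep_def)
  moreover have "verma_elt l (poly_word (poly_act l A p)) = verma_elt l (free_gen A * poly_word p)"
    if "A \<in> sl2" for A p
    using poly_word_poly_act[OF that, of p l] that
    by (subst eq_commute, subst verma_elt_eq_iff)
      (simp_all add: free_alg_closed free_gen_closed poly_word_closed)
  ultimately show ?thesis
    unfolding sl2_iso_def
    by (intro exI[of _ ?\<theta>])
      (simp add: act sm ad poly_word_closed poly_rep_def poly_word_add poly_word_smult)
qed

section \<open>Graded modules on which \<open>e\<close> acts injectively\<close>

lemma cring_complex_field: "cring complex_field"
proof (rule cringI)
  show "abelian_group complex_field"
  proof (rule abelian_groupI)
    fix x assume "x \<in> carrier complex_field"
    show "\<exists>y\<in>carrier complex_field. y \<oplus>\<^bsub>complex_field\<^esub> x = \<zero>\<^bsub>complex_field\<^esub>"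
      by (intro bexI[of _ "- x"]) (simp_all add: complex_field_def)
  qed (simp_all add: complex_field_def algebra_simps)
  show "Group.comm_monoid complex_field"
    by (rule comm_monoidI) (simp_all add: complex_field_def algebra_simps)
qed (simp add: complex_field_def algebra_simps)

text \<open>The vectors \<open>b n i\<close> with \<open>i < c n\<close> form a basis of the part of degree \<open>n\<close>.  Since \<open>e\<close> preserves
  the index \<open>i\<close>, those with a fixed \<open>i\<close> are \<open>v, e v, e\<^sup>2 v, \<dots>\<close>, where \<open>v\<close> has degree \<open>start i\<close>.\<close>

locale graded_sl2 = vector_space scale
  for scale :: "complex \<Rightarrow> 'v::ab_group_add \<Rightarrow> 'v" +
  fixes c :: "nat \<Rightarrow> nat" and b :: "nat \<Rightarrow> nat \<Rightarrow> 'v" and e f h :: "'v \<Rightarrow> 'v" and M :: complex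
  assumes linear_e: "Vector_Spaces.linear scale scale e"
    and linear_f: "Vector_Spaces.linear scale scale f"
    and linear_h: "Vector_Spaces.linear scale scale h"
    and indep: "independent {b n i | n i. i < c n}"
    and b_inj: "i < c n \<Longrightarrow> i' < c n' \<Longrightarrow> b n i = b n' i' \<Longrightarrow> n = n' \<and> i = i'"
    and c_mono: "c n \<le> c (Suc n)"
    and e_b: "i < c n \<Longrightarrow> e (b n i) = b (Suc n) i"
    and h_b: "i < c n \<Longrightarrow> h (b n i) = scale (2 * of_nat n - M) (b n i)"
    and f_b0: "i < c 0 \<Longrightarrow> f (b 0 i) = 0"
    and f_b: "i < c (Suc n) \<Longrightarrow> f (b (Suc n) i) \<in> span (b n ` {..<c n})"
    and ef: "i < c n \<Longrightarrow> e (f (b n i)) - f (e (b n i)) = h (b n i)"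
begin

sublocale E: Vector_Spaces.linear scale scale e by (rule linear_e)
sublocale F: Vector_Spaces.linear scale scale f by (rule linear_f)
sublocale H: Vector_Spaces.linear scale scale h by (rule linear_h)
sublocale P: vector_space_pair scale "psmult :: complex \<Rightarrow> complex poly \<Rightarrow> complex poly"
  using vector_space_smult by (simp add: vector_space_pair_def vector_space_axioms)

definition basis_upto :: "nat \<Rightarrow> 'v set" where
  "basis_upto m = {b n i | n i. i < m \<and> i < c n}"

definition filt :: "nat \<Rightarrow> 'v set" where
  "filt m = span (basis_upto m)"

text \<open>The module proper. The ambient type will be all complex functions on sets, in which the
  orbit algebra is only a subspace.\<close>

definition total :: "'v set" where
  "total = span {b n i | n i. i < c n}"

definition start :: "nat \<Rightarrow> nat" where
  "start i = (LEAST n. i < c n)"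

definition act :: "complex^2^2 \<Rightarrow> 'v \<Rightarrow> 'v" where
  "act A v = scale (A $ 1 $ 2) (e v) + scale (A $ 2 $ 1) (f v) + scale (A $ 1 $ 1) (h v)"

lemma start_le: "i < c n \<Longrightarrow> start i \<le> n"
  unfolding start_def by (rule Least_le)

lemma start_less: "i < c n \<Longrightarrow> i < c (start i)"
  unfolding start_def by (rule LeastI)

lemma c_mono': "n \<le> n' \<Longrightarrow> c n \<le> c n'"
  using c_mono by (rule lift_Suc_mono_le)

text \<open>As \<open>c\<close> is nondecreasing, an index that occurs is present in all later
  degrees. Each index therefore contributes one shifted sequence of ones.\<close>

lemma less_c_iff: "i < c n \<longleftrightarrow> (\<exists>n'. i < c n') \<and> start i \<le> n"
  by (meson c_mono' less_le_trans start_le start_less)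

lemma filt_mono: "m \<le> m' \<Longrightarrow> filt m \<subseteq> filt m'"
  unfolding filt_def basis_upto_def by (intro span_mono) (blast intro: less_le_trans)

lemma filt_total: "filt m \<subseteq> total"
  unfolding filt_def basis_upto_def total_def by (intro span_mono) auto

lemma b_filt: "i < m \<Longrightarrow> i < c n \<Longrightarrow> b n i \<in> filt m"
  unfolding filt_def basis_upto_def by (intro span_base) auto

lemma b_total: "i < c n \<Longrightarrow> b n i \<in> total"
  unfolding total_def by (intro span_base) auto

lemma subspace_filt: "subspace (filt m)"
  unfolding filt_def by (rule subspace_span)

lemma subspace_total: "subspace total"
  unfolding total_def by (rule subspace_span)

lemma filt_0: "filt 0 = {0}"
  by (simp add: filt_def basis_upto_def)

lemma linear_image_span:
  assumes "Vector_Spaces.linear scale scale t" "\<And>x. x \<in> S \<Longrightarrow> t x \<in> span S'" "v \<in> span S"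
  shows "t v \<in> span S'"
proof -
  interpret t: Vector_Spaces.linear scale scale t by fact
  have "span (t ` S) \<subseteq> span S'" using assms(2) by (intro span_minimal) auto
  then show ?thesis using assms(3) t.span_image by blast
qed

text \<open>This holds by \<open>f e = e f - h\<close> for \<open>i < c n\<close>, and for degree reasons otherwise, because then
  every index of degree \<open>n\<close> is below \<open>i\<close>.\<close>

lemma f_triangular:
  "i < c (Suc n) \<Longrightarrow> f (b (Suc n) i) \<in> span (b n ` {j. j \<le> i \<and> j < c n})"
proof (induction n arbitrary: i)
  case 0
  show ?case
  proof (cases "i < c 0")
    case True
    then have "f (b 1 i) = - h (b 0 i)"
      using ef[OF True] e_b[OF True] f_b0[OF True] E.zero by (simp add: minus_equation_iff)
    moreover have "h (b 0 i) \<in> span (b 0 ` {j. j \<le> i \<and> j < c 0})"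
      unfolding h_b[OF True] by (intro span_scale span_base) (use True in auto)
    ultimately show ?thesis by (simp add: span_neg)
  next
    case False
    then have "{..<c 0} \<subseteq> {j. j \<le> i \<and> j < c 0}" by auto
    then have "span (b 0 ` {..<c 0}) \<subseteq> span (b 0 ` {j. j \<le> i \<and> j < c 0})"
      by (intro span_mono image_mono)
    then show ?thesis using f_b[OF 0] by auto
  qed
next
  case (Suc n)
  show ?case
  proof (cases "i < c (Suc n)")
    case True
    have "f (b (Suc (Suc n)) i) = e (f (b (Suc n) i)) - h (b (Suc n) i)"
      using ef[OF True] e_b[OF True] by (simp add: algebra_simps)
    moreover have "e (f (b (Suc n) i)) \<in> span (b (Suc n) ` {j. j \<le> i \<and> j < c (Suc n)})"
      using Suc.IH[OF True]
    proof (rule linear_image_span[OF linear_e, rotated])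
      fix x assume "x \<in> b n ` {j. j \<le> i \<and> j < c n}"
      then show "e x \<in> span (b (Suc n) ` {j. j \<le> i \<and> j < c (Suc n)})"
        using e_b c_mono[of n] by (auto intro!: span_base)
    qed
    moreover have "h (b (Suc n) i) \<in> span (b (Suc n) ` {j. j \<le> i \<and> j < c (Suc n)})"
      unfolding h_b[OF True] by (intro span_scale span_base) (use True in auto)
    ultimately show ?thesis by (simp add: span_diff)
  next
    case False
    then have "{..<c (Suc n)} \<subseteq> {j. j \<le> i \<and> j < c (Suc n)}" by auto
    then have "span (b (Suc n) ` {..<c (Suc n)}) \<subseteq> span (b (Suc n) ` {j. j \<le> i \<and> j < c (Suc n)})"
      by (intro span_mono image_mono)
    then show ?thesis using f_b[OF Suc.prems] by auto
  qed
qed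

lemma f_filt_basis: "i < m \<Longrightarrow> i < c n \<Longrightarrow> f (b n i) \<in> filt m"
proof (cases n)
  case 0
  then show "i < c n \<Longrightarrow> f (b n i) \<in> filt m" using f_b0 span_zero by (simp add: filt_def)
next
  case (Suc k)
  assume i: "i < m" "i < c n"
  have "b k ` {j. j \<le> i \<and> j < c k} \<subseteq> basis_upto m"
    using i unfolding basis_upto_def by (blast intro: le_less_trans)
  then show ?thesis
    using f_triangular[of i k] i(2) Suc span_mono[of "b k ` {j. j \<le> i \<and> j < c k}" "basis_upto m"]
    unfolding filt_def by auto
qed

lemma e_filt: "v \<in> filt m \<Longrightarrow> e v \<in> filt m"
  unfolding filt_def
proof (erule linear_image_span[OF linear_e, rotated])
  fix x assume "x \<in> basis_upto m"
  then obtain n i where "x = b n i" "i < m" "i < c n" by (auto simp: basis_upto_def)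
  then show "e x \<in> span (basis_upto m)"
    using e_b c_mono[of n] b_filt[of i m "Suc n"] by (simp add: filt_def)
qed

lemma f_filt: "v \<in> filt m \<Longrightarrow> f v \<in> filt m"
  unfolding filt_def
proof (erule linear_image_span[OF linear_f, rotated])
  fix x assume "x \<in> basis_upto m"
  then show "f x \<in> span (basis_upto m)"
    using f_filt_basis unfolding basis_upto_def filt_def by blast
qed

lemma h_filt: "v \<in> filt m \<Longrightarrow> h v \<in> filt m"
  unfolding filt_def
proof (erule linear_image_span[OF linear_h, rotated])
  fix x assume "x \<in> basis_upto m"
  then show "h x \<in> span (basis_upto m)"
    using h_b b_filt span_scale unfolding basis_upto_def filt_def by auto
qed

lemma act_filt: "v \<in> filt m \<Longrightarrow> act A v \<in> filt m"
  unfolding act_def using e_filt f_filt h_filt subspace_filt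
  by (intro subspace_add subspace_scale) auto

text \<open>Reads off the component along the generator of index \<open>m\<close>, as a polynomial
  in \<open>e\<close>. The description operator recovers the degree of a basis vector, which
  \<open>b_inj\<close> makes unique, and subtracting \<open>start m\<close> turns it into the
  exponent of \<open>e\<close>.\<close>

definition coord :: "nat \<Rightarrow> 'v \<Rightarrow> complex poly" where
  "coord m = P.construct {b n i | n i. i < c n}
     (\<lambda>x. if \<exists>n. m < c n \<and> x = b n m then monom 1 ((THE n. m < c n \<and> x = b n m) - start m) else 0)"

lemma linear_coord: "Vector_Spaces.linear scale psmult (coord m)"
  unfolding coord_def by (rule P.linear_construct[OF indep])

lemma coord_b:
  assumes "i < c n"
  shows "coord m (b n i) = (if i = m then monom 1 (n - start m) else 0)"
proof -
  have "coord m (b n i) = (if \<exists>n'. m < c n' \<and> b n i = b n' m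
      then monom 1 ((THE n'. m < c n' \<and> b n i = b n' m) - start m) else 0)"
    unfolding coord_def using assms by (subst P.construct_basis[OF indep]) auto
  moreover have "(THE n'. m < c n' \<and> b n i = b n' m) = n" if "i = m"
    using that assms b_inj by (intro the_equality) auto
  moreover have "(\<exists>n'. m < c n' \<and> b n i = b n' m) \<longleftrightarrow> i = m"
    using assms b_inj by blast
  ultimately show ?thesis by simp
qed

lemma linear_poly_eq_on_span:
  assumes "Vector_Spaces.linear scale psmult s" "Vector_Spaces.linear scale psmult t"
    and "\<And>x. x \<in> S \<Longrightarrow> s x = t x" "v \<in> span S"
  shows "s v = t v"
  using P.linear_eq_on[OF assms(1,2,4,3)] by simp

lemma linear_compose_poly:
  assumes "Vector_Spaces.linear scale scale s" "Vector_Spaces.linear scale psmult t"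
  shows "Vector_Spaces.linear scale psmult (\<lambda>v. t (s v))"
  using Vector_Spaces.linear_compose[OF assms] by (simp add: o_def)

lemma linear_compose_poly':
  assumes "Vector_Spaces.linear scale psmult s"
    "Vector_Spaces.linear psmult psmult t"
  shows "Vector_Spaces.linear scale psmult (\<lambda>v. t (s v))"
  using Vector_Spaces.linear_compose[OF assms] by (simp add: o_def)

sublocale C: Vector_Spaces.linear scale "psmult :: complex \<Rightarrow> complex poly \<Rightarrow> complex poly"
  "coord m" for m by (rule linear_coord)

lemma coord_e: "v \<in> total \<Longrightarrow> coord m (e v) = pCons 0 (coord m v)"
  unfolding total_def
proof (erule linear_poly_eq_on_span[rotated -1])
  fix x assume "x \<in> {b n i | n i. i < c n}"
  then obtain n i where x: "x = b n i" "i < c n" by blast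
  moreover have "i < c (Suc n)" using x c_mono[of n] by simp
  ultimately show "coord m (e x) = pCons 0 (coord m x)"
    using start_le[of m n] by (auto simp: e_b coord_b Suc_diff_le monom_Suc)
qed (rule linear_compose_poly[OF linear_e linear_coord] linear_compose_poly'[OF linear_coord linear_verma(1)])+

text \<open>The coefficient of \<open>x^k\<close> belongs to degree \<open>start m + k\<close>,
  where \<open>h\<close> acts by the lowest weight plus \<open>2 k\<close>.\<close>

lemma coord_h: "v \<in> total \<Longrightarrow> coord m (h v) = verma_h (2 * of_nat (start m) - M) (coord m v)"
  unfolding total_def
proof (erule linear_poly_eq_on_span[rotated -1])
  fix x assume "x \<in> {b n i | n i. i < c n}"
  then obtain n i where x: "x = b n i" "i < c n" by blast
  have eq: "coord m (h x) = psmult (2 * of_nat n - M) (coord m x)"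
    by (simp only: x h_b C.scale)
  show "coord m (h x) = verma_h (2 * of_nat (start m) - M) (coord m x)"
    unfolding eq
    using x start_le[of m n]
    by (intro poly_eqI) (auto simp: coord_b coeff_verma of_nat_diff algebra_simps)
qed (rule linear_compose_poly[OF linear_h linear_coord] linear_compose_poly'[OF linear_coord linear_verma(3)])+

lemma coord_filt: "v \<in> filt m \<Longrightarrow> coord m v = 0"
  unfolding filt_def
proof (erule linear_poly_eq_on_span[rotated -1])
  show "Vector_Spaces.linear scale psmult (\<lambda>v. 0 :: complex poly)"
    by (rule P.linear_zero)
qed (auto simp: basis_upto_def coord_b linear_coord)

text \<open>Both sides obey the recursion \<open>f e = e f - h\<close> in the degree. They agree at
  the generator, where the left side vanishes because \<open>f\<close> sends it into
  \<open>filt m\<close>, and the right side because \<open>verma_f\<close> kills constants.\<close>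

lemma coord_f_b:
  "m < c n \<Longrightarrow> coord m (f (b n m)) = verma_f (2 * of_nat (start m) - M) (coord m (b n m))"
proof (induction n)
  case 0
  then show ?case using start_le[OF 0] by (simp add: f_b0 C.zero coord_b verma_f_def pderiv_monom)
next
  case (Suc n)
  let ?l = "2 * of_nat (start m) - M"
  show ?case
  proof (cases "m < c n")
    case True
    have "f (b (Suc n) m) = e (f (b n m)) - h (b n m)"
      using ef[OF True] e_b[OF True] by (simp add: algebra_simps)
    moreover have "f (b n m) \<in> total" "b n m \<in> total"
      using f_filt_basis[OF _ True, of "Suc m"] filt_total b_total[OF True] by auto
    ultimately have "coord m (f (b (Suc n) m)) = pCons 0 (coord m (f (b n m))) - verma_h ?l (coord m (b n m))"
      by (simp add: C.diff coord_e coord_h)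
    also have "\<dots> = verma_f ?l (pCons 0 (coord m (b n m)))"
      unfolding Suc.IH[OF True] verma_rels_poly(1)[symmetric] by simp
    also have "pCons 0 (coord m (b n m)) = coord m (b (Suc n) m)"
      using coord_e[OF b_total[OF True]] e_b[OF True] by simp
    finally show ?thesis .
  next
    case False
    \<comment> \<open>The index \<open>m\<close> is new in this degree, so this vector is the
      generator, and every basis vector one degree below has a smaller index.\<close>
    have "start m = Suc n"
      using False start_le[OF Suc.prems] start_less[OF Suc.prems] c_mono'[of "start m" n]
      by (meson le_SucE less_le_trans)
    then have "coord m (b (Suc n) m) = [:1:]" using Suc.prems by (simp add: coord_b)
    moreover have "b n ` {..<c n} \<subseteq> basis_upto m" using False unfolding basis_upto_def by force
    then have "f (b (Suc n) m) \<in> filt m"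
      using f_b[OF Suc.prems] span_mono[of "b n ` {..<c n}" "basis_upto m"] unfolding filt_def by auto
    ultimately show ?thesis by (simp add: coord_filt verma_f_def pderiv_pCons)
  qed
qed

text \<open>Confined to \<open>filt (Suc m)\<close>, since \<open>f\<close> may send basis vectors
  of larger index to combinations that involve index \<open>m\<close>.\<close>

lemma coord_f: "v \<in> filt (Suc m) \<Longrightarrow> coord m (f v) = verma_f (2 * of_nat (start m) - M) (coord m v)"
  unfolding filt_def
proof (erule linear_poly_eq_on_span[rotated -1])
  fix x assume "x \<in> basis_upto (Suc m)"
  then obtain n i where x: "x = b n i" "i < c n" "i < Suc m" by (auto simp: basis_upto_def)
  show "coord m (f x) = verma_f (2 * of_nat (start m) - M) (coord m x)"
  proof (cases "i = m")
    case True
    then show ?thesis using x coord_f_b by simp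
  next
    case False
    then have "x \<in> filt m" using x b_filt by simp
    then show ?thesis using f_filt[of x m] by (simp add: coord_filt verma_f_def)
  qed
qed (rule linear_compose_poly[OF linear_f linear_coord] linear_compose_poly'[OF linear_coord linear_verma(2)])+

text \<open>The polynomial \<open>p\<close> in \<open>e\<close>, applied to the generator of index
  \<open>m\<close>; a section of \<open>coord m\<close>.\<close>

definition of_coord :: "nat \<Rightarrow> complex poly \<Rightarrow> 'v" where
  "of_coord m p = fold_coeffs (\<lambda>a v. scale a (b (start m) m) + e v) p 0"

lemma of_coord_0 [simp]: "of_coord m 0 = 0"
  by (simp add: of_coord_def)

lemma of_coord_pCons: "of_coord m (pCons a p) = scale a (b (start m) m) + e (of_coord m p)"
  by (cases "a = 0 \<and> p = 0")
    (auto simp: of_coord_def fold_coeffs_pCons_not_0_0_eq fold_coeffs_pCons_coeff_not_0_eq E.zero)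

lemma of_coord_add: "of_coord m (p + q) = of_coord m p + of_coord m q"
  by (induction p q rule: poly_induct2)
    (simp_all add: of_coord_pCons scale_left_distrib E.add algebra_simps)

lemma of_coord_smult: "of_coord m (psmult a p) = scale a (of_coord m p)"
  by (induction p) (simp_all add: of_coord_pCons scale_right_distrib E.scale)

lemma of_coord_filt: "m < c n \<Longrightarrow> of_coord m p \<in> filt (Suc m)"
  by (induction p)
    (auto simp: of_coord_pCons intro!: subspace_add subspace_scale subspace_0 subspace_filt e_filt b_filt start_less)

lemma coord_of_coord:
  assumes "m < c n"
  shows "coord m (of_coord m p) = p"
proof (induction p)
  case (pCons a p)
  have "of_coord m p \<in> total" using of_coord_filt[OF assms] filt_total by blast
  then show ?case
    using pCons start_less[OF assms]
    by (simp add: of_coord_pCons C.add C.scale coord_b coord_e monom_0)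
qed (simp add: C.zero)

lemma of_coord_monom:
  assumes "m < c n"
  shows "of_coord m (monom 1 (n - start m)) = b n m"
  using start_le[OF assms] assms
proof (induction n rule: dec_induct)
  case base
  then show ?case by (simp add: monom_0 of_coord_pCons E.zero)
next
  case (step k)
  have "m < c k" using step start_less[OF step.prems] c_mono'[of "start m" k] by simp
  then show ?case using step by (simp add: Suc_diff_le monom_Suc of_coord_pCons e_b)
qed

text \<open>Modulo \<open>filt m\<close> a vector of \<open>filt (Suc m)\<close> is a polynomial in
  \<open>e\<close> applied to the generator, and \<open>of_coord\<close> reconstructs that part from
  its coordinate.\<close>

lemma coord_kernel:
  assumes "v \<in> filt (Suc m)" "coord m v = 0"
  shows "v \<in> filt m"
proof -
  let ?C = "{b n m | n. m < c n}"
  have "basis_upto (Suc m) = basis_upto m \<union> ?C" by (force simp: basis_upto_def less_Suc_eq)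
  then obtain x y where xy: "v = x + y" "x \<in> filt m" "y \<in> span ?C"
    using assms(1) unfolding filt_def by (auto simp: span_Un)
  have "of_coord m (coord m y) = y"
    using xy(3)
  proof (induction rule: span_induct_alt)
    case base
    show ?case by (simp add: C.zero)
  next
    case (step a x y)
    then show ?case
      by (auto simp: C.add C.scale of_coord_add of_coord_smult coord_b of_coord_monom)
  qed
  moreover have "coord m y = 0" using assms(2) xy by (simp add: C.add coord_filt)
  ultimately have "y = 0" by simp
  then show ?thesis using xy by simp
qed

lemma act_linear: "act A (v + w) = act A v + act A w" "act A (scale a v) = scale a (act A v)"
  by (simp_all add: act_def E.add F.add H.add E.scale F.scale H.scale algebra_simps
      scale_right_distrib scale_left_commute)

text \<open>\<open>coord m\<close> is onto with kernel \<open>filt m\<close>. The weight is the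
  eigenvalue of \<open>h\<close> on the generator, which sits in degree
  \<open>start m\<close>.\<close>

lemma sl2_iso_filt_quotient:
  fixes R :: "'v sl2_rep"
  assumes R: "carrier R = filt (Suc m)" "add R = (+)" "module.smult R = scale" "rep_act R = act"
    and m: "m < c n"
  shows "sl2_iso (quot_rep R (filt m)) (verma_minus (2 * of_nat (start m) - M))"
proof (rule sl2_iso_trans[OF _ sl2_iso_poly_rep_verma])
  have st: "v \<in> total" if "v \<in> filt (Suc m)" for v using that filt_total by blast
  have "coord m ` filt (Suc m) = UNIV"
    using coord_of_coord[OF m] of_coord_filt[OF m] by (metis image_iff UNIV_eq_I)
  moreover have "add_subgrp (filt (Suc m))"
    using subspace_filt by (simp add: add_subgrp_def subspace_0 subspace_diff)
  moreover have "coord m (act A v) = poly_act (2 * of_nat (start m) - M) A (coord m v)"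
    if "v \<in> filt (Suc m)" for A v
    using that st[OF that] by (simp add: act_def poly_act_def C.add C.scale coord_e coord_f coord_h)
  moreover have "filt m = {v \<in> filt (Suc m). coord m v = 0}"
    using filt_mono[of m "Suc m"] coord_filt coord_kernel by auto
  ultimately show "sl2_iso (quot_rep R (filt m)) (poly_rep (2 * of_nat (start m) - M))"
    using subspace_filt[of "Suc m"]
    by (intro sl2_iso_quot_rep[where T = "coord m"])
      (simp_all add: R poly_rep_def C.add C.scale act_filt act_linear scale_right_distrib
        subspace_scale poly_act_0)
qed

section \<open>The sl_2 relations on the whole graded module\<close>

lemma linear_eq_on_span:
  assumes "Vector_Spaces.linear scale scale s" "Vector_Spaces.linear scale scale t"
    and "\<And>x. x \<in> S \<Longrightarrow> s x = t x" "v \<in> span S"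
  shows "s v = t v"
proof -
  interpret V: vector_space_pair scale scale
    by (simp add: vector_space_pair_def vector_space_axioms)
  show ?thesis using V.linear_eq_on[OF assms(1,2,4,3)] by simp
qed

lemma linear_compose_diff:
  assumes "Vector_Spaces.linear scale scale r" "Vector_Spaces.linear scale scale s"
    "Vector_Spaces.linear scale scale t" "Vector_Spaces.linear scale scale u"
  shows "Vector_Spaces.linear scale scale (\<lambda>v. r (s v) - t (u v))"
proof -
  interpret V: vector_space_pair scale scale
    by (simp add: vector_space_pair_def vector_space_axioms)
  show ?thesis
    using V.linear_compose_sub[OF Vector_Spaces.linear_compose[OF assms(2,1)] Vector_Spaces.linear_compose[OF assms(4,3)]]
    by (simp add: o_def)
qed

lemma linear_scale_fun:
  assumes "Vector_Spaces.linear scale scale r"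
  shows "Vector_Spaces.linear scale scale (\<lambda>v. scale a (r v))"
proof -
  interpret V: vector_space_pair scale scale
    by (simp add: vector_space_pair_def vector_space_axioms)
  show ?thesis using V.linear_compose_scale_right[OF assms] .
qed

lemma e_total: "v \<in> total \<Longrightarrow> e v \<in> total"
  unfolding total_def
proof (erule linear_image_span[OF linear_e, rotated])
  fix x assume "x \<in> {b n i | n i. i < c n}"
  then obtain n i where "x = b n i" "i < c n" by auto
  then show "e x \<in> span {b n i | n i. i < c n}"
    using e_b c_mono[of n] b_total[of i "Suc n"] by (simp add: total_def)
qed

lemma h_weight: "v \<in> span (b n ` {..<c n}) \<Longrightarrow> h v = scale (2 * of_nat n - M) v"
proof (erule linear_eq_on_span[rotated -1])
  show "Vector_Spaces.linear scale scale (\<lambda>v. scale (2 * of_nat n - M) v)"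
    using linear_scale_fun[OF linear_id] by simp
qed (auto simp: linear_h h_b)

text \<open>Only the first relation rests on the hypothesis \<open>ef\<close>. The others are degree
  counts: \<open>e\<close> and \<open>f\<close> shift the degree by one, and \<open>h\<close> is a
  scalar in each degree that grows by 2 per step.\<close>

lemma relations:
  assumes "v \<in> total"
  shows "e (f v) - f (e v) = h v" "h (e v) - e (h v) = scale 2 (e v)"
    "h (f v) - f (h v) = scale (- 2) (f v)"
proof -
  show "e (f v) - f (e v) = h v"
    using assms unfolding total_def
    by (elim linear_eq_on_span[OF linear_compose_diff[OF linear_e linear_f linear_f linear_e] linear_h, rotated])
      (auto simp: ef)
  show "h (e v) - e (h v) = scale 2 (e v)"
    using assms unfolding total_def
  proof (elim linear_eq_on_span[OF linear_compose_diff[OF linear_h linear_e linear_e linear_h] linear_scale_fun[OF linear_e], rotated])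
    fix x assume "x \<in> {b n i | n i. i < c n}"
    then obtain n i where x: "x = b n i" "i < c n" by auto
    have "i < c (Suc n)" using x(2) c_mono[of n] by simp
    then have "h (e x) - e (h x) = scale (2 * of_nat (Suc n) - M) (e x) - scale (2 * of_nat n - M) (e x)"
      using x by (simp only: e_b h_b E.scale)
    then show "h (e x) - e (h x) = scale 2 (e x)"
      by (simp add: scale_left_diff_distrib[symmetric])
  qed
  show "h (f v) - f (h v) = scale (- 2) (f v)"
    using assms unfolding total_def
  proof (elim linear_eq_on_span[OF linear_compose_diff[OF linear_h linear_f linear_f linear_h] linear_scale_fun[OF linear_f], rotated])
    fix x assume "x \<in> {b n i | n i. i < c n}"
    then obtain n i where x: "x = b n i" "i < c n" by auto
    have "f (h x) = scale (2 * of_nat n - M) (f x)" using x by (simp only: h_b F.scale)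
    then show "h (f x) - f (h x) = scale (- 2) (f x)"
    proof (cases n)
      case 0
      then have "f x = 0" using x f_b0 by simp
      then show ?thesis using \<open>f (h x) = _\<close> by (simp add: H.zero)
    next
      case (Suc k)
      then have "h (f x) = scale (2 * of_nat k - M) (f x)" using x f_b h_weight by blast
      then show ?thesis using \<open>f (h x) = _\<close> Suc
        by (simp add: scale_left_diff_distrib[symmetric])
    qed
  qed
qed

lemma f_total: "v \<in> total \<Longrightarrow> f v \<in> total"
  unfolding total_def
proof (erule linear_image_span[OF linear_f, rotated])
  fix x assume "x \<in> {b n i | n i. i < c n}"
  then obtain n i where "x = b n i" "i < c n" by auto
  then show "f x \<in> span {b n i | n i. i < c n}"
    using f_filt_basis[of i "Suc i" n] filt_total[of "Suc i"] by (auto simp: total_def)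
qed

lemma h_total: "v \<in> total \<Longrightarrow> h v \<in> total"
  unfolding total_def
proof (erule linear_image_span[OF linear_h, rotated])
  fix x assume "x \<in> {b n i | n i. i < c n}"
  then show "h x \<in> span {b n i | n i. i < c n}"
    using h_b b_total span_scale unfolding total_def by auto
qed

lemma act_total: "v \<in> total \<Longrightarrow> act A v \<in> total"
  unfolding act_def using e_total f_total h_total subspace_total
  by (intro subspace_add subspace_scale) auto

context
  fixes R :: "'v sl2_rep"
  assumes R: "carrier R = total" "add R = (+)" "ring.zero R = 0" "module.smult R = scale" "rep_act R = act"
begin

lemma abelian_group_R: "abelian_group R"
proof (rule abelian_groupI)
  fix x assume "x \<in> carrier R"
  then show "\<exists>y\<in>carrier R. y \<oplus>\<^bsub>R\<^esub> x = \<zero>\<^bsub>R\<^esub>"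
    using subspace_neg[OF subspace_total] by (intro bexI[of _ "- x"]) (simp_all add: R)
qed (simp_all add: R subspace_total subspace_add subspace_0 algebra_simps)

lemma a_inv_R: "x \<in> total \<Longrightarrow> \<ominus>\<^bsub>R\<^esub> x = - x"
  using subspace_neg[OF subspace_total]
  by (intro abelian_group.minus_equality[OF abelian_group_R]) (simp_all add: R)

lemma a_minus_R: "y \<in> total \<Longrightarrow> x \<ominus>\<^bsub>R\<^esub> y = x - y"
  by (simp add: a_minus_def a_inv_R R)

lemma module_R: "Module.module complex_field R"
  by (rule moduleI[OF cring_complex_field abelian_group_R])
    (simp_all add: R complex_field_def subspace_scale subspace_total scale_left_distrib scale_right_distrib)

lemma sl2_module_R: "sl2_module R"
proof -
  have br: "act (lie_bracket A B) v = act A (act B v) - act B (act A v)"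
    if "A \<in> sl2" "B \<in> sl2" "v \<in> total" for A B v
    using sl2_comb_bracket[where e = e and f = f and h = h and v = v and scale' = scale,
        OF linear_e linear_f linear_h relations[OF that(3)] that(1,2)]
    unfolding act_def by simp
  show ?thesis
    unfolding sl2_module_def
    using module_R
    by (auto simp: R act_total act_linear a_minus_R br)
      (auto simp: act_def scale_left_distrib scale_right_distrib mat_entries algebra_simps)
qed

lemma sl2_subrep_filt: "sl2_subrep (filt m) R"
proof -
  have "submodule (filt m) complex_field R"
  proof (rule Module.module.submoduleI[OF module_R])
    show "filt m \<subseteq> carrier R" using filt_total by (simp add: R)
    show "\<zero>\<^bsub>R\<^esub> \<in> filt m" using subspace_0[OF subspace_filt] by (simp add: R)
    show "\<And>a. a \<in> filt m \<Longrightarrow> \<ominus>\<^bsub>R\<^esub> a \<in> filt m"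
      using filt_total subspace_neg[OF subspace_filt] by (auto simp: a_inv_R subset_iff)
  qed (simp_all add: R subspace_add subspace_scale subspace_filt)
  then show ?thesis by (auto simp: sl2_subrep_def sl2_module_R R act_filt)
qed

end

text \<open>A vector involves finitely many indices. The bound on \<open>m\<close> is recorded
  because the filtration ends at the number of generators, which may be finite.\<close>

lemma total_filt:
  assumes "v \<in> total"
  shows "\<exists>m. enat m \<le> (SUP n. enat (c n)) \<and> v \<in> filt m"
  using assms unfolding total_def
proof (induction rule: span_induct_alt)
  case base
  show ?case using subspace_0[OF subspace_filt, of 0] by (intro exI[of _ 0]) (simp add: zero_enat_def[symmetric])
next
  case (step a x y)
  then obtain n i m where x: "x = b n i" "i < c n" and y: "enat m \<le> (SUP n. enat (c n))" "y \<in> filt m"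
    by auto
  have "enat (Suc i) \<le> enat (c n)" using x(2) by simp
  also have "\<dots> \<le> (SUP n. enat (c n))" by (rule SUP_upper) simp
  finally have "enat (max (Suc i) m) \<le> (SUP n. enat (c n))" using y(1) by (simp add: max_def)
  moreover have "x \<in> filt (max (Suc i) m)" "y \<in> filt (max (Suc i) m)"
    using x b_filt[of i "max (Suc i) m"] y(2) filt_mono[of m "max (Suc i) m"] by auto
  ultimately show ?case
    by (intro exI[of _ "max (Suc i) m"] conjI subspace_add subspace_scale subspace_filt)
qed

lemma Union_filt: "(\<Union>m\<in>{m. enat m \<le> (SUP n. enat (c n))}. filt m) = total"
  using total_filt filt_total by (intro equalityI UN_least subsetI) auto

lemma dimension_count:
  "{i \<in> {i. \<exists>n. i < c n}. shifted_ones (start i) n \<noteq> 0} = {..<c n}"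
proof -
  have "shifted_ones (start i) n \<noteq> 0 \<longleftrightarrow> start i \<le> n" for i by (simp add: shifted_ones_def)
  then show ?thesis unfolding lessThan_def by (subst less_c_iff) simp
qed

end

section \<open>Finiteness of orbits\<close>

lemma finite_image_factor:
  assumes "finite (f ` S)" "\<And>x y. x \<in> S \<Longrightarrow> y \<in> S \<Longrightarrow> f x = f y \<Longrightarrow> g x = g y"
  shows "finite (g ` S)"
proof -
  have "g x = g (SOME y. y \<in> S \<and> f y = f x)" if "x \<in> S" for x
    using someI[of "\<lambda>y. y \<in> S \<and> f y = f x" x] that by (intro assms(2)) auto
  then have "g ` S \<subseteq> (\<lambda>k. g (SOME y. y \<in> S \<and> f y = k)) ` f ` S" by auto
  then show ?thesis using assms(1) finite_surj by blast
qed

lemma group_action_elementary: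
  assumes "Group.group K"
    and closed: "\<And>g z. g \<in> carrier K \<Longrightarrow> z \<in> E \<Longrightarrow> \<phi> g z \<in> E"
    and mult: "\<And>g h z. g \<in> carrier K \<Longrightarrow> h \<in> carrier K \<Longrightarrow> z \<in> E \<Longrightarrow> \<phi> (g \<otimes>\<^bsub>K\<^esub> h) z = \<phi> g (\<phi> h z)"
    and one: "\<And>z. z \<in> E \<Longrightarrow> \<phi> \<one>\<^bsub>K\<^esub> z = z"
    and ext: "\<And>g. g \<in> carrier K \<Longrightarrow> \<phi> g \<in> extensional E"
  shows "group_action K E \<phi>"
proof -
  interpret Group.group K by fact
  have bij: "\<phi> g \<in> Bij E" if g: "g \<in> carrier K" for g
  proof -
    have "bij_betw (\<phi> g) E E"
      using g closed mult[symmetric] one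
      by (intro bij_betw_byWitness[where f' = "\<phi> (inv\<^bsub>K\<^esub> g)"]) auto
    then show ?thesis using ext[OF g] by (simp add: Bij_def)
  qed
  have "\<phi> (g \<otimes>\<^bsub>K\<^esub> h) = \<phi> g \<otimes>\<^bsub>BijGroup E\<^esub> \<phi> h" if "g \<in> carrier K" "h \<in> carrier K" for g h
    using that ext bij mult
    by (intro extensionalityI[of _ E]) (auto simp: BijGroup_def compose_def)
  then have "\<phi> \<in> hom K (BijGroup E)"
    using bij by (auto simp: hom_def BijGroup_def)
  then show ?thesis
    by (simp add: group_action_def group_hom_def group_hom_axioms_def group_axioms group_BijGroup)
qed

locale oligomorphic_group =
  fixes X :: "'x set" and G :: "('x \<Rightarrow> 'x) set"
  assumes oligomorphic: "oligomorphic X G"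
begin

lemma subgroup_G: "subgroup G (BijGroup X)"
  using oligomorphic by (simp add: oligomorphic_def)

sublocale B: Group.group "BijGroup X" by (rule group_BijGroup)

abbreviation mul (infixl "\<cdot>" 70) where "g \<cdot> h \<equiv> g \<otimes>\<^bsub>BijGroup X\<^esub> h"
abbreviation iv where "iv \<equiv> m_inv (BijGroup X)"

lemma carrier_BijGroup: "carrier (BijGroup X) = Bij X"
  by (simp add: BijGroup_def)

lemma open_subgroupD:
  assumes "open_subgroup X G U"
  shows "subgroup U (BijGroup X)" "U \<subseteq> G" "U \<subseteq> Bij X"
    "\<one>\<^bsub>BijGroup X\<^esub> \<in> U" "g \<in> U \<Longrightarrow> h \<in> U \<Longrightarrow> g \<cdot> h \<in> U" "g \<in> U \<Longrightarrow> iv g \<in> U"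
proof -
  show s: "subgroup U (BijGroup X)" "U \<subseteq> G"
    using assms perm_group_simps(2)[OF subgroup_G] by (auto simp: open_subgroup_def)
  show "U \<subseteq> Bij X" using subgroup.subset[OF s(1)] by (simp add: BijGroup_def)
  show "\<one>\<^bsub>BijGroup X\<^esub> \<in> U" "g \<in> U \<Longrightarrow> h \<in> U \<Longrightarrow> g \<cdot> h \<in> U" "g \<in> U \<Longrightarrow> iv g \<in> U"
    using s(1) by (simp_all add: subgroup.one_closed subgroup.m_closed subgroup.m_inv_closed)
qed

lemma open_subgroup_superset:
  assumes "open_subgroup X G V" "V \<subseteq> U" "subgroup U (BijGroup X)" "U \<subseteq> G"
  shows "open_subgroup X G U"
proof -
  obtain A where "finite A" "A \<subseteq> X" "{g \<in> G. \<forall>x\<in>A. g x = x} \<subseteq> V"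
    using assms(1) unfolding open_subgroup_iff[OF subgroup_G] by blast
  then show ?thesis
    unfolding open_subgroup_iff[OF subgroup_G] perm_group_simps(2)[OF subgroup_G]
    using assms(2-) by (intro conjI exI[of _ A]) auto
qed

lemma open_subgroup_G: "open_subgroup X G G"
  unfolding open_subgroup_iff[OF subgroup_G] perm_group_simps(2)[OF subgroup_G]
  using subgroup_G by blast

lemma group_perm_group: "open_subgroup X G U \<Longrightarrow> Group.group (perm_group X U)"
  using perm_group_simps(1)[OF open_subgroupD(1)] .

lemma smooth_gsetD:
  assumes "smooth_gset X G Z"
  shows "open_subgroup X G (gs_grp Z)"
    "g \<in> gs_grp Z \<Longrightarrow> z \<in> gs_pts Z \<Longrightarrow> gs_act Z g z \<in> gs_pts Z"
    "g \<in> gs_grp Z \<Longrightarrow> h \<in> gs_grp Z \<Longrightarrow> z \<in> gs_pts Z \<Longrightarrow> gs_act Z (g \<cdot> h) z = gs_act Z g (gs_act Z h z)"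
    "z \<in> gs_pts Z \<Longrightarrow> gs_act Z \<one>\<^bsub>BijGroup X\<^esub> z = z"
    "g \<in> gs_grp Z \<Longrightarrow> z \<in> gs_pts Z \<Longrightarrow> gs_act Z (iv g) (gs_act Z g z) = z"
    "g \<in> gs_grp Z \<Longrightarrow> z \<in> gs_pts Z \<Longrightarrow> gs_act Z g (gs_act Z (iv g) z) = z"
    "g \<in> gs_grp Z \<Longrightarrow> gs_act Z g \<in> extensional (gs_pts Z)"
    "z \<in> gs_pts Z \<Longrightarrow> open_subgroup X G {g \<in> gs_grp Z. gs_act Z g z = z}"
proof -
  interpret A: group_action "perm_group X (gs_grp Z)" "gs_pts Z" "gs_act Z"
    using assms by (simp add: smooth_gset_def)
  show o: "open_subgroup X G (gs_grp Z)" using assms by (simp add: smooth_gset_def)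
  show cl: "g \<in> gs_grp Z \<Longrightarrow> z \<in> gs_pts Z \<Longrightarrow> gs_act Z g z \<in> gs_pts Z" for g z
    using smooth_gset_act_closed[OF assms] .
  show m: "g \<in> gs_grp Z \<Longrightarrow> h \<in> gs_grp Z \<Longrightarrow> z \<in> gs_pts Z \<Longrightarrow>
      gs_act Z (g \<cdot> h) z = gs_act Z g (gs_act Z h z)" for g h z
    using A.composition_rule[of z g h] by simp
  show one: "z \<in> gs_pts Z \<Longrightarrow> gs_act Z \<one>\<^bsub>BijGroup X\<^esub> z = z" for z
    using A.id_eq_one by (metis (no_types, lifting) monoid.select_convs(2) monoid.surjective partial_object.update_convs(1) restrict_apply')
  have c: "g \<in> gs_grp Z \<Longrightarrow> g \<in> carrier (BijGroup X)" for g
    using open_subgroupD(3)[OF o] by (auto simp: carrier_BijGroup)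
  show "g \<in> gs_grp Z \<Longrightarrow> z \<in> gs_pts Z \<Longrightarrow> gs_act Z (iv g) (gs_act Z g z) = z"
    using m[of "iv g" g z] one open_subgroupD(6)[OF o] c by simp
  show "g \<in> gs_grp Z \<Longrightarrow> z \<in> gs_pts Z \<Longrightarrow> gs_act Z g (gs_act Z (iv g) z) = z"
    using m[of g "iv g" z] one open_subgroupD(6)[OF o] c by simp
  show "g \<in> gs_grp Z \<Longrightarrow> gs_act Z g \<in> extensional (gs_pts Z)"
    using A.bij_prop0[of g] by (simp add: Bij_def)
  show "z \<in> gs_pts Z \<Longrightarrow> open_subgroup X G {g \<in> gs_grp Z. gs_act Z g z = z}"
    using assms by (auto simp: smooth_gset_def stabilizer_def)
qed

lemma finite_tuple_orbits: "finite ((\<lambda>xs. (\<lambda>g. map g xs) ` G) ` {xs. set xs \<subseteq> X \<and> length xs = n})"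
proof -
  have "orbit (perm_group X G) map xs = (\<lambda>g. map g xs) ` G" for xs
    by (auto simp: orbit_def)
  then have "(\<lambda>xs. (\<lambda>g. map g xs) ` G) ` {xs. set xs \<subseteq> X \<and> length xs = n} =
      orbits (perm_group X G) {xs. set xs \<subseteq> X \<and> length xs = n} map"
    unfolding orbits_def by auto
  then show ?thesis using oligomorphic by (simp add: oligomorphic_def)
qed

lemma tuple_orbit_eqD:
  assumes "set ys \<subseteq> X" "(\<lambda>g. map g xs) ` G = (\<lambda>g. map g ys) ` G"
  shows "\<exists>h\<in>G. map h xs = ys"
proof -
  have "map \<one>\<^bsub>BijGroup X\<^esub> ys = ys"
    using assms(1) by (intro map_idI) (auto simp: BijGroup_def)
  then have "ys \<in> (\<lambda>g. map g ys) ` G"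
    using open_subgroupD(4)[OF open_subgroup_G] by (metis image_eqI)
  then have "ys \<in> (\<lambda>g. map g xs) ` G" using assms(2) by simp
  then show ?thesis by (metis imageE)
qed

text \<open>A point \<open>z = t\<^sub>z r\<^sub>z\<close> with \<open>r\<^sub>z\<close> in a finite set of orbit representatives is determined by
  \<open>r\<^sub>z\<close> and \<open>t\<^sub>z a\<close>, where the tuple \<open>a\<close> of points of \<open>X\<close> is so long that its stabilizer fixes all
  representatives.  This reduces orbits on tuples of \<open>Z\<close> to orbits on tuples of \<open>X\<close>.\<close>

lemma ghat_set_code:
  fixes Z :: "('x, 'z) gset"
  assumes Z: "ghat_set X G Z" and V: "open_subgroup X G V" "V \<subseteq> gs_grp Z"
  obtains code :: "'z list \<Rightarrow> 'z list \<times> 'x list set"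
  where "finite (code ` {xs. set xs \<subseteq> gs_pts Z \<and> length xs = n})"
    "\<And>xs ys. set xs \<subseteq> gs_pts Z \<Longrightarrow> length xs = n \<Longrightarrow> set ys \<subseteq> gs_pts Z \<Longrightarrow> length ys = n \<Longrightarrow>
       code xs = code ys \<Longrightarrow> \<exists>h\<in>V. map (gs_act Z h) xs = ys"
proof -
  let ?U = "gs_grp Z" and ?P = "gs_pts Z" and ?act = "gs_act Z"
  have sm: "smooth_gset X G Z" using Z by (simp add: ghat_set_def)
  note D = smooth_gsetD[OF sm]
  note oU = open_subgroupD[OF D(1)]
  interpret A: group_action "perm_group X ?U" ?P ?act using sm by (simp add: smooth_gset_def)
  let ?O = "orbits (perm_group X ?U) ?P ?act"
  define rep where "rep z = (SOME y. y \<in> orbit (perm_group X ?U) ?act z)" for z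
  have rep: "rep z \<in> orbit (perm_group X ?U) ?act z" if "z \<in> ?P" for z
    unfolding rep_def using A.orbit_refl[OF that] by (rule someI)
  then have repP: "rep z \<in> ?P" if "z \<in> ?P" for z
    using that D(2) by (fastforce simp: orbit_def)
  have "\<exists>t\<in>?U. ?act t (rep z) = z" if "z \<in> ?P" for z
    using A.orbit_sym[OF that repP[OF that] rep[OF that]] unfolding orbit_def by force
  then obtain tr where tr: "\<And>z. z \<in> ?P \<Longrightarrow> tr z \<in> ?U" "\<And>z. z \<in> ?P \<Longrightarrow> ?act (tr z) (rep z) = z"
    by metis
  have "finite ((\<lambda>z. orbit (perm_group X ?U) ?act z) ` ?P)"
  proof -
    have "(\<lambda>z. orbit (perm_group X ?U) ?act z) ` ?P = ?O" by (auto simp: orbits_def)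
    then show ?thesis using Z by (simp add: ghat_set_def)
  qed
  then have fin: "finite (rep ` ?P)"
    by (rule finite_image_factor) (simp add: rep_def)
  have "\<forall>r\<in>?P. \<exists>A. finite A \<and> A \<subseteq> X \<and> {g \<in> G. \<forall>x\<in>A. g x = x} \<subseteq> {g \<in> ?U. ?act g r = r}"
    using D(8) unfolding open_subgroup_iff[OF subgroup_G] by blast
  from bchoice[OF this] obtain fx where fx_all: "\<forall>r\<in>?P. finite (fx r) \<and> fx r \<subseteq> X \<and>
      {g \<in> G. \<forall>x\<in>fx r. g x = x} \<subseteq> {g \<in> ?U. ?act g r = r}" by (rule exE)
  have fx: "finite (fx r)" "fx r \<subseteq> X" "{g \<in> G. \<forall>x\<in>fx r. g x = x} \<subseteq> {g \<in> ?U. ?act g r = r}"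
    if "r \<in> ?P" for r using bspec[OF fx_all that] by simp_all
  have "finite (\<Union>r\<in>rep ` ?P. fx r)" by (intro finite_UN_I[OF fin]) (use fx(1) repP in auto)
  from finite_list[OF this] obtain a where a: "set a = (\<Union>r\<in>rep ` ?P. fx r)" ..
  have aX: "set a \<subseteq> X" using a fx(2) repP by auto
  obtain A where A: "finite A" "A \<subseteq> X" and AV: "{g \<in> G. \<forall>x\<in>A. g x = x} \<subseteq> V"
    using V(1) unfolding open_subgroup_iff[OF subgroup_G] by blast
  from finite_list[OF A(1)] obtain v where vA: "set v = A" ..
  then have v: "set v = A" "set v \<subseteq> X" using A(2) by simp_all
  \<comment> \<open>The points \<open>v\<close> in front have their pointwise stabilizer inside
    \<open>V\<close>. An element of \<open>G\<close> that carries one such tuple to another fixes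
    \<open>v\<close>, hence belongs to \<open>V\<close>.\<close>
  define tup where "tup xs = v @ concat (map (\<lambda>z. map (tr z) a) xs)" for xs
  define code where "code xs = (map rep xs, (\<lambda>g. map g (tup xs)) ` G)" for xs
  let ?L = "\<lambda>n. {xs. set xs \<subseteq> ?P \<and> length xs = n}"
  have trX: "tr z x \<in> X" if "z \<in> ?P" "x \<in> X" for z x
    using tr(1)[OF that(1)] oU(3) that(2) Bij_imp_funcset by blast
  have tupX: "set (tup xs) \<subseteq> X" if "set xs \<subseteq> ?P" for xs
    using that v(2) aX by (auto simp: tup_def subset_iff intro!: trX)
  have len: "length (tup xs) = length v + length xs * length a" for xs
    by (induction xs) (simp_all add: tup_def)
  have "code ` ?L n \<subseteq> {ys. set ys \<subseteq> rep ` ?P \<and> length ys = n} \<times>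
      (\<lambda>xs. (\<lambda>g. map g xs) ` G) ` {xs. set xs \<subseteq> X \<and> length xs = length v + n * length a}"
    using tupX len by (auto simp: code_def image_subset_iff)
  then have 1: "finite (code ` ?L n)"
    using finite_lists_length_eq[OF fin] finite_tuple_orbits by (rule finite_subset[OF _ finite_cartesian_product])
  have 2: "\<exists>h\<in>V. map (?act h) xs = ys" if xs: "set xs \<subseteq> ?P" "length xs = n"
    and ys: "set ys \<subseteq> ?P" "length ys = n" and eq: "code xs = code ys" for xs ys
  proof -
    have r: "map rep xs = map rep ys" using eq by (simp add: code_def)
    obtain h where h: "h \<in> G" "map h (tup xs) = tup ys"
      using tuple_orbit_eqD[OF tupX[OF ys(1)], of "tup xs"] eq by (auto simp: code_def)
    have hv: "map h v = v" and hc: "map h (concat (map (\<lambda>z. map (tr z) a) xs)) = concat (map (\<lambda>z. map (tr z) a) ys)"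
      using h(2) by (simp_all add: tup_def)
    have hV: "h \<in> V" using hv h(1) AV v(1) map_idI[of v] by (auto simp: map_eq_conv[of h v id, simplified])
    \<comment> \<open>All blocks have the length of \<open>a\<close>, so the concatenations can be
      cut apart again.\<close>
    have hm: "map (\<lambda>z. map (h \<circ> tr z) a) xs = map (\<lambda>z. map (tr z) a) ys"
      using hc xs ys by (intro concat_injective) (auto simp: map_concat o_def set_zip)
    have ha: "map (h \<circ> tr (xs ! i)) a = map (tr (ys ! i)) a" if "i < n" for i
      using arg_cong[OF hm, of "\<lambda>l. l ! i"] that xs(2) ys(2) by simp
    have "?act h (xs ! i) = ys ! i" if i: "i < n" for i
    proof -
      let ?x = "xs ! i" and ?y = "ys ! i"
      have xy: "?x \<in> ?P" "?y \<in> ?P" using xs ys i by (auto simp: subset_iff)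
      have rxy: "rep ?x = rep ?y" using arg_cong[OF r, of "\<lambda>l. l ! i"] i xs(2) ys(2) by simp
      \<comment> \<open>This element fixes all points of \<open>a\<close>, hence the common
        representative \<open>r\<close> of the two points. Applying \<open>h\<close> to the first
        point \<open>tr ?x r\<close> thus gives \<open>tr ?y\<close> applied to \<open>r\<close>,
        the second point.\<close>
      let ?k = "iv (tr ?y) \<cdot> (h \<cdot> tr ?x)"
      have hU: "h \<in> ?U" using hV V(2) by blast
      have kU: "?k \<in> ?U" using oU(5,6) tr(1)[OF xy(1)] tr(1)[OF xy(2)] hU by blast
      have B: "tr ?x \<in> Bij X" "tr ?y \<in> Bij X" "h \<in> Bij X" "iv (tr ?y) \<in> Bij X" "h \<cdot> tr ?x \<in> Bij X"
        using oU(3,5,6) tr(1)[OF xy(1)] tr(1)[OF xy(2)] hU by blast+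
      have "?k w = w" if "w \<in> set a" for w
      proof -
        have wX: "w \<in> X" using that aX by blast
        have "h (tr ?x w) = tr ?y w" using ha[OF i] that by (simp add: o_def)
        then have "?k w = iv (tr ?y) (tr ?y w)"
          using B wX by (simp add: BijGroup_mult)
        then show ?thesis using BijGroup_inv[OF B(2) wX] by simp
      qed
      then have "?k \<in> {g \<in> G. \<forall>x\<in>fx (rep ?x). g x = x}"
        using a xy kU oU(2) by blast
      then have k: "?act ?k (rep ?x) = rep ?x" using fx(3)[OF repP[OF xy(1)]] by blast
      have "?act h ?x = ?act (h \<cdot> tr ?x) (rep ?x)"
        using D(3)[OF hU tr(1)[OF xy(1)] repP[OF xy(1)]] tr(2)[OF xy(1)] by simp
      also have "h \<cdot> tr ?x = tr ?y \<cdot> ?k"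
        using B B.m_assoc[of "tr ?y" "iv (tr ?y)" "h \<cdot> tr ?x"] by (simp add: carrier_BijGroup)
      also have "?act \<dots> (rep ?x) = ?act (tr ?y) (rep ?x)"
        using D(3)[OF tr(1)[OF xy(2)] kU repP[OF xy(1)]] k by simp
      also have "\<dots> = ?y" using rxy tr(2)[OF xy(2)] by simp
      finally show ?thesis .
    qed
    then have "map (?act h) xs = ys" using xs(2) ys(2) by (intro nth_equalityI) auto
    then show ?thesis using hV by blast
  qed
  show ?thesis using that[OF 1 2] .
qed

text \<open>The orbit of a point is determined by the code of its one-element tuple. Passing to a
  smaller open group thus keeps the number of orbits finite, and with it all sums over
  orbits.\<close>

lemma finite_orbits:
  fixes Z :: "('x, 'z) gset"
  assumes Z: "ghat_set X G Z" and V: "open_subgroup X G V" "V \<subseteq> gs_grp Z" and A: "A \<subseteq> gs_pts Z"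
  shows "finite (orbits (perm_group X V) A (gs_act Z))"
proof -
  obtain code :: "'z list \<Rightarrow> 'z list \<times> 'x list set"
    where code: "finite (code ` {xs. set xs \<subseteq> gs_pts Z \<and> length xs = 1})"
    "\<And>xs ys. set xs \<subseteq> gs_pts Z \<Longrightarrow> length xs = 1 \<Longrightarrow> set ys \<subseteq> gs_pts Z \<Longrightarrow> length ys = 1 \<Longrightarrow>
       code xs = code ys \<Longrightarrow> \<exists>h\<in>V. map (gs_act Z h) xs = ys"
    using ghat_set_code[OF Z V] by blast
  have sm: "smooth_gset X G Z" using Z by (simp add: ghat_set_def)
  note D = smooth_gsetD[OF sm]
  note oV = open_subgroupD[OF V(1)]
  have sub: "orbit (perm_group X V) (gs_act Z) (gs_act Z h z) \<subseteq> orbit (perm_group X V) (gs_act Z) z"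
    if "h \<in> V" "z \<in> gs_pts Z" for h z
  proof -
    have "gs_act Z g (gs_act Z h z) = gs_act Z (g \<cdot> h) z" if "g \<in> V" for g
      using D(3) V(2) \<open>h \<in> V\<close> \<open>z \<in> gs_pts Z\<close> that by (metis subsetD)
    then show ?thesis using oV(5)[OF _ that(1)] by (fastforce simp: orbit_def)
  qed
  have "orbit (perm_group X V) (gs_act Z) y = orbit (perm_group X V) (gs_act Z) z"
    if yz: "y \<in> A" "z \<in> A" "code [y] = code [z]" for y z
  proof -
    have yzP: "y \<in> gs_pts Z" "z \<in> gs_pts Z" using A yz by auto
    then obtain h where h: "h \<in> V" "gs_act Z h y = z" using code(2)[of "[y]" "[z]"] yz by auto
    moreover have "gs_act Z (iv h) z = y" using D(5)[of h y] h V(2) yzP by auto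
    ultimately show ?thesis
      using sub[OF h(1) yzP(1)] sub[OF oV(6)[OF h(1)] yzP(2)] by simp
  qed
  moreover have "finite ((\<lambda>z. code [z]) ` A)"
    by (rule finite_subset[OF _ code(1)]) (use A in auto)
  ultimately have "finite (orbit (perm_group X V) (gs_act Z) ` A)"
    using finite_image_factor[of "\<lambda>z. code [z]" A "orbit (perm_group X V) (gs_act Z)"] by blast
  moreover have "orbit (perm_group X V) (gs_act Z) ` A = orbits (perm_group X V) A (gs_act Z)"
    by (simp add: orbits_def Setcompr_eq_image)
  ultimately show ?thesis by simp
qed

lemma sub_gset_simps [simp]:
  "gs_grp (sub_gset U A Z) = U" "gs_pts (sub_gset U A Z) = A"
  "z \<in> A \<Longrightarrow> gs_act (sub_gset U A Z) g z = gs_act Z g z"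
  by (simp_all add: sub_gset_def)

lemma ghat_set_sub_gset:
  assumes Z: "ghat_set X G Z" and V: "open_subgroup X G V" "V \<subseteq> gs_grp Z"
    and A: "A \<subseteq> gs_pts Z" "\<And>g z. g \<in> V \<Longrightarrow> z \<in> A \<Longrightarrow> gs_act Z g z \<in> A"
  shows "ghat_set X G (sub_gset V A Z)"
proof -
  have sm: "smooth_gset X G Z" using Z by (simp add: ghat_set_def)
  note D = smooth_gsetD[OF sm]
  have "group_action (perm_group X V) A (gs_act (sub_gset V A Z))"
  proof (rule group_action_elementary)
    fix g assume "g \<in> carrier (perm_group X V)"
    then show "gs_act (sub_gset V A Z) g \<in> extensional A" by (simp add: sub_gset_def)
  qed (use A D V in \<open>auto simp: group_perm_group subset_iff\<close>)
  moreover have "open_subgroup X G (stabilizer (perm_group X V) (gs_act (sub_gset V A Z)) z)" if "z \<in> A" for z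
  proof -
    have "stabilizer (perm_group X V) (gs_act (sub_gset V A Z)) z = V \<inter> {g \<in> gs_grp Z. gs_act Z g z = z}"
      using that V(2) by (auto simp: stabilizer_def)
    then show ?thesis using open_subgroup_Int[OF subgroup_G V(1) D(8)] that A(1) by auto
  qed
  moreover have "orbits (perm_group X V) A (gs_act (sub_gset V A Z)) = orbits (perm_group X V) A (gs_act Z)"
  proof -
    have "orbit (perm_group X V) (gs_act (sub_gset V A Z)) z = orbit (perm_group X V) (gs_act Z) z"
      if "z \<in> A" for z using that by (auto simp: orbit_def)
    then have "orbit (perm_group X V) (gs_act (sub_gset V A Z)) ` A = orbit (perm_group X V) (gs_act Z) ` A"
      by simp
    then show ?thesis by (simp add: orbits_def Setcompr_eq_image)
  qed
  ultimately show ?thesis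
    using V finite_orbits[OF Z V A(1)] by (simp add: ghat_set_def smooth_gset_def)
qed

end

section \<open>Measures of subsets\<close>

locale measured_group = oligomorphic_group X G for X :: "'x set" and G +
  fixes \<mu> :: "('x, 'x gset_univ) gset \<Rightarrow> complex"
  assumes measure: "ghat_measure X G \<mu>"
begin

abbreviation meas :: "('x, 'z) gset \<Rightarrow> complex" where
  "meas Z \<equiv> measure_of_gset X G \<mu> Z"

lemma meas_eq: "ghat_set X G Z \<Longrightarrow> ghat_set X G Z' \<Longrightarrow> ghat_iso X G Z Z' \<Longrightarrow> meas Z = \<mu> Z'"
  using measure_of_gset_eq[OF subgroup_G measure] .

lemma meas_iso:
  assumes "ghat_set X G Z" "ghat_set X G Z'" "ghat_iso X G Z Z'"
  shows "meas Z = meas Z'"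
proof -
  obtain W :: "('x, 'x gset_univ) gset" where W: "ghat_set X G W" "ghat_iso X G Z' W"
    using ghat_set_has_copy[OF assms(2)] by blast
  then show ?thesis
    using meas_eq[OF assms(2) W] meas_eq[OF assms(1) W(1) ghat_iso_trans[OF subgroup_G assms(3) W(2)]]
    by simp
qed

lemma meas_singleton:
  assumes "ghat_set X G Z" "gs_pts Z = {p}"
  shows "meas Z = 1"
proof -
  obtain W :: "('x, 'x gset_univ) gset" where W: "ghat_set X G W" "ghat_iso X G Z W"
    using ghat_set_has_copy[OF assms(1)] by blast
  obtain \<beta> where "bij_betw \<beta> (gs_pts Z) (gs_pts W)"
    using W(2) unfolding ghat_iso_def by (elim exE conjE)
  then have "gs_pts W = {\<beta> p}" by (simp add: assms(2) bij_betw_def)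
  moreover have "\<forall>Z p. ghat_set X G Z \<and> gs_pts Z = {p} \<longrightarrow> \<mu> Z = 1"
    using measure unfolding ghat_measure_def by (elim conjE)
  ultimately show ?thesis using meas_eq[OF assms(1) W] W(1) by auto
qed

text \<open>The identity is an isomorphism over the smaller group, so the value depends on the
  subset and not on the open group through which it is viewed.\<close>

lemma meas_sub_gset_cong:
  assumes Z: "ghat_set X G Z" and U: "open_subgroup X G U" "U \<subseteq> gs_grp Z"
    and V: "open_subgroup X G V" "V \<subseteq> U"
    and A: "A \<subseteq> gs_pts Z" "\<And>g z. g \<in> U \<Longrightarrow> z \<in> A \<Longrightarrow> gs_act Z g z \<in> A"
  shows "meas (sub_gset V A Z) = meas (sub_gset U A Z)"
proof (rule meas_iso)
  show "ghat_set X G (sub_gset V A Z)" "ghat_set X G (sub_gset U A Z)"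
    using assms by (intro ghat_set_sub_gset[OF Z]; blast)+
  show "ghat_iso X G (sub_gset V A Z) (sub_gset U A Z)"
    unfolding ghat_iso_def using V by (intro exI[of _ id] exI[of _ V]) auto
qed

lemma meas_sub_gset_all:
  assumes Z: "ghat_set X G Z" and V: "open_subgroup X G V" "V \<subseteq> gs_grp Z"
  shows "meas (sub_gset V (gs_pts Z) Z) = meas Z"
proof (rule meas_iso[OF _ Z])
  have sm: "smooth_gset X G Z" using Z by (simp add: ghat_set_def)
  show "ghat_set X G (sub_gset V (gs_pts Z) Z)"
    using V smooth_gsetD(2)[OF sm] by (intro ghat_set_sub_gset[OF Z]) auto
  show "ghat_iso X G (sub_gset V (gs_pts Z) Z) Z"
    unfolding ghat_iso_def using V by (intro exI[of _ id] exI[of _ V]) auto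
qed

text \<open>The copy \<open>W\<close> on which \<open>\<mu>\<close> is given is isomorphic to the union only over a smaller group \<open>V'\<close>,
  to which the action on \<open>W\<close> has to be restricted before additivity applies.\<close>

lemma meas_sub_gset_Un:
  assumes Z: "ghat_set X G Z" and V: "open_subgroup X G V" "V \<subseteq> gs_grp Z"
    and A: "A \<subseteq> gs_pts Z" "\<And>g z. g \<in> V \<Longrightarrow> z \<in> A \<Longrightarrow> gs_act Z g z \<in> A"
    and B: "B \<subseteq> gs_pts Z" "\<And>g z. g \<in> V \<Longrightarrow> z \<in> B \<Longrightarrow> gs_act Z g z \<in> B"
    and AB: "A \<inter> B = {}"
  shows "meas (sub_gset V (A \<union> B) Z) = meas (sub_gset V A Z) + meas (sub_gset V B Z)"
proof -
  let ?Z = "sub_gset V (A \<union> B) Z"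
  have gZ: "ghat_set X G ?Z" "ghat_set X G (sub_gset V A Z)" "ghat_set X G (sub_gset V B Z)"
    using A B by (intro ghat_set_sub_gset[OF Z V]; blast)+
  obtain W :: "('x, 'x gset_univ) gset" where W: "ghat_set X G W" "ghat_iso X G ?Z W"
    using ghat_set_has_copy[OF gZ(1)] by blast
  then obtain \<beta> V' where \<beta>: "bij_betw \<beta> (A \<union> B) (gs_pts W)" and V': "open_subgroup X G V'"
      "V' \<subseteq> V \<inter> gs_grp W" and "\<forall>g\<in>V'. \<forall>z\<in>A \<union> B. \<beta> (gs_act ?Z g z) = gs_act W g (\<beta> z)"
    unfolding ghat_iso_def by auto
  then have eq: "\<And>g z. g \<in> V' \<Longrightarrow> z \<in> A \<union> B \<Longrightarrow> gs_act W g (\<beta> z) = \<beta> (gs_act Z g z)" by simp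
  have sW: "smooth_gset X G W" using W(1) by (simp add: ghat_set_def)
  let ?W = "sub_gset V' (gs_pts W) W"
  have img: "gs_pts W = \<beta> ` A \<union> \<beta> ` B" "\<beta> ` A \<inter> \<beta> ` B = {}"
    using \<beta> inj_on_image_Int[of \<beta> "A \<union> B" A B] AB by (auto simp: bij_betw_def image_Un)
  have gW: "ghat_set X G ?W"
    using V' smooth_gsetD(2)[OF sW] by (intro ghat_set_sub_gset[OF W(1)]) auto
  have piece: "ghat_set X G (sub_gset V' (\<beta> ` C) ?W)" "meas (sub_gset V C Z) = \<mu> (sub_gset V' (\<beta> ` C) ?W)"
    if C: "C \<subseteq> A \<union> B" "\<And>g z. g \<in> V \<Longrightarrow> z \<in> C \<Longrightarrow> gs_act Z g z \<in> C"
      "ghat_set X G (sub_gset V C Z)" for C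
  proof -
    have CW: "\<beta> z \<in> gs_pts W" if "z \<in> C" for z using that C(1) img(1) by blast
    have eqC: "gs_act ?W g (\<beta> z) = \<beta> (gs_act Z g z)" if "g \<in> V'" "z \<in> C" for g z
      using CW eq that C(1) by auto
    show g: "ghat_set X G (sub_gset V' (\<beta> ` C) ?W)"
      using V' CW eqC C(2) by (intro ghat_set_sub_gset[OF gW]) auto
    have "ghat_iso X G (sub_gset V C Z) (sub_gset V' (\<beta> ` C) ?W)"
      unfolding ghat_iso_def
    proof (intro exI conjI)
      show "bij_betw \<beta> (gs_pts (sub_gset V C Z)) (gs_pts (sub_gset V' (\<beta> ` C) ?W))"
        using \<beta> C(1) by (auto simp: bij_betw_def inj_on_def)
      show "open_subgroup X G V'" by (rule V')
      show "\<forall>g\<in>V'. \<forall>z\<in>gs_pts (sub_gset V C Z). \<beta> (gs_act (sub_gset V C Z) g z) =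
          gs_act (sub_gset V' (\<beta> ` C) ?W) g (\<beta> z)"
        using eqC by simp
    qed (use V' in auto)
    then show "meas (sub_gset V C Z) = \<mu> (sub_gset V' (\<beta> ` C) ?W)" by (rule meas_eq[OF C(3) g])
  qed
  have "\<forall>Z A B. ghat_set X G Z \<and> gs_pts Z = A \<union> B \<and> A \<inter> B = {} \<and>
        (\<forall>g \<in> gs_grp Z. gs_act Z g ` A \<subseteq> A \<and> gs_act Z g ` B \<subseteq> B) \<longrightarrow>
        \<mu> Z = \<mu> (sub_gset (gs_grp Z) A Z) + \<mu> (sub_gset (gs_grp Z) B Z)"
    using measure unfolding ghat_measure_def by (elim conjE)
  note additive = this[rule_format, of ?W "\<beta> ` A" "\<beta> ` B"]
  have stab: "gs_act ?W g ` \<beta> ` C \<subseteq> \<beta> ` C"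
    if "g \<in> V'" "C \<subseteq> A \<union> B" "\<And>g z. g \<in> V \<Longrightarrow> z \<in> C \<Longrightarrow> gs_act Z g z \<in> C" for g C
  proof (rule subsetI)
    fix w assume "w \<in> gs_act ?W g ` \<beta> ` C"
    then obtain z where z: "z \<in> C" "w = gs_act ?W g (\<beta> z)" by blast
    then have "gs_act Z g z \<in> C" using that V'(2) by blast
    moreover have "gs_act ?W g (\<beta> z) = \<beta> (gs_act Z g z)" using eq[OF that(1)] z(1) that(2) img(1) by auto
    ultimately show "w \<in> \<beta> ` C" using z(2) by simp
  qed
  have "\<mu> ?W = \<mu> (sub_gset V' (\<beta> ` A) ?W) + \<mu> (sub_gset V' (\<beta> ` B) ?W)"
    using additive gW img stab[of _ A] stab[of _ B] A(2) B(2) by simp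
  moreover have "meas ?Z = \<mu> ?W"
  proof (rule meas_eq[OF gZ(1) gW])
    show "ghat_iso X G ?Z ?W"
      unfolding ghat_iso_def
    proof (intro exI conjI)
      show "bij_betw \<beta> (gs_pts ?Z) (gs_pts ?W)" using \<beta> by simp
      show "open_subgroup X G V'" by (rule V')
      show "\<forall>g\<in>V'. \<forall>z\<in>gs_pts ?Z. \<beta> (gs_act ?Z g z) = gs_act ?W g (\<beta> z)"
        using eq img(1) by auto
    qed (use V' in auto)
  qed
  ultimately show ?thesis using piece(2)[of A] piece(2)[of B] A B gZ by auto
qed

section \<open>Conjugation by elements of \<open>G\<close> and translation of subsets\<close>

lemma Bij_closed: "g \<in> Bij X \<Longrightarrow> h \<in> Bij X \<Longrightarrow> g \<cdot> h \<in> Bij X" "g \<in> Bij X \<Longrightarrow> iv g \<in> Bij X"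
  using B.m_closed B.inv_closed by (simp_all add: carrier_BijGroup)

lemma cancel_iv: "g \<in> Bij X \<Longrightarrow> h \<in> Bij X \<Longrightarrow> iv g \<cdot> (g \<cdot> h) = h" "g \<in> Bij X \<Longrightarrow> h \<in> Bij X \<Longrightarrow> g \<cdot> (iv g \<cdot> h) = h"
  using B.m_assoc[of "iv g" g h] B.m_assoc[of g "iv g" h] Bij_closed(2)[of g]
  by (simp_all add: carrier_BijGroup)

lemma Bij_assoc: "g \<in> Bij X \<Longrightarrow> h \<in> Bij X \<Longrightarrow> k \<in> Bij X \<Longrightarrow> g \<cdot> h \<cdot> k = g \<cdot> (h \<cdot> k)"
  using B.m_assoc by (simp add: carrier_BijGroup)

lemma Bij_inv_simps: "g \<in> Bij X \<Longrightarrow> iv g \<cdot> g = \<one>\<^bsub>BijGroup X\<^esub>" "g \<in> Bij X \<Longrightarrow> g \<cdot> iv g = \<one>\<^bsub>BijGroup X\<^esub>"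
  "g \<in> Bij X \<Longrightarrow> g \<cdot> \<one>\<^bsub>BijGroup X\<^esub> = g" "g \<in> Bij X \<Longrightarrow> \<one>\<^bsub>BijGroup X\<^esub> \<cdot> g = g"
  by (simp_all add: carrier_BijGroup)

lemmas Bij_simps = cancel_iv Bij_closed Bij_assoc Bij_inv_simps

lemma conj_mem_iff:
  assumes "g \<in> Bij X" "V \<subseteq> Bij X" "h \<in> Bij X"
  shows "h \<in> (\<lambda>u. g \<cdot> u \<cdot> iv g) ` V \<longleftrightarrow> iv g \<cdot> h \<cdot> g \<in> V"
proof
  assume "h \<in> (\<lambda>u. g \<cdot> u \<cdot> iv g) ` V"
  then obtain u where u: "u \<in> V" "h = g \<cdot> u \<cdot> iv g" by blast
  have "iv g \<cdot> h \<cdot> g = u"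
    using assms(1,2) u by (simp add: u(2) Bij_simps subset_iff)
  then show "iv g \<cdot> h \<cdot> g \<in> V" using u by simp
next
  assume *: "iv g \<cdot> h \<cdot> g \<in> V"
  have "h = g \<cdot> (iv g \<cdot> h \<cdot> g) \<cdot> iv g"
    using assms(1,3) by (simp add: Bij_simps)
  then show "h \<in> (\<lambda>u. g \<cdot> u \<cdot> iv g) ` V" using * by blast
qed

abbreviation conj_grp where "conj_grp g V \<equiv> (\<lambda>u. g \<cdot> u \<cdot> iv g) ` V"

lemma Bij_G: "g \<in> G \<Longrightarrow> g \<in> Bij X"
  using open_subgroupD(3)[OF open_subgroup_G] by blast

lemma open_conj_grp:
  assumes V: "open_subgroup X G V" and g: "g \<in> G"
  shows "open_subgroup X G (conj_grp g V)"
proof -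
  note oV = open_subgroupD[OF V]
  note oG = open_subgroupD[OF open_subgroup_G]
  have gB: "g \<in> Bij X" using g by (rule Bij_G)
  have VB: "u \<in> Bij X" if "u \<in> V" for u using oV(3) that by blast
  have sub: "conj_grp g V \<subseteq> G"
    using oG(5,6) g oV(2) by blast
  obtain A where A: "finite A" "A \<subseteq> X" "{g \<in> G. \<forall>x\<in>A. g x = x} \<subseteq> V"
    using V unfolding open_subgroup_iff[OF subgroup_G] by blast
  have "subgroup (conj_grp g V) (BijGroup X)"
  proof (rule B.subgroupI)
    show "conj_grp g V \<subseteq> carrier (BijGroup X)" using sub Bij_G by (auto simp: carrier_BijGroup)
    show "conj_grp g V \<noteq> {}" using oV(4) by blast
  next
    fix a assume "a \<in> conj_grp g V"
    then obtain u where u: "u \<in> V" "a = g \<cdot> u \<cdot> iv g" by blast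
    have "iv a = g \<cdot> iv u \<cdot> iv g"
      using gB VB[OF u(1)] unfolding u(2)
      by (intro B.inv_equality) (simp_all add: carrier_BijGroup Bij_simps)
    then show "iv a \<in> conj_grp g V" using oV(6)[OF u(1)] by blast
  next
    fix a a' assume "a \<in> conj_grp g V" "a' \<in> conj_grp g V"
    then obtain u u' where u: "u \<in> V" "a = g \<cdot> u \<cdot> iv g" "u' \<in> V" "a' = g \<cdot> u' \<cdot> iv g" by blast
    have "a \<cdot> a' = g \<cdot> (u \<cdot> u') \<cdot> iv g"
      using gB VB[OF u(1)] VB[OF u(3)] unfolding u(2,4) by (simp add: Bij_simps)
    then show "a \<cdot> a' \<in> conj_grp g V" using oV(5)[OF u(1,3)] by blast
  qed
  \<comment> \<open>Conjugation by \<open>g\<close> turns the pointwise stabilizer of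
    \<open>A\<close> into that of its image under \<open>g\<close>.\<close>
  moreover have "{h \<in> G. \<forall>x\<in>g ` A. h x = x} \<subseteq> conj_grp g V"
  proof clarify
    fix h assume h: "h \<in> G" "\<forall>x\<in>g ` A. h x = x"
    have hB: "h \<in> Bij X" using h Bij_G by blast
    have "(iv g \<cdot> h \<cdot> g) x = x" if x: "x \<in> A" for x
      using h(2) x gB hB A(2) BijGroup_inv[OF gB, of x]
      by (simp add: Bij_simps BijGroup_mult subset_iff)
    moreover have "iv g \<cdot> h \<cdot> g \<in> G" using oG(5,6) g h(1) by blast
    ultimately have "iv g \<cdot> h \<cdot> g \<in> V" using A(3) by auto
    then show "h \<in> conj_grp g V" using conj_mem_iff[OF gB oV(3) hB] by blast
  qed
  moreover have "g ` A \<subseteq> X" using A(2) gB Bij_imp_funcset by blast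
  ultimately show ?thesis
    unfolding open_subgroup_iff[OF subgroup_G] perm_group_simps(2)[OF subgroup_G]
    using sub A(1) by (intro conjI exI[of _ "g ` A"]) auto
qed

lemma conj_gset_simps [simp]:
  "gs_grp (conj_gset X g Z) = conj_grp g (gs_grp Z)" "gs_pts (conj_gset X g Z) = gs_pts Z"
  "gs_act (conj_gset X g Z) h = gs_act Z (iv g \<cdot> h \<cdot> g)"
  by (simp_all add: conj_gset_def)

lemma ghat_set_conj_gset:
  assumes Z: "ghat_set X G Z" and g: "g \<in> G"
  shows "ghat_set X G (conj_gset X g Z)"
proof -
  have sm: "smooth_gset X G Z" using Z by (simp add: ghat_set_def)
  note D = smooth_gsetD[OF sm]
  note oU = open_subgroupD[OF D(1)]
  let ?C = "conj_grp g (gs_grp Z)"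
  have gB: "g \<in> Bij X" using g by (rule Bij_G)
  have oC: "open_subgroup X G ?C" by (rule open_conj_grp[OF D(1) g])
  have CB: "h \<in> Bij X" if "h \<in> ?C" for h using open_subgroupD(3)[OF oC] that by blast
  have mem: "iv g \<cdot> h \<cdot> g \<in> gs_grp Z" if "h \<in> ?C" for h
    using conj_mem_iff[OF gB oU(3) CB[OF that]] that by blast
  have ga: "group_action (perm_group X ?C) (gs_pts Z) (gs_act (conj_gset X g Z))"
  proof (rule group_action_elementary)
    fix h k z assume hk: "h \<in> carrier (perm_group X ?C)" "k \<in> carrier (perm_group X ?C)" "z \<in> gs_pts Z"
    have hB: "h \<in> Bij X" "k \<in> Bij X" using CB[of h] CB[of k] hk(1,2) by simp_all
    have "iv g \<cdot> (h \<cdot> k) \<cdot> g = (iv g \<cdot> h \<cdot> g) \<cdot> (iv g \<cdot> k \<cdot> g)"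
      using gB hB by (simp add: Bij_simps)
    then show "gs_act (conj_gset X g Z) (h \<otimes>\<^bsub>perm_group X ?C\<^esub> k) z =
        gs_act (conj_gset X g Z) h (gs_act (conj_gset X g Z) k z)"
      using D(3)[OF mem[of h] mem[of k], of z] hk by simp
  next
    fix z assume "z \<in> gs_pts Z"
    then show "gs_act (conj_gset X g Z) \<one>\<^bsub>perm_group X ?C\<^esub> z = z"
      using gB D(4) by (simp add: Bij_simps)
  qed (use mem D(2,7) group_perm_group[OF oC] in auto)
  have im: "(\<lambda>h. iv g \<cdot> h \<cdot> g) ` ?C = gs_grp Z"
  proof -
    have "iv g \<cdot> (g \<cdot> u \<cdot> iv g) \<cdot> g = u" if "u \<in> gs_grp Z" for u
    proof -
      have "u \<in> Bij X" using that oU(3) by blast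
      then show ?thesis using gB by (simp add: Bij_simps)
    qed
    then show ?thesis by (simp add: image_image)
  qed
  have st: "stabilizer (perm_group X ?C) (gs_act (conj_gset X g Z)) z =
      conj_grp g {u \<in> gs_grp Z. gs_act Z u z = z}" for z
  proof -
    have "h \<in> conj_grp g {u \<in> gs_grp Z. gs_act Z u z = z} \<longleftrightarrow>
        h \<in> ?C \<and> gs_act Z (iv g \<cdot> h \<cdot> g) z = z" if "h \<in> Bij X" for h
    proof -
      have s: "{u \<in> gs_grp Z. gs_act Z u z = z} \<subseteq> Bij X" using oU(3) by blast
      show ?thesis unfolding conj_mem_iff[OF gB s that] conj_mem_iff[OF gB oU(3) that] by simp
    qed
    moreover have "conj_grp g {u \<in> gs_grp Z. gs_act Z u z = z} \<subseteq> ?C" by blast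
    ultimately show ?thesis using CB by (auto simp: stabilizer_def)
  qed
  have "orbit (perm_group X ?C) (gs_act (conj_gset X g Z)) z = orbit (perm_group X (gs_grp Z)) (gs_act Z) z" for z
  proof -
    have "orbit (perm_group X ?C) (gs_act (conj_gset X g Z)) z = (\<lambda>u. gs_act Z u z) ` ((\<lambda>h. iv g \<cdot> h \<cdot> g) ` ?C)"
      by (simp add: orbit_def Setcompr_eq_image) (simp only: image_image)
    then show ?thesis unfolding im by (simp add: orbit_def Setcompr_eq_image)
  qed
  then have "orbits (perm_group X ?C) (gs_pts Z) (gs_act (conj_gset X g Z)) =
      orbits (perm_group X (gs_grp Z)) (gs_pts Z) (gs_act Z)"
    by (simp add: orbits_def)
  then show ?thesis
    using oC ga Z st open_conj_grp[OF D(8) g] by (simp add: ghat_set_def smooth_gset_def)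
qed

lemma meas_conj_gset:
  assumes Z: "ghat_set X G Z" and g: "g \<in> G"
  shows "meas (conj_gset X g Z) = meas Z"
proof -
  obtain W :: "('x, 'x gset_univ) gset" where W: "ghat_set X G W" "ghat_iso X G Z W"
    using ghat_set_has_copy[OF Z] by blast
  then obtain \<beta> V where \<beta>: "bij_betw \<beta> (gs_pts Z) (gs_pts W)" and V: "open_subgroup X G V"
      "V \<subseteq> gs_grp Z \<inter> gs_grp W"
      and eq: "\<forall>g\<in>V. \<forall>z\<in>gs_pts Z. \<beta> (gs_act Z g z) = gs_act W g (\<beta> z)"
    unfolding ghat_iso_def by blast
  have gB: "g \<in> Bij X" using g by (rule Bij_G)
  have oC: "open_subgroup X G (conj_grp g V)" by (rule open_conj_grp[OF V(1) g])
  have mem: "iv g \<cdot> h \<cdot> g \<in> V" if "h \<in> conj_grp g V" for h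
    using conj_mem_iff[OF gB open_subgroupD(3)[OF V(1)], of h] open_subgroupD(3)[OF oC] that by blast
  have "ghat_iso X G (conj_gset X g Z) (conj_gset X g W)"
    unfolding ghat_iso_def
    using \<beta> oC V(2) eq mem by (intro exI[of _ \<beta>] exI[of _ "conj_grp g V"]) auto
  then have "meas (conj_gset X g Z) = \<mu> (conj_gset X g W)"
    by (rule meas_eq[OF ghat_set_conj_gset[OF Z g] ghat_set_conj_gset[OF W(1) g]])
  moreover have "\<forall>Z. \<forall>g \<in> G. ghat_set X G Z \<longrightarrow> \<mu> (conj_gset X g Z) = \<mu> Z"
    using measure unfolding ghat_measure_def by (elim conjE)
  ultimately show ?thesis using W(1) g meas_eq[OF Z W] by simp
qed

text \<open>The map \<open>z \<mapsto> g z\<close> is an isomorphism from \<open>A\<close> with the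
  conjugated action onto the translate of \<open>A\<close> with its own action. Invariance under
  conjugation thereby becomes invariance under translation.\<close>

lemma meas_translate:
  assumes Z: "ghat_set X G Z" "gs_grp Z = G" and V: "open_subgroup X G V" and g: "g \<in> G"
    and A: "A \<subseteq> gs_pts Z" "\<And>h z. h \<in> V \<Longrightarrow> z \<in> A \<Longrightarrow> gs_act Z h z \<in> A"
  shows "meas (sub_gset (conj_grp g V) (gs_act Z g ` A) Z) = meas (sub_gset V A Z)"
proof -
  have sm: "smooth_gset X G Z" using Z by (simp add: ghat_set_def)
  note D = smooth_gsetD[OF sm, unfolded Z(2)]
  note oV = open_subgroupD[OF V]
  note oG = open_subgroupD[OF open_subgroup_G]
  have gB: "g \<in> Bij X" using g by (rule Bij_G)
  have oC: "open_subgroup X G (conj_grp g V)" by (rule open_conj_grp[OF V g])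
  have V': "V \<subseteq> gs_grp Z" "conj_grp g V \<subseteq> gs_grp Z"
    using oV(2) open_subgroupD(2)[OF oC] Z(2) by auto
  have act: "gs_act Z h (gs_act Z g z) = gs_act Z g (gs_act Z (iv g \<cdot> h \<cdot> g) z)"
    and mem: "iv g \<cdot> h \<cdot> g \<in> V" if "h \<in> conj_grp g V" "z \<in> A" for h z
  proof -
    have h: "h \<in> G" "h \<in> Bij X" using open_subgroupD(2)[OF oC] that Bij_G by auto
    show "iv g \<cdot> h \<cdot> g \<in> V" using conj_mem_iff[OF gB oV(3) h(2)] that by blast
    then have k: "iv g \<cdot> h \<cdot> g \<in> G" using oV(2) by blast
    have "z \<in> gs_pts Z" using that A by blast
    moreover have "h \<cdot> g = g \<cdot> (iv g \<cdot> h \<cdot> g)" using gB h by (simp add: Bij_simps)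
    ultimately show "gs_act Z h (gs_act Z g z) = gs_act Z g (gs_act Z (iv g \<cdot> h \<cdot> g) z)"
      using D(3)[OF h(1) g] D(3)[OF g k] by metis
  qed
  have gA: "ghat_set X G (sub_gset V A Z)" using A by (intro ghat_set_sub_gset[OF Z(1) V V'(1)]) auto
  have "ghat_set X G (sub_gset (conj_grp g V) (gs_act Z g ` A) Z)"
  proof (rule ghat_set_sub_gset[OF Z(1) oC V'(2)])
    show "gs_act Z g ` A \<subseteq> gs_pts Z" using A(1) D(2)[OF g] by auto
  next
    fix h z assume hz: "h \<in> conj_grp g V" "z \<in> gs_act Z g ` A"
    then obtain y where y: "y \<in> A" "z = gs_act Z g y" by blast
    show "gs_act Z h z \<in> gs_act Z g ` A"
      unfolding y(2) act[OF hz(1) y(1)] using A(2)[OF mem[OF hz(1) y(1)] y(1)] by blast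
  qed
  moreover have "ghat_iso X G (conj_gset X g (sub_gset V A Z)) (sub_gset (conj_grp g V) (gs_act Z g ` A) Z)"
    unfolding ghat_iso_def
  proof (intro exI conjI)
    show "open_subgroup X G (conj_grp g V)" by (rule oC)
    have "inj_on (gs_act Z g) A"
      using D(5)[OF g] A(1) by (intro inj_on_inverseI[of A "gs_act Z (iv g)"]) blast
    then show "bij_betw (gs_act Z g) (gs_pts (conj_gset X g (sub_gset V A Z)))
        (gs_pts (sub_gset (conj_grp g V) (gs_act Z g ` A) Z))"
      by (simp add: bij_betw_def)
    show "\<forall>h\<in>conj_grp g V. \<forall>z\<in>gs_pts (conj_gset X g (sub_gset V A Z)).
        gs_act Z g (gs_act (conj_gset X g (sub_gset V A Z)) h z) =
        gs_act (sub_gset (conj_grp g V) (gs_act Z g ` A) Z) h (gs_act Z g z)"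
      using act by simp
  qed simp
  ultimately have "meas (conj_gset X g (sub_gset V A Z)) = meas (sub_gset (conj_grp g V) (gs_act Z g ` A) Z)"
    by (intro meas_iso ghat_set_conj_gset[OF gA g])
  then show ?thesis using meas_conj_gset[OF gA g] by simp
qed

end

section \<open>Integration over orbits and the relation \<open>[e, f] = h\<close>\<close>

locale measured_gset = measured_group X G \<mu> for X :: "'x set" and G and \<mu> +
  fixes Y :: "('x, 'y) gset"
  assumes ghat_Y: "ghat_set X G Y" and grp_Y: "gs_grp Y = G"
begin

abbreviation "pts \<equiv> gs_pts Y"
abbreviation "act \<equiv> gs_act Y"

lemma smooth_Y: "smooth_gset X G Y"
  using ghat_Y by (simp add: ghat_set_def)

lemmas act_simps = smooth_gsetD[OF smooth_Y, unfolded grp_Y]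

definition stable :: "('x \<Rightarrow> 'x) set \<Rightarrow> 'y set \<Rightarrow> bool" where
  "stable V A \<longleftrightarrow> A \<subseteq> pts \<and> (\<forall>g\<in>V. \<forall>z\<in>A. act g z \<in> A)"

lemma stable_Union:
  assumes "\<And>Q. Q \<in> C \<Longrightarrow> stable V Q"
  shows "stable V (\<Union>C)"
proof -
  have "Q \<subseteq> pts" "g \<in> V \<Longrightarrow> z \<in> Q \<Longrightarrow> act g z \<in> Q" if "Q \<in> C" for Q g z
    using assms[OF that] by (auto simp: stable_def)
  then show ?thesis unfolding stable_def by blast
qed

definition orb :: "('x \<Rightarrow> 'x) set \<Rightarrow> 'y \<Rightarrow> 'y set" where
  "orb V z = (\<lambda>g. act g z) ` V"

definition nu :: "('x \<Rightarrow> 'x) set \<Rightarrow> 'y set \<Rightarrow> complex" where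
  "nu V A = meas (sub_gset V A Y)"

text \<open>Meant for \<open>\<phi>\<close> constant on the orbits of \<open>V\<close>, where the
  chosen points do not matter. The shape copies \<open>orbit_f\<close>, which becomes an integral by
  unfolding.\<close>

definition integral :: "('x \<Rightarrow> 'x) set \<Rightarrow> 'y set \<Rightarrow> ('y \<Rightarrow> complex) \<Rightarrow> complex" where
  "integral V W \<phi> = (\<Sum>Q\<in>orb V ` W. nu V Q * \<phi> (SOME y. y \<in> Q))"

lemma orbits_eq: "orbits (perm_group X V) W act = orb V ` W"
proof -
  have "orbit (perm_group X V) act z = orb V z" for z by (auto simp: orbit_def orb_def)
  then show ?thesis by (simp add: orbits_def Setcompr_eq_image)
qed

context
  fixes V :: "('x \<Rightarrow> 'x) set"
  assumes V: "open_subgroup X G V"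
begin

lemmas V_simps = open_subgroupD[OF V]

lemma V_grp: "V \<subseteq> gs_grp Y"
  using V_simps(2) grp_Y by simp

lemma orb_self: "z \<in> pts \<Longrightarrow> z \<in> orb V z"
  using act_simps(4) V_simps(4) unfolding orb_def by force

lemma orb_pts: "z \<in> pts \<Longrightarrow> orb V z \<subseteq> pts"
  using act_simps(2) V_simps(2) unfolding orb_def by blast

lemma orb_sub: "g \<in> V \<Longrightarrow> z \<in> pts \<Longrightarrow> orb V (act g z) \<subseteq> orb V z"
proof -
  assume g: "g \<in> V" and z: "z \<in> pts"
  have "act h (act g z) = act (h \<cdot> g) z" if "h \<in> V" for h
    using act_simps(3)[OF subsetD[OF V_simps(2) that] subsetD[OF V_simps(2) g] z] by simp
  then show ?thesis using V_simps(5)[OF _ g] by (auto simp: orb_def)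
qed

lemma orb_eq: "y \<in> orb V z \<Longrightarrow> z \<in> pts \<Longrightarrow> orb V y = orb V z"
proof -
  assume y: "y \<in> orb V z" and z: "z \<in> pts"
  then obtain g where g: "g \<in> V" "y = act g z" by (auto simp: orb_def)
  have "act (iv g) y = z" using act_simps(5)[of g z] g V_simps(2) z by auto
  moreover have "y \<in> pts" using y orb_pts[OF z] by blast
  ultimately show ?thesis
    using orb_sub[OF g(1) z] orb_sub[OF V_simps(6)[OF g(1)], of y] g(2) by simp
qed

lemma stable_orb: "z \<in> pts \<Longrightarrow> stable V (orb V z)"
  unfolding stable_def
proof (intro conjI ballI)
  fix g y assume z: "z \<in> pts" and g: "g \<in> V" and y: "y \<in> orb V z"
  then have "y \<in> pts" using orb_pts by blast
  moreover have "act g y \<in> orb V y" using g by (simp add: orb_def)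
  ultimately show "act g y \<in> orb V z" using orb_eq[OF y z] by simp
qed (use orb_pts in blast)

lemma orb_subset: "stable V W \<Longrightarrow> z \<in> W \<Longrightarrow> orb V z \<subseteq> W"
  by (auto simp: stable_def orb_def)

lemma Union_orb: "stable V W \<Longrightarrow> (\<Union>z\<in>W. orb V z) = W"
proof -
  assume W: "stable V W"
  then have "z \<in> orb V z" if "z \<in> W" for z using that orb_self by (auto simp: stable_def)
  then show ?thesis using orb_subset[OF W] by blast
qed

lemma orb_disjoint: "y \<in> pts \<Longrightarrow> z \<in> pts \<Longrightarrow> orb V y \<noteq> orb V z \<Longrightarrow> orb V y \<inter> orb V z = {}"
  using orb_eq by (metis disjoint_iff)

lemma finite_orb: "W \<subseteq> pts \<Longrightarrow> finite (orb V ` W)"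
  using finite_orbits[OF ghat_Y V V_grp] by (simp add: orbits_eq)

lemma nu_Un:
  "stable V A \<Longrightarrow> stable V B \<Longrightarrow> A \<inter> B = {} \<Longrightarrow> nu V (A \<union> B) = nu V A + nu V B"
  unfolding nu_def stable_def by (intro meas_sub_gset_Un[OF ghat_Y V V_grp]) auto

lemma nu_empty: "nu V {} = 0"
  using nu_Un[of "{}" "{}"] by (simp add: stable_def)

lemma nu_Union:
  assumes "finite C" "\<And>Q. Q \<in> C \<Longrightarrow> stable V Q"
    "\<And>Q Q'. Q \<in> C \<Longrightarrow> Q' \<in> C \<Longrightarrow> Q \<noteq> Q' \<Longrightarrow> Q \<inter> Q' = {}"
  shows "nu V (\<Union>C) = (\<Sum>Q\<in>C. nu V Q)"
  using assms
proof (induction C)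
  case (insert Q C)
  have "stable V (\<Union>C)" using insert.prems(1) by (intro stable_Union) auto
  moreover have "Q \<inter> \<Union>C = {}" using insert.prems(2)[of Q] insert.hyps(2) by blast
  ultimately show ?case using insert nu_Un[of Q "\<Union>C"] by simp
qed (simp add: nu_empty)

lemma nu_eq_sum: "stable V W \<Longrightarrow> nu V W = (\<Sum>Q\<in>orb V ` W. nu V Q)"
proof -
  assume W: "stable V W"
  then have WP: "W \<subseteq> pts" by (simp add: stable_def)
  have "nu V (\<Union>(orb V ` W)) = (\<Sum>Q\<in>orb V ` W. nu V Q)"
  proof (rule nu_Union)
    show "finite (orb V ` W)" by (rule finite_orb[OF WP])
    show "stable V Q" if "Q \<in> orb V ` W" for Q using that WP stable_orb by blast
    show "Q \<inter> Q' = {}" if "Q \<in> orb V ` W" "Q' \<in> orb V ` W" "Q \<noteq> Q'" for Q Q'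
      using that orb_disjoint WP by blast
  qed
  then show ?thesis using Union_orb[OF W] by simp
qed

lemma nu_singleton:
  assumes "z \<in> pts" "\<And>g. g \<in> V \<Longrightarrow> act g z = z"
  shows "nu V {z} = 1"
  unfolding nu_def
proof (rule meas_singleton)
  show "ghat_set X G (sub_gset V {z} Y)"
    using assms by (intro ghat_set_sub_gset[OF ghat_Y V V_grp]) auto
qed simp

lemma integral_point:
  assumes W: "stable V W" and \<phi>: "\<And>g z. g \<in> V \<Longrightarrow> z \<in> W \<Longrightarrow> \<phi> (act g z) = \<phi> z"
    and z: "z \<in> W" and y: "y \<in> orb V z"
  shows "\<phi> y = \<phi> z" "\<phi> (SOME y. y \<in> orb V z) = \<phi> z"
proof -
  have *: "\<phi> y = \<phi> z" if "y \<in> orb V z" for y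
    using that \<phi> z by (auto simp: orb_def)
  then show "\<phi> y = \<phi> z" using y .
  show "\<phi> (SOME y. y \<in> orb V z) = \<phi> z" using * someI[of "\<lambda>y. y \<in> orb V z", OF y] by blast
qed

lemma some_orb: "stable V W \<Longrightarrow> z \<in> W \<Longrightarrow> (SOME y. y \<in> orb V z) \<in> W"
  using someI[of "\<lambda>y. y \<in> orb V z", OF orb_self[of z]] orb_subset[of W z] by (auto simp: stable_def)

lemma integral_cong:
  assumes "stable V W" "\<And>z. z \<in> W \<Longrightarrow> \<phi> z = \<psi> z"
  shows "integral V W \<phi> = integral V W \<psi>"
  unfolding integral_def using assms some_orb by (intro sum.cong) auto

lemma integral_const: "stable V W \<Longrightarrow> integral V W (\<lambda>z. c) = c * nu V W"
  by (simp add: integral_def nu_eq_sum sum_distrib_left mult.commute)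

text \<open>A fixed point is an orbit of its own, of measure 1. Such points produce the terms by
  which \<open>e f\<close> and \<open>f e\<close> differ.\<close>

lemma integral_insert:
  assumes W: "stable V W" and y: "y \<in> pts" "y \<notin> W" "\<And>g. g \<in> V \<Longrightarrow> act g y = y"
  shows "integral V (insert y W) \<phi> = \<phi> y + integral V W \<phi>"
proof -
  have o: "orb V y = {y}" using y(3) V_simps(4) by (auto simp: orb_def)
  then have "{y} \<notin> orb V ` W" using orb_subset[OF W] y(2) by fastforce
  moreover have "finite (orb V ` W)" using W by (intro finite_orb) (simp add: stable_def)
  ultimately show ?thesis
    using nu_singleton[OF y(1,3)] by (simp add: integral_def o)
qed

end

lemma integral_add: "integral V W (\<lambda>z. \<phi> z + \<psi> z) = integral V W \<phi> + integral V W \<psi>"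
  by (simp add: integral_def distrib_left sum.distrib)

lemma integral_sum: "integral V W (\<lambda>z. \<Sum>i\<in>I. \<phi> i z) = (\<Sum>i\<in>I. integral V W (\<phi> i))"
  unfolding integral_def sum_distrib_left by (rule sum.swap)

lemma nu_subgroup:
  assumes "open_subgroup X G V" "open_subgroup X G V'" "V' \<subseteq> V" "stable V A"
  shows "nu V' A = nu V A"
  unfolding nu_def using assms V_grp[OF assms(1)]
  by (intro meas_sub_gset_cong[OF ghat_Y]) (auto simp: stable_def)

lemma stable_mono: "V' \<subseteq> V \<Longrightarrow> stable V A \<Longrightarrow> stable V' A"
  by (auto simp: stable_def)

text \<open>An orbit of \<open>V\<close> splits into finitely many orbits of \<open>V'\<close>,
  whose measures add up to its own, and \<open>\<phi>\<close> is constant on it. This allows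
  \<open>f\<close> at several sets to be evaluated over one common group.\<close>

lemma integral_subgroup:
  assumes V: "open_subgroup X G V" and V': "open_subgroup X G V'" "V' \<subseteq> V" and W: "stable V W"
    and \<phi>: "\<And>g z. g \<in> V \<Longrightarrow> z \<in> W \<Longrightarrow> \<phi> (act g z) = \<phi> z"
  shows "integral V' W \<phi> = integral V W \<phi>"
proof -
  have WP: "W \<subseteq> pts" using W by (simp add: stable_def)
  have un: "orb V' ` W = (\<Union>Q\<in>orb V ` W. orb V' ` Q)"
    by (simp add: image_UN[symmetric] Union_orb[OF V W])
  have st: "stable V Q" "Q \<subseteq> W" if "Q \<in> orb V ` W" for Q
    using that stable_orb[OF V] orb_subset[OF V W] WP by auto
  have st': "stable V' Q" if "Q \<in> orb V ` W" for Q
    using st(1)[OF that] stable_mono[OF V'(2)] by blast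
  have in_Q: "R \<subseteq> Q" "R \<noteq> {}" if Q: "Q \<in> orb V ` W" and R: "R \<in> orb V' ` Q" for Q R
  proof -
    obtain r where r: "r \<in> Q" "R = orb V' r" using R by blast
    have "r \<in> pts" using r(1) st(2)[OF Q] WP by blast
    then show "R \<noteq> {}" using orb_self[OF V'(1)] r(2) by blast
    show "R \<subseteq> Q" using orb_subset[OF V'(1) st'[OF Q] r(1)] r(2) by simp
  qed
  have "integral V' W \<phi> = (\<Sum>Q\<in>orb V ` W. \<Sum>R\<in>orb V' ` Q. nu V' R * \<phi> (SOME y. y \<in> R))"
    unfolding integral_def un
  proof (rule sum.UNION_disjoint)
    show "finite (orb V ` W)" by (rule finite_orb[OF V WP])
    show "\<forall>Q\<in>orb V ` W. finite (orb V' ` Q)"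
      using finite_orb[OF V'(1)] st(2) WP by blast
    show "\<forall>Q\<in>orb V ` W. \<forall>Q'\<in>orb V ` W. Q \<noteq> Q' \<longrightarrow> orb V' ` Q \<inter> orb V' ` Q' = {}"
    proof (intro ballI impI equals0I)
      fix Q Q' R assume Q: "Q \<in> orb V ` W" "Q' \<in> orb V ` W" "Q \<noteq> Q'"
        and R: "R \<in> orb V' ` Q \<inter> orb V' ` Q'"
      have "Q \<inter> Q' = {}" using Q orb_disjoint[OF V] WP by blast
      then show False using in_Q[of Q R] in_Q[of Q' R] Q R by auto
    qed
  qed
  also have "\<dots> = integral V W \<phi>"
    unfolding integral_def
  proof (rule sum.cong[OF refl])
    fix Q assume Q: "Q \<in> orb V ` W"
    then obtain z where z: "z \<in> W" "Q = orb V z" by blast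
    have zQ: "z \<in> orb V z" using z(1) WP orb_self[OF V] by blast
    have c: "\<phi> y = \<phi> z" if "y \<in> Q" for y using integral_point(1)[OF V W \<phi> z(1)] that z(2) by blast
    have "\<phi> (SOME y. y \<in> R) = \<phi> z" if R: "R \<in> orb V' ` Q" for R
    proof -
      obtain r where "r \<in> R" using in_Q(2)[OF Q R] by blast
      then have "(SOME y. y \<in> R) \<in> R" by (rule someI)
      then show ?thesis using c in_Q(1)[OF Q R] by blast
    qed
    then have "(\<Sum>R\<in>orb V' ` Q. nu V' R * \<phi> (SOME y. y \<in> R)) = nu V' Q * \<phi> z"
      by (simp add: nu_eq_sum[OF V'(1) st'[OF Q]] sum_distrib_right)
    also have "\<dots> = nu V Q * \<phi> (SOME y. y \<in> Q)"
      using nu_subgroup[OF V V' st(1)[OF Q]] integral_point(2)[OF V W \<phi> z(1) zQ] z(2) by simp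
    finally show "(\<Sum>R\<in>orb V' ` Q. nu V' R * \<phi> (SOME y. y \<in> R)) = nu V Q * \<phi> (SOME y. y \<in> Q)" .
  qed
  finally show ?thesis .
qed

section \<open>Stabilizers of finite subsets\<close>

definition fixer :: "'y set \<Rightarrow> ('x \<Rightarrow> 'x) set" where
  "fixer T = {g \<in> G. \<forall>y\<in>T. act g y = y}"

lemma open_fixer: "finite T \<Longrightarrow> T \<subseteq> pts \<Longrightarrow> open_subgroup X G (fixer T)"
proof (induction T rule: finite_induct)
  case empty
  then show ?case using open_subgroup_G by (simp add: fixer_def)
next
  case (insert y T)
  have "fixer (insert y T) = {g \<in> G. act g y = y} \<inter> fixer T" by (auto simp: fixer_def)
  then show ?case using insert open_subgroup_Int[OF subgroup_G act_simps(8)] by simp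
qed

lemma act_image_inv:
  assumes "g \<in> G" "S \<subseteq> pts"
  shows "act (iv g) ` act g ` S = S" "act g ` act (iv g) ` S = S"
  using act_simps(5,6)[OF assms(1)] assms(2) by (force simp: image_image)+

lemma act_image_mult:
  assumes "g \<in> G" "h \<in> G" "S \<subseteq> pts"
  shows "act (g \<cdot> h) ` S = act g ` act h ` S"
  using act_simps(3)[OF assms(1,2)] assms(3) by (force simp: image_image)

lemma act_image_pts: "g \<in> G \<Longrightarrow> S \<subseteq> pts \<Longrightarrow> act g ` S \<subseteq> pts"
  using act_simps(2) by blast

lemma inj_act: "g \<in> G \<Longrightarrow> S \<subseteq> pts \<Longrightarrow> inj_on (act g) S"
  using act_simps(5) by (intro inj_on_inverseI[of S "act (iv g)"]) blast

lemma card_act: "g \<in> G \<Longrightarrow> S \<subseteq> pts \<Longrightarrow> card (act g ` S) = card S"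
  using inj_act by (intro card_image)

lemma act_Diff: "g \<in> G \<Longrightarrow> A \<subseteq> pts \<Longrightarrow> B \<subseteq> A \<Longrightarrow> act g ` (A - B) = act g ` A - act g ` B"
  using inj_on_image_set_diff[OF inj_act, of g A A B] by auto

lemma act_pts: "g \<in> G \<Longrightarrow> act g ` pts = pts"
  using act_image_pts[of g pts] act_image_inv(2)[of g pts]
    act_image_pts[OF open_subgroupD(6)[OF open_subgroup_G], of g pts] by blast

lemma set_stab_eq: "set_stab Y S = {g \<in> G. act g ` S = S}"
  by (simp add: set_stab_def grp_Y)

lemma fixer_set_stab: "S \<subseteq> T \<Longrightarrow> fixer T \<subseteq> set_stab Y S"
  unfolding fixer_def set_stab_eq by (auto simp: image_def subset_iff)

lemma open_set_stab:
  assumes "finite S" "S \<subseteq> pts"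
  shows "open_subgroup X G (set_stab Y S)"
proof (rule open_subgroup_superset[OF open_fixer[OF assms] fixer_set_stab[OF order_refl]])
  note oG = open_subgroupD[OF open_subgroup_G]
  show "set_stab Y S \<subseteq> G" by (auto simp: set_stab_eq)
  show "subgroup (set_stab Y S) (BijGroup X)"
  proof (rule B.subgroupI)
    show "set_stab Y S \<subseteq> carrier (BijGroup X)" using Bij_G by (auto simp: set_stab_eq carrier_BijGroup)
    show "set_stab Y S \<noteq> {}"
      using open_subgroupD(4)[OF open_fixer[OF assms]] fixer_set_stab[OF order_refl] by blast
    show "iv g \<in> set_stab Y S" if "g \<in> set_stab Y S" for g
      using that oG(6) act_image_inv(1)[of g S] assms(2) by (auto simp: set_stab_eq)
    show "g \<cdot> h \<in> set_stab Y S" if "g \<in> set_stab Y S" "h \<in> set_stab Y S" for g h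
      using that oG(5) act_image_mult[of g h S] assms(2) by (auto simp: set_stab_eq)
  qed
qed

lemma stable_Diff: "S \<subseteq> pts \<Longrightarrow> stable (set_stab Y S) (pts - S)"
proof -
  assume S: "S \<subseteq> pts"
  have "act g ` (pts - S) = pts - S" if "g \<in> set_stab Y S" for g
    using that act_Diff[of g pts S] act_pts[of g] S by (simp add: set_stab_eq)
  then show ?thesis unfolding stable_def by blast
qed

text \<open>Imposed on finite subsets of every size and without a condition on supports, so that
  \<open>e\<close> and \<open>f\<close> can be studied apart from the grading.\<close>

definition invariant :: "('y set \<Rightarrow> complex) \<Rightarrow> bool" where
  "invariant v \<longleftrightarrow> (\<forall>g\<in>G. \<forall>T. finite T \<and> T \<subseteq> pts \<longrightarrow> v (act g ` T) = v T)"

abbreviation "E \<equiv> orbit_e Y"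
abbreviation "F \<equiv> orbit_f X G \<mu> Y"
abbreviation "H \<equiv> orbit_h X G \<mu> Y"

lemma F_eq_integral:
  "finite S \<Longrightarrow> S \<subseteq> pts \<Longrightarrow> F v S = integral (set_stab Y S) (pts - S) (\<lambda>y. v (insert y S))"
  by (simp add: orbit_f_def integral_def nu_def orbits_eq)

lemma invariant_insert:
  assumes "invariant v" "finite S" "S \<subseteq> pts" "g \<in> set_stab Y S" "z \<in> pts"
  shows "v (insert (act g z) S) = v (insert z S)"
proof -
  have "act g ` insert z S = insert (act g z) S" using assms(4) by (simp add: set_stab_eq)
  then show ?thesis using assms by (metis (no_types, lifting) finite_insert insert_subset invariant_def mem_Collect_eq set_stab_eq)
qed

lemma F_eq_integral_subgroup:
  assumes "invariant v" "finite S" "S \<subseteq> pts" "open_subgroup X G V" "V \<subseteq> set_stab Y S"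
  shows "F v S = integral V (pts - S) (\<lambda>y. v (insert y S))"
  using assms F_eq_integral integral_subgroup[OF open_set_stab assms(4,5) stable_Diff]
    invariant_insert[OF assms(1-3)] by simp

text \<open>The stabilizer of the translate of \<open>S\<close> is the conjugate of the stabilizer
  of \<open>S\<close>, so \<open>g\<close> carries the orbits outside \<open>S\<close> to those
  outside the translate. Their measures agree by \<open>meas_translate\<close>, the values by
  invariance of \<open>v\<close>.\<close>

lemma invariant_F:
  assumes "invariant v"
  shows "invariant (F v)"
  unfolding invariant_def
proof (intro ballI allI impI, elim conjE)
  fix g S assume g: "g \<in> G" and S: "finite S" "S \<subseteq> pts"
  let ?V = "set_stab Y S" and ?W = "set_stab Y (act g ` S)"
  have gB: "g \<in> Bij X" using g by (rule Bij_G)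
  have gS: "finite (act g ` S)" "act g ` S \<subseteq> pts" using S act_image_pts[OF g] by auto
  note oG = open_subgroupD[OF open_subgroup_G]
  have oV: "open_subgroup X G ?V" and oW: "open_subgroup X G ?W" using open_set_stab S gS by blast+
  have W: "?W = conj_grp g ?V"
  proof (rule Set.set_eqI)
    fix h
    show "h \<in> ?W \<longleftrightarrow> h \<in> conj_grp g ?V"
    proof (cases "h \<in> G")
      case True
      have "iv g \<cdot> h \<cdot> g \<in> ?V \<longleftrightarrow> act (iv g) ` act h ` act g ` S = S"
        using oG(5,6) g True S act_image_pts[OF g S(2)]
        by (simp add: set_stab_eq act_image_mult)
      also have "\<dots> \<longleftrightarrow> act h ` act g ` S = act g ` S"
        using act_image_inv[OF g] act_image_pts[OF True gS(2)] S by metis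
      finally show ?thesis
        using conj_mem_iff[OF gB open_subgroupD(3)[OF oV] Bij_G[OF True]] True by (simp add: set_stab_eq)
    next
      case False
      then show ?thesis using open_subgroupD(2)[OF open_conj_grp[OF oV g]] by (auto simp: set_stab_eq)
    qed
  qed
  have orb: "orb ?W (act g z) = act g ` orb ?V z" if "z \<in> pts" for z
  proof -
    have "act (g \<cdot> u \<cdot> iv g) (act g z) = act g (act u z)" if "u \<in> ?V" for u
    proof -
      have u: "u \<in> G" using that by (simp add: set_stab_eq)
      have "act (g \<cdot> u \<cdot> iv g) (act g z) = act (g \<cdot> u) (act (iv g) (act g z))"
        using act_simps(2,3) oG(5,6) g u \<open>z \<in> pts\<close> by simp
      then show ?thesis using act_simps(3,5) g u \<open>z \<in> pts\<close> by simp
    qed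
    then show ?thesis unfolding W orb_def by (simp add: image_image)
  qed
  have gPS: "pts - act g ` S = act g ` (pts - S)" using act_Diff[OF g order_refl S(2)] act_pts[OF g] by simp
  have orbs: "orb ?W ` (pts - act g ` S) = (`) (act g) ` orb ?V ` (pts - S)"
    unfolding gPS using orb by (simp add: image_image)
  have inj: "inj_on ((`) (act g)) (orb ?V ` (pts - S))"
  proof (rule inj_onI)
    fix Q Q' assume Q: "Q \<in> orb ?V ` (pts - S)" "Q' \<in> orb ?V ` (pts - S)" "act g ` Q = act g ` Q'"
    have "Q \<subseteq> pts" "Q' \<subseteq> pts" using Q(1,2) orb_pts[OF oV] by blast+
    then show "Q = Q'" using inj_on_image_eq_iff[OF inj_act[OF g order_refl]] Q(3) by blast
  qed
  have "F v (act g ` S) = (\<Sum>Q\<in>orb ?V ` (pts - S). nu ?W (act g ` Q) * v (insert (SOME y. y \<in> act g ` Q) (act g ` S)))"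
    unfolding F_eq_integral[OF gS] integral_def orbs using inj by (simp add: sum.reindex)
  also have "\<dots> = F v S"
    unfolding F_eq_integral[OF S] integral_def
  proof (rule sum.cong[OF refl])
    fix Q assume "Q \<in> orb ?V ` (pts - S)"
    then obtain z where z: "z \<in> pts - S" "Q = orb ?V z" by blast
    have zP: "z \<in> pts" using z by blast
    have "nu ?W (act g ` Q) = nu ?V Q"
      unfolding nu_def W using stable_orb[OF oV zP] z(2)
      by (intro meas_translate[OF ghat_Y grp_Y oV g]) (auto simp: stable_def)
    moreover have "v (insert (SOME y. y \<in> orb ?V z) S) = v (insert z S)"
      using z orb_self[OF oV zP]
      by (intro integral_point(2)[OF oV stable_Diff[OF S(2)], where \<phi> = "\<lambda>y. v (insert y S)"]
          invariant_insert[OF assms S]) auto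
    moreover have "v (insert (SOME y. y \<in> orb ?W (act g z)) (act g ` S)) = v (insert (act g z) (act g ` S))"
      using z gPS orb_self[OF oW act_simps(2)[OF g zP]]
      by (intro integral_point(2)[OF oW stable_Diff[OF gS(2)], where \<phi> = "\<lambda>y. v (insert y (act g ` S))"]
          invariant_insert[OF assms gS]) auto
    moreover have "v (insert (act g z) (act g ` S)) = v (insert z S)"
      using assms g S zP unfolding invariant_def by (metis finite_insert image_insert insert_subset)
    ultimately show "nu ?W (act g ` Q) * v (insert (SOME y. y \<in> act g ` Q) (act g ` S)) =
        nu ?V Q * v (insert (SOME y. y \<in> Q) S)"
      using z(2) orb[OF zP] by simp
  qed
  finally show "F v (act g ` S) = F v S" .
qed

lemma invariant_E:
  assumes "invariant v"
  shows "invariant (E v)"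
  unfolding invariant_def
proof (intro ballI allI impI, elim conjE)
  fix g T assume g: "g \<in> G" and T: "finite T" "T \<subseteq> pts"
  have "E v (act g ` T) = (\<Sum>y\<in>T. v (act g ` T - {act g y}))"
    using T act_image_pts[OF g T(2)] inj_act[OF g T(2)] by (simp add: orbit_e_def sum.reindex)
  also have "\<dots> = (\<Sum>y\<in>T. v (T - {y}))"
  proof (rule sum.cong[OF refl])
    fix y assume "y \<in> T"
    then have "act g ` T - {act g y} = act g ` (T - {y})" using act_Diff[OF g T(2), of "{y}"] by simp
    then show "v (act g ` T - {act g y}) = v (T - {y})"
      using assms g T unfolding invariant_def by (metis Diff_subset finite_Diff subset_trans)
  qed
  finally show "E v (act g ` T) = E v T" using T by (simp add: orbit_e_def)
qed

lemma E_insert: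
  assumes "finite T" "T \<subseteq> pts" "z \<in> pts - T"
  shows "E v (insert z T) = v T + (\<Sum>y\<in>T. v (insert z (T - {y})))"
proof -
  have "insert z T - {y} = insert z (T - {y})" if "y \<in> T" for y using that assms(3) by auto
  then show ?thesis using assms by (simp add: orbit_e_def)
qed

text \<open>The points of \<open>T\<close> are fixed, so each has measure 1 and together they
  account for \<open>card T\<close> of the measure of \<open>Y\<close>. Half of the weight
  \<open>2 n - \<mu>(Y)\<close> has its origin here.\<close>

lemma meas_Y:
  assumes T: "finite T" "T \<subseteq> pts"
  shows "nu (fixer T) (pts - T) = meas Y - of_nat (card T)"
proof -
  let ?V = "fixer T"
  have V: "open_subgroup X G ?V" by (rule open_fixer[OF T])
  have fx: "act g y = y" if "g \<in> ?V" "y \<in> T" for g y using that by (auto simp: fixer_def)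
  have st: "stable ?V (pts - T)"
    using stable_mono[OF fixer_set_stab stable_Diff] T by blast
  have "nu ?V (\<Union>((\<lambda>y. {y}) ` T)) = (\<Sum>Q\<in>(\<lambda>y. {y}) ` T. nu ?V Q)"
    using T fx by (intro nu_Union[OF V]) (auto simp: stable_def)
  also have "\<dots> = of_nat (card T)"
    using T nu_singleton[OF V] fx by (simp add: sum.reindex subset_iff)
  finally have "nu ?V T = of_nat (card T)" by simp
  moreover have "nu ?V (T \<union> (pts - T)) = nu ?V T + nu ?V (pts - T)"
    using st T fx by (intro nu_Un[OF V]) (auto simp: stable_def)
  moreover have "T \<union> (pts - T) = pts" using T by blast
  moreover have "nu ?V pts = meas Y"
    unfolding nu_def by (rule meas_sub_gset_all[OF ghat_Y V V_grp[OF V]])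
  ultimately show ?thesis by simp
qed

text \<open>With respect to the pointwise stabilizer of \<open>T\<close>, both \<open>e f v\<close> and \<open>f e v\<close> at \<open>T\<close> are integrals
  of the functions \<open>z \<mapsto> v (T - {y} \<union> {z})\<close>; the domain of the former also contains the point
  \<open>z = y\<close>, which contributes \<open>v T\<close>.\<close>

lemma E_F_commutator:
  assumes v: "invariant v" and T: "finite T" "T \<subseteq> pts"
  shows "E (F v) T - F (E v) T = H v T"
proof -
  let ?V = "fixer T"
  have V: "open_subgroup X G ?V" by (rule open_fixer[OF T])
  have st: "stable ?V (pts - T)"
    using stable_mono[OF fixer_set_stab stable_Diff] T by blast
  have "F v (T - {y}) = v T + integral ?V (pts - T) (\<lambda>z. v (insert z (T - {y})))" if y: "y \<in> T" for y
  proof -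
    have "F v (T - {y}) = integral ?V (pts - (T - {y})) (\<lambda>z. v (insert z (T - {y})))"
      using T by (intro F_eq_integral_subgroup[OF v _ _ V] fixer_set_stab) auto
    also have "pts - (T - {y}) = insert y (pts - T)" using y T by auto
    also have "integral ?V \<dots> (\<lambda>z. v (insert z (T - {y}))) =
        v (insert y (T - {y})) + integral ?V (pts - T) (\<lambda>z. v (insert z (T - {y})))"
      using y T by (intro integral_insert[OF V st]) (auto simp: fixer_def)
    finally show ?thesis using y by (simp add: insert_absorb)
  qed
  then have "E (F v) T = of_nat (card T) * v T
      + (\<Sum>y\<in>T. integral ?V (pts - T) (\<lambda>z. v (insert z (T - {y}))))"
    using T by (simp add: orbit_e_def sum.distrib)
  moreover have "F (E v) T = v T * nu ?V (pts - T)
      + (\<Sum>y\<in>T. integral ?V (pts - T) (\<lambda>z. v (insert z (T - {y}))))"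
  proof -
    have "F (E v) T = integral ?V (pts - T) (\<lambda>z. E v (insert z T))"
      using T by (intro F_eq_integral_subgroup[OF invariant_E[OF v] _ _ V] fixer_set_stab) auto
    also have "\<dots> = integral ?V (pts - T) (\<lambda>z. v T + (\<Sum>y\<in>T. v (insert z (T - {y}))))"
      using E_insert[OF T] by (intro integral_cong[OF V st])
    finally show ?thesis by (simp add: integral_add integral_sum integral_const[OF V st])
  qed
  \<comment> \<open>The sums of integrals cancel. What remains is \<open>card T\<close>, from the
    fixed points, minus the measure of the complement of \<open>T\<close>.\<close>
  ultimately show ?thesis
    by (simp add: meas_Y[OF T] orbit_h_def algebra_simps)
qed

end

section \<open>Injectivity of \<open>e\<close> and compatible bases\<close>

text \<open>For \<open>x \<noteq> y\<close> the function \<open>w U = v (U \<union> {x}) - v (U \<union> {y})\<close> on the \<open>n\<close>-subsets of \<open>P - {x, y}\<close>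
  satisfies the same hypothesis.  Hence \<open>w = 0\<close> by induction, \<open>v\<close> is constant on the sets
  \<open>T - {t}\<close>, and the hypothesis says that a positive multiple of its value vanishes.\<close>

lemma sum_delete_inject:
  fixes v :: "'a set \<Rightarrow> complex"
  assumes "infinite P" "\<And>T. finite T \<Longrightarrow> T \<subseteq> P \<Longrightarrow> card T = Suc n \<Longrightarrow> (\<Sum>t\<in>T. v (T - {t})) = 0"
    and "finite S" "S \<subseteq> P" "card S = n"
  shows "v S = 0"
  using assms
proof (induction n arbitrary: P v S)
  case 0
  obtain x where "x \<in> P" using "0.prems"(1) by (metis ex_in_conv finite.emptyI)
  then have "v {} = 0" using "0.prems"(2)[of "{x}"] by simp
  then show ?case using "0.prems" by simp
next
  case (Suc n)
  have swap: "v (insert x U) = v (insert y U)"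
    if xy: "x \<in> P" "y \<in> P" "x \<noteq> y" and U: "finite U" "U \<subseteq> P - {x, y}" "card U = n" for x y U
  proof -
    define w where "w U = v (insert x U) - v (insert y U)" for U
    \<comment> \<open>The hypothesis for \<open>insert z T\<close>, with the deletion of
      \<open>z\<close> singled out. The right side does not depend on \<open>z\<close>, so it
      cancels in the difference \<open>w\<close>.\<close>
    have *: "(\<Sum>t\<in>T. v (insert z (T - {t}))) = - v T"
      if T: "finite T" "T \<subseteq> P - {z}" "card T = Suc n" and z: "z \<in> P" for T z
    proof -
      have "insert z T - {t} = insert z (T - {t})" if "t \<in> T" for t using that T(2) by auto
      then have "(\<Sum>t\<in>insert z T. v (insert z T - {t})) = v T + (\<Sum>t\<in>T. v (insert z (T - {t})))"
        using T by (simp add: subset_Diff_insert)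
      moreover have "(\<Sum>t\<in>insert z T. v (insert z T - {t})) = 0"
        using T z by (intro Suc.prems(2)) (auto simp: subset_Diff_insert)
      ultimately show ?thesis by (simp add: eq_neg_iff_add_eq_0 add.commute)
    qed
    have "w U = 0"
    proof (rule Suc.IH[of "P - {x, y}" w U])
      show "infinite (P - {x, y})" using Suc.prems(1) by (simp add: Diff_infinite_finite)
      fix T assume "finite T" "T \<subseteq> P - {x, y}" "card T = Suc n"
      then show "(\<Sum>t\<in>T. w (T - {t})) = 0"
        using *[of T x] *[of T y] xy subset_trans[of T "P - {x, y}" "P - {x}"]
          subset_trans[of T "P - {x, y}" "P - {y}"]
        by (simp add: w_def sum_subtractf Diff_mono)
    qed (use U in auto)
    then show ?thesis by (simp add: w_def)
  qed
  obtain z where z: "z \<in> P" "z \<notin> S"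
    using Suc.prems(1,3) by (metis finite_subset subsetI)
  have "v (insert z S - {t}) = v S" if t: "t \<in> insert z S" for t
  proof (cases "t = z")
    case True
    then show ?thesis using z(2) by simp
  next
    case False
    then have "t \<in> S" "insert z S - {t} = insert z (S - {t})" using t by auto
    moreover have "v (insert z (S - {t})) = v (insert t (S - {t}))"
      using z Suc.prems(3-5) \<open>t \<in> S\<close> by (intro swap) auto
    ultimately show ?thesis by (simp add: insert_absorb)
  qed
  then have "(\<Sum>t\<in>insert z S. v (insert z S - {t})) = of_nat (card (insert z S)) * v S" by simp
  moreover have "(\<Sum>t\<in>insert z S. v (insert z S - {t})) = 0"
    using z Suc.prems(3-5) by (intro Suc.prems(2)) auto
  ultimately show ?case using Suc.prems(3) by auto
qed

definition fscale :: "complex \<Rightarrow> ('a \<Rightarrow> complex) \<Rightarrow> 'a \<Rightarrow> complex" where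
  "fscale c v = (\<lambda>T. c * v T)"

lemma fscale_apply [simp]: "fscale c v T = c * v T"
  by (simp add: fscale_def)

interpretation fs: vector_space "fscale :: complex \<Rightarrow> ('a \<Rightarrow> complex) \<Rightarrow> 'a \<Rightarrow> complex"
  by unfold_locales (auto simp: fun_eq_iff algebra_simps)

interpretation fs2: vector_space_pair "fscale :: complex \<Rightarrow> ('a \<Rightarrow> complex) \<Rightarrow> 'a \<Rightarrow> complex"
    "fscale :: complex \<Rightarrow> ('a \<Rightarrow> complex) \<Rightarrow> 'a \<Rightarrow> complex"
  by unfold_locales

lemma sum_fun_apply: "(\<Sum>i\<in>I. f i) x = (\<Sum>i\<in>I. f i x)" for f :: "'i \<Rightarrow> 'a \<Rightarrow> complex"
  by (induction I rule: infinite_finite_induct) simp_all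

section \<open>The graded pieces of the orbit algebra\<close>

context measured_gset
begin

abbreviation "Hn \<equiv> orbit_comp Y"

lemma nsets_iff: "T \<in> nsets pts n \<longleftrightarrow> finite T \<and> T \<subseteq> pts \<and> card T = n"
  by (auto simp: nsets_def)

lemma act_nsets: "g \<in> G \<Longrightarrow> T \<in> nsets pts n \<Longrightarrow> act g ` T \<in> nsets pts n"
  using act_image_pts card_act by (simp add: nsets_iff)

text \<open>\<open>G\<close> preserves cardinality, so a function supported on the
  \<open>n\<close>-subsets is invariant on all finite subsets once it is so on those of size
  \<open>n\<close>.\<close>

lemma orbit_comp_iff:
  "v \<in> Hn n \<longleftrightarrow> (\<forall>T. T \<notin> nsets pts n \<longrightarrow> v T = 0) \<and> invariant v"
proof -
  have "v (act g ` T) = v T"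
    if "\<forall>T. T \<notin> nsets pts n \<longrightarrow> v T = 0" "\<forall>g\<in>G. \<forall>T\<in>nsets pts n. v (act g ` T) = v T"
      "g \<in> G" "finite T" "T \<subseteq> pts" for g T
  proof (cases "card T = n")
    case True
    then show ?thesis using that by (simp add: nsets_iff)
  next
    case False
    then have "T \<notin> nsets pts n" "act g ` T \<notin> nsets pts n"
      using card_act[OF that(3,5)] by (simp_all add: nsets_iff)
    then show ?thesis using that(1) by simp
  qed
  moreover have "v (act g ` T) = v T" if "invariant v" "g \<in> G" "T \<in> nsets pts n" for g T
    using that by (simp add: invariant_def nsets_iff)
  ultimately show ?thesis unfolding orbit_comp_def invariant_def grp_Y by blast
qed

lemma subspace_Hn: "fs.subspace (Hn n)"
  by (rule fs.subspaceI) (auto simp: orbit_comp_iff invariant_def)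

lemma E_Hn: "v \<in> Hn n \<Longrightarrow> E v \<in> Hn (Suc n)"
proof -
  assume v: "v \<in> Hn n"
  have "E v T = 0" if "T \<notin> nsets pts (Suc n)" for T
  proof (cases "finite T \<and> T \<subseteq> pts")
    case True
    have "v (T - {y}) = 0" if "y \<in> T" for y
    proof -
      have "card T = Suc (card (T - {y}))" using True that by (metis card.remove)
      then have "T - {y} \<notin> nsets pts n" using \<open>T \<notin> _\<close> True by (auto simp: nsets_iff)
      then show ?thesis using v by (simp add: orbit_comp_iff)
    qed
    then show ?thesis by (simp add: orbit_e_def)
  qed (auto simp: orbit_e_def)
  then show ?thesis using v invariant_E by (simp add: orbit_comp_iff)
qed

lemma F_notin_nsets:
  assumes v: "v \<in> Hn n" and S: "\<And>y. y \<in> pts - S \<Longrightarrow> insert y S \<notin> nsets pts n"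
  shows "F v S = 0"
proof (cases "finite S \<and> S \<subseteq> pts")
  case True
  then have oV: "open_subgroup X G (set_stab Y S)" and st: "stable (set_stab Y S) (pts - S)"
    using open_set_stab stable_Diff by auto
  have "integral (set_stab Y S) (pts - S) (\<lambda>y. v (insert y S)) = integral (set_stab Y S) (pts - S) (\<lambda>y. 0)"
    using v S by (intro integral_cong[OF oV st]) (simp add: orbit_comp_iff)
  then show ?thesis using True integral_const[OF oV st, of 0] by (simp add: F_eq_integral)
qed (auto simp: orbit_f_def)

lemma F_Hn: "v \<in> Hn (Suc n) \<Longrightarrow> F v \<in> Hn n"
proof -
  assume v: "v \<in> Hn (Suc n)"
  have "F v S = 0" if "S \<notin> nsets pts n" for S
    using that by (intro F_notin_nsets[OF v]) (auto simp: nsets_iff)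
  then show ?thesis using v invariant_F by (simp add: orbit_comp_iff)
qed

lemma F_H0: "v \<in> Hn 0 \<Longrightarrow> F v = 0"
proof (rule ext)
  fix S assume "v \<in> Hn 0"
  then show "F v S = 0 S" by (subst F_notin_nsets) (auto simp: nsets_iff)
qed

lemma H_Hn: "v \<in> Hn n \<Longrightarrow> H v = fscale (2 * of_nat n - meas Y) v"
  by (rule ext) (auto simp: orbit_h_def orbit_comp_iff nsets_iff)

lemma E_F_Hn: "v \<in> Hn n \<Longrightarrow> E (F v) - F (E v) = H v"
proof (rule ext)
  fix T assume v: "v \<in> Hn n"
  show "(E (F v) - F (E v)) T = H v T"
  proof (cases "finite T \<and> T \<subseteq> pts")
    case True
    then show ?thesis using v E_F_commutator[of v T] by (simp add: orbit_comp_iff)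
  next
    case False
    then have "v T = 0" using v by (auto simp: orbit_comp_iff nsets_iff)
    then show ?thesis using False by (auto simp: orbit_e_def orbit_f_def orbit_h_def)
  qed
qed

lemma linear_EFH:
  "Vector_Spaces.linear fscale fscale E" "Vector_Spaces.linear fscale fscale F"
  "Vector_Spaces.linear fscale fscale H"
  by (auto simp: Vector_Spaces.linear_iff fs.vector_space_axioms fun_eq_iff orbit_e_def orbit_f_def
      orbit_h_def sum.distrib sum_distrib_left algebra_simps)

section \<open>Indicator functions of orbits as bases\<close>

definition set_orb :: "'y set \<Rightarrow> 'y set set" where
  "set_orb T = (\<lambda>g. act g ` T) ` G"

lemma subset_orbits_eq: "subset_orbits X Y n = set_orb ` nsets pts n"
proof -
  have "orbit (perm_group X G) (\<lambda>g T. act g ` T) T = set_orb T" for T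
    by (auto simp: orbit_def set_orb_def)
  then show ?thesis by (simp add: subset_orbits_def orbits_def Setcompr_eq_image grp_Y)
qed

lemma set_orb_self: "T \<subseteq> pts \<Longrightarrow> T \<in> set_orb T"
proof -
  assume "T \<subseteq> pts"
  then have "act \<one>\<^bsub>BijGroup X\<^esub> ` T = T" using act_simps(4) by force
  then show ?thesis using open_subgroupD(4)[OF open_subgroup_G] unfolding set_orb_def by blast
qed

lemma set_orb_eq:
  assumes g: "g \<in> G" and T: "T \<subseteq> pts"
  shows "set_orb (act g ` T) = set_orb T"
proof -
  note oG = open_subgroupD[OF open_subgroup_G]
  have sub: "set_orb (act g ` T) \<subseteq> set_orb T" if "g \<in> G" "T \<subseteq> pts" for g T
    using that oG(5) act_image_mult[symmetric] by (auto simp: set_orb_def simp del: image_image)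
  have "set_orb T \<subseteq> set_orb (act g ` T)"
    using sub[OF oG(6)[OF g] act_image_pts[OF g T]] act_image_inv(1)[OF g T] by simp
  then show ?thesis using sub[OF g T] by blast
qed

text \<open>An \<open>n\<close>-subset is listed as an \<open>n\<close>-tuple. Tuples of equal code
  are translates of each other under \<open>G\<close>, and a translation of lists is one of the
  underlying sets.\<close>

lemma finite_subset_orbits: "finite (subset_orbits X Y n)"
proof -
  have G: "G \<subseteq> gs_grp Y" by (simp add: grp_Y)
  obtain code :: "'y list \<Rightarrow> 'y list \<times> 'x list set"
    where fin: "finite (code ` {xs. set xs \<subseteq> pts \<and> length xs = n})"
    and code: "\<And>xs ys. set xs \<subseteq> pts \<Longrightarrow> length xs = n \<Longrightarrow> set ys \<subseteq> pts \<Longrightarrow> length ys = n \<Longrightarrow>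
       code xs = code ys \<Longrightarrow> \<exists>h\<in>G. map (act h) xs = ys"
    using ghat_set_code[OF ghat_Y open_subgroup_G G] by blast
  define enum where "enum T = (SOME xs. set xs = T \<and> length xs = n)" for T :: "'y set"
  have enum: "set (enum T) = T" "length (enum T) = n" if "T \<in> nsets pts n" for T
  proof -
    have "finite T" using that by (simp add: nsets_iff)
    from finite_distinct_list[OF this] obtain xs where "set xs = T" "distinct xs" by blast
    then have "set xs = T \<and> length xs = n" using that distinct_card[of xs] by (simp add: nsets_iff)
    from someI[of "\<lambda>xs. set xs = T \<and> length xs = n", OF this]
    show "set (enum T) = T" "length (enum T) = n" by (simp_all add: enum_def)
  qed
  have "finite ((\<lambda>T. code (enum T)) ` nsets pts n)"
    using enum by (intro finite_subset[OF _ fin]) (auto simp: nsets_iff)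
  then show ?thesis
    unfolding subset_orbits_eq
  proof (rule finite_image_factor)
    fix S T assume S: "S \<in> nsets pts n" and T: "T \<in> nsets pts n" and "code (enum S) = code (enum T)"
    then obtain h where h: "h \<in> G" "map (act h) (enum S) = enum T"
      using code[of "enum S" "enum T"] enum[OF S] enum[OF T] by (auto simp: nsets_iff)
    then have "act h ` S = T" using enum(1)[OF S] enum(1)[OF T] by (metis set_map)
    then show "set_orb S = set_orb T" using set_orb_eq[OF h(1), of S] S by (simp add: nsets_iff)
  qed
qed

definition orb_ind :: "'y set set \<Rightarrow> 'y set \<Rightarrow> complex" where
  "orb_ind Q T = (if T \<in> Q then 1 else 0)"

lemma subset_orbit_mem_iff:
  assumes "Q \<in> subset_orbits X Y n" "T \<in> nsets pts n"
  shows "T \<in> Q \<longleftrightarrow> Q = set_orb T"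
proof -
  obtain S where S: "S \<in> nsets pts n" "Q = set_orb S" using assms(1) by (auto simp: subset_orbits_eq)
  have "Q = set_orb T" if T: "T \<in> Q"
  proof -
    obtain g where "g \<in> G" "T = act g ` S" using T S(2) by (auto simp: set_orb_def)
    then show ?thesis using set_orb_eq S by (simp add: nsets_iff)
  qed
  then show ?thesis using set_orb_self[of T] assms(2) by (auto simp: nsets_iff)
qed

lemma subset_orbit_nsets: "Q \<in> subset_orbits X Y n \<Longrightarrow> Q \<subseteq> nsets pts n"
  using act_nsets by (auto simp: subset_orbits_eq set_orb_def)

lemma orb_ind_Hn:
  assumes Q: "Q \<in> subset_orbits X Y n"
  shows "orb_ind Q \<in> Hn n"
  unfolding orbit_comp_def grp_Y
proof (intro CollectI conjI allI impI ballI)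
  fix T assume "T \<notin> nsets pts n"
  then show "orb_ind Q T = 0" using subset_orbit_nsets[OF Q] by (auto simp: orb_ind_def)
next
  fix g T assume g: "g \<in> G" and T: "T \<in> nsets pts n"
  have "act g ` T \<in> Q \<longleftrightarrow> T \<in> Q"
    unfolding subset_orbit_mem_iff[OF Q T] subset_orbit_mem_iff[OF Q act_nsets[OF g T]]
    using set_orb_eq[OF g] T by (simp add: nsets_iff)
  then show "orb_ind Q (act g ` T) = orb_ind Q T" by (simp add: orb_ind_def)
qed

lemma sum_orb_ind:
  assumes "T \<in> nsets pts n"
  shows "(\<Sum>Q\<in>subset_orbits X Y n. u Q * orb_ind Q T) = u (set_orb T)"
proof -
  have "(\<Sum>Q\<in>subset_orbits X Y n. u Q * orb_ind Q T) =
      (\<Sum>Q\<in>subset_orbits X Y n. if Q = set_orb T then u Q else 0)"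
    using subset_orbit_mem_iff[OF _ assms] by (intro sum.cong) (auto simp: orb_ind_def)
  also have "\<dots> = u (set_orb T)"
    using assms finite_subset_orbits by (simp add: subset_orbits_eq)
  finally show ?thesis .
qed

lemma inj_orb_ind: "inj_on orb_ind (subset_orbits X Y n)"
proof (rule inj_onI)
  fix Q Q' assume *: "orb_ind Q = orb_ind Q'"
  have "T \<in> Q \<longleftrightarrow> T \<in> Q'" for T
    using fun_cong[OF *, of T] by (simp add: orb_ind_def split: if_splits)
  then show "Q = Q'" by blast
qed

text \<open>An invariant function is determined by one value on each orbit. The dimension of the
  graded piece is therefore the number of orbits, through which the filtration yields the counting
  statement.\<close>

lemma Hn_basis:
  "fs.independent (orb_ind ` subset_orbits X Y n)"
  "fs.span (orb_ind ` subset_orbits X Y n) = Hn n"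
  "card (orb_ind ` subset_orbits X Y n) = card (subset_orbits X Y n)"
proof -
  let ?O = "subset_orbits X Y n"
  show "card (orb_ind ` ?O) = card ?O" by (rule card_image[OF inj_orb_ind])
  show "fs.independent (orb_ind ` ?O)"
  proof (rule fs.independent_if_scalars_zero)
    show "finite (orb_ind ` ?O)" using finite_subset_orbits by simp
    fix u x assume s: "(\<Sum>x\<in>orb_ind ` ?O. fscale (u x) x) = 0" and x: "x \<in> orb_ind ` ?O"
    then obtain T where T: "T \<in> nsets pts n" "x = orb_ind (set_orb T)" by (auto simp: subset_orbits_eq)
    have "(\<Sum>Q\<in>?O. u (orb_ind Q) * orb_ind Q T) = (\<Sum>x\<in>orb_ind ` ?O. fscale (u x) x) T"
      by (simp add: sum_fun_apply sum.reindex[OF inj_orb_ind])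
    then show "u x = 0" using s sum_orb_ind[OF T(1), of "\<lambda>Q. u (orb_ind Q)"] T(2) by simp
  qed
  show "fs.span (orb_ind ` ?O) = Hn n"
  proof
    show "fs.span (orb_ind ` ?O) \<subseteq> Hn n"
      using orb_ind_Hn by (intro fs.span_minimal subspace_Hn) auto
    show "Hn n \<subseteq> fs.span (orb_ind ` ?O)"
    proof
      fix v assume v: "v \<in> Hn n"
      define u where "u Q = v (SOME T. T \<in> Q)" for Q
      have "v = (\<Sum>Q\<in>?O. fscale (u Q) (orb_ind Q))"
      proof (rule ext)
        fix T
        show "v T = (\<Sum>Q\<in>?O. fscale (u Q) (orb_ind Q)) T"
        proof (cases "T \<in> nsets pts n")
          case True
          have "(SOME S. S \<in> set_orb T) \<in> set_orb T"
            using set_orb_self[of T] True by (intro someI[of "\<lambda>S. S \<in> set_orb T"]) (auto simp: nsets_iff)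
          then obtain g where "g \<in> G" "(SOME S. S \<in> set_orb T) = act g ` T" by (auto simp: set_orb_def)
          then have "u (set_orb T) = v T"
            using v True by (simp add: u_def orbit_comp_def grp_Y)
          then show ?thesis using sum_orb_ind[OF True, of u] by (simp add: sum_fun_apply)
        next
          case False
          have "orb_ind Q T = 0" if "Q \<in> ?O" for Q
            using orb_ind_Hn[OF that] False by (simp add: orbit_comp_iff)
          then show ?thesis using False v by (simp add: sum_fun_apply orbit_comp_iff)
        qed
      qed
      moreover have "(\<Sum>Q\<in>?O. fscale (u Q) (orb_ind Q)) \<in> fs.span (orb_ind ` ?O)"
        by (intro fs.span_sum fs.span_scale fs.span_base) auto
      ultimately show "v \<in> fs.span (orb_ind ` ?O)" by simp
    qed
  qed
qed

end

text \<open>The first \<open>k\<close> places are prescribed, so that the image of a basis vector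
  under \<open>e\<close> can keep the index of that vector.\<close>

lemma extend_enumeration:
  fixes \<alpha> :: "nat \<Rightarrow> 'a"
  assumes "finite B" "inj_on \<alpha> {..<k}" "\<alpha> ` {..<k} \<subseteq> B"
  shows "k \<le> card B \<and> (\<exists>\<beta>. bij_betw \<beta> {..<card B} B \<and> (\<forall>i<k. \<beta> i = \<alpha> i))"
proof -
  let ?A = "\<alpha> ` {..<k}"
  have cA: "card ?A = k" using card_image[OF assms(2)] by simp
  then have k: "k \<le> card B" using card_mono[OF assms(1,3)] by simp
  have "card (B - ?A) = card {k..<card B}"
    using card_Diff_subset[of ?A B] assms(3) cA by simp
  then obtain \<gamma> where \<gamma>: "bij_betw \<gamma> {k..<card B} (B - ?A)"
    using finite_same_card_bij[of "{k..<card B}" "B - ?A"] assms(1) by auto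
  define \<beta> where "\<beta> i = (if i < k then \<alpha> i else \<gamma> i)" for i
  have "bij_betw \<beta> {..<k} ?A"
    using assms(2) by (intro bij_betw_cong[THEN iffD1, OF _ inj_on_imp_bij_betw[OF assms(2)]]) (simp add: \<beta>_def)
  moreover have "bij_betw \<beta> {k..<card B} (B - ?A)"
    by (rule bij_betw_cong[THEN iffD1, OF _ \<gamma>]) (simp add: \<beta>_def)
  ultimately have "bij_betw \<beta> ({..<k} \<union> {k..<card B}) (?A \<union> (B - ?A))"
    by (rule bij_betw_combine) blast
  moreover have "{..<k} \<union> {k..<card B} = {..<card B}" "?A \<union> (B - ?A) = B" using k assms(3) by auto
  ultimately show ?thesis using k by (intro conjI exI[of _ \<beta>]) (simp_all add: \<beta>_def)
qed

section \<open>Bases carried along by \<open>e\<close>\<close>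

locale infinite_measured_gset = measured_gset X G \<mu> Y
  for X :: "'x set" and G and \<mu> and Y :: "('x, 'y) gset" +
  assumes infinite_pts: "infinite (gs_pts Y)"
begin

lemma E_injective:
  assumes v: "v \<in> Hn n" and "E v = 0"
  shows "v = 0"
proof (rule ext)
  fix S
  show "v S = 0 S"
  proof (cases "S \<in> nsets pts n")
    case True
    have "(\<Sum>t\<in>T. v (T - {t})) = 0" if "finite T" "T \<subseteq> pts" for T
      using fun_cong[OF assms(2), of T] that by (simp add: orbit_e_def)
    then show ?thesis
      using True sum_delete_inject[OF infinite_pts, of n v S] by (simp add: nsets_iff)
  next
    case False
    then show ?thesis using v by (simp add: orbit_comp_iff)
  qed
qed

abbreviation "num n \<equiv> card (subset_orbits X Y n)"

definition is_basis :: "nat \<Rightarrow> (nat \<Rightarrow> 'y set \<Rightarrow> complex) \<Rightarrow> bool" where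
  "is_basis n \<beta> \<longleftrightarrow> inj_on \<beta> {..<num n} \<and> fs.independent (\<beta> ` {..<num n}) \<and> fs.span (\<beta> ` {..<num n}) = Hn n"

lemma basis_Hn_card:
  assumes "fs.independent B" "B \<subseteq> Hn n" "Hn n \<subseteq> fs.span B"
  shows "finite B" "card B = num n"
proof -
  let ?A = "orb_ind ` subset_orbits X Y n"
  show "finite B"
    using fs.independent_span_bound[of ?A B] finite_subset_orbits assms(1,2) Hn_basis(2)[of n] by simp
  have "card B = fs.dim (Hn n)" by (rule fs.basis_card_eq_dim[OF assms(2,3,1)])
  moreover have "card ?A = fs.dim (Hn n)"
    using Hn_basis[of n] orb_ind_Hn by (intro fs.basis_card_eq_dim) auto
  ultimately show "card B = num n" using Hn_basis(3)[of n] by simp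
qed

lemma extend_basis_Hn:
  assumes inj: "inj_on \<alpha> {..<k}" and ind: "fs.independent (\<alpha> ` {..<k})" and sub: "\<alpha> ` {..<k} \<subseteq> Hn n"
  shows "k \<le> num n \<and> (\<exists>\<beta>. is_basis n \<beta> \<and> (\<forall>i<k. \<beta> i = \<alpha> i))"
proof -
  obtain B where B: "\<alpha> ` {..<k} \<subseteq> B" "B \<subseteq> Hn n" "fs.independent B" "Hn n \<subseteq> fs.span B"
    using fs.maximal_independent_subset_extend[OF sub ind] .
  note fin = basis_Hn_card[OF B(3,2,4)]
  obtain \<beta> where \<beta>: "bij_betw \<beta> {..<num n} B" "\<forall>i<k. \<beta> i = \<alpha> i" and k: "k \<le> num n"
    using extend_enumeration[OF fin(1) inj B(1)] fin(2) by auto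
  have "fs.span B = Hn n" using B(2,4) fs.span_minimal[OF B(2) subspace_Hn] by blast
  then have "is_basis n \<beta>" using \<beta>(1) B(3) by (simp add: is_basis_def bij_betw_def)
  then show ?thesis using \<beta>(2) k by blast
qed

lemma E_basis:
  assumes "is_basis n \<beta>"
  shows "inj_on (\<lambda>i. E (\<beta> i)) {..<num n}" "fs.independent ((\<lambda>i. E (\<beta> i)) ` {..<num n})"
    "(\<lambda>i. E (\<beta> i)) ` {..<num n} \<subseteq> Hn (Suc n)"
proof -
  interpret E: Vector_Spaces.linear fscale fscale E by (rule linear_EFH)
  have \<beta>: "inj_on \<beta> {..<num n}" "fs.independent (\<beta> ` {..<num n})" "fs.span (\<beta> ` {..<num n}) = Hn n"
    using assms by (auto simp: is_basis_def)
  have inj: "inj_on E (Hn n)"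
    using E_injective by (simp add: E.inj_on_iff_eq_0[OF subspace_Hn])
  have sub: "\<beta> ` {..<num n} \<subseteq> Hn n" using fs.span_superset[of "\<beta> ` {..<num n}"] \<beta>(3) by simp
  then have "\<beta> i \<in> Hn n" if "i < num n" for i using that by auto
  then show "(\<lambda>i. E (\<beta> i)) ` {..<num n} \<subseteq> Hn (Suc n)" using E_Hn by auto
  show "inj_on (\<lambda>i. E (\<beta> i)) {..<num n}"
    using comp_inj_on[OF \<beta>(1) inj_on_subset[OF inj sub]] by (simp add: o_def)
  have "fs.independent (E ` \<beta> ` {..<num n})"
    using \<beta> inj by (intro E.independent_injective_image) simp_all
  then show "fs.independent ((\<lambda>i. E (\<beta> i)) ` {..<num n})" by (simp add: image_image)
qed

text \<open>\<open>e\<close> maps a basis to an independent family in the next degree, which is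
  completed to a basis there; the vectors added are the new generators. Since each basis depends on
  the one before, the sequence comes from dependent choice.\<close>

lemma num_mono: "num n \<le> num (Suc n)"
  and basis_sequence: "\<exists>b. \<forall>n. is_basis n (b n) \<and> (\<forall>i<num n. b (Suc n) i = E (b n i))"
proof -
  have ex: "\<exists>\<beta>. is_basis n \<beta>" for n
    \<comment> \<open>Completing the empty family gives a basis to start from.\<close>
    using extend_basis_Hn[of "\<lambda>_. 0" 0 n] by (auto simp: fs.independent_empty)
  have step: "num n \<le> num (Suc n) \<and> (\<exists>\<beta>'. is_basis (Suc n) \<beta>' \<and> (\<forall>i<num n. \<beta>' i = E (\<beta> i)))"
    if "is_basis n \<beta>" for n \<beta>
    by (rule extend_basis_Hn[OF E_basis[OF that]])
  obtain \<beta> where "is_basis n \<beta>" using ex[of n] ..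
  from step[OF this] show "num n \<le> num (Suc n)" ..
  show "\<exists>b. \<forall>n. is_basis n (b n) \<and> (\<forall>i<num n. b (Suc n) i = E (b n i))"
  proof (rule dependent_nat_choice[OF ex])
    fix \<beta> n assume "is_basis n \<beta>"
    from step[OF this]
    show "\<exists>\<beta>'. is_basis (Suc n) \<beta>' \<and> (\<forall>i<num n. \<beta>' i = E (\<beta> i))" ..
  qed
qed

text \<open>Vectors of different degrees have disjoint supports, so a relation between basis vectors
  can be examined one degree at a time.\<close>

lemma basis_union:
  assumes b: "\<And>n. is_basis n (b n)"
  shows "fs.independent {b n i | n i. i < num n}"
    "i < num n \<Longrightarrow> i' < num n' \<Longrightarrow> b n i = b n' i' \<Longrightarrow> n = n' \<and> i = i'"
    "fs.span {b n i | n i. i < num n} = orbit_algebra Y"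
proof -
  let ?B = "\<lambda>n. b n ` {..<num n}"
  have inj: "inj_on (b n) {..<num n}" and ind: "fs.independent (?B n)" and span: "fs.span (?B n) = Hn n" for n
    using b[of n] by (auto simp: is_basis_def)
  have bH: "b n i \<in> Hn n" if "i < num n" for n i
    using fs.span_base[of "b n i" "?B n"] span[of n] that by simp
  have zero: "b n i T = 0" if "i < num n" "T \<in> nsets pts n'" "n \<noteq> n'" for n n' i T
    using bH[OF that(1)] that(2,3) by (auto simp: orbit_comp_iff nsets_iff)
  have zero': "b n i T = 0" if "i < num n" "T \<notin> nsets pts n" for n i T
    using bH[OF that(1)] that(2) by (auto simp: orbit_comp_iff)
  show eq: "n = n' \<and> i = i'" if i: "i < num n" "i' < num n'" "b n i = b n' i'" for n n' i i'
  proof -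
    have "n = n'"
    proof (rule ccontr)
      assume "n \<noteq> n'"
      then have "b n i T = 0" for T
        using zero[OF i(2), of T n] zero'[OF i(1), of T] i(3) by (cases "T \<in> nsets pts n") simp_all
      then have "b n i = 0" by (simp add: fun_eq_iff)
      moreover have "b n i \<in> ?B n" using i(1) by simp
      ultimately show False using fs.dependent_zero[of "?B n"] ind[of n] by simp
    qed
    then show ?thesis using inj_onD[OF inj[of n], of i i'] i by simp
  qed
  show "fs.independent {b n i | n i. i < num n}"
    unfolding fs.independent_explicit_finite_subsets
  proof (intro allI impI ballI)
    fix S u v assume S: "S \<subseteq> {b n i | n i. i < num n}" "finite S"
      and s: "(\<Sum>v\<in>S. fscale (u v) v) = 0" and v: "v \<in> S"
    obtain n i where n: "v = b n i" "i < num n" using v S(1) by auto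
    \<comment> \<open>The terms of degree \<open>n\<close>. Evaluation at an \<open>n\<close>-subset
      kills all others, so these sum to zero on their own.\<close>
    let ?S = "S \<inter> ?B n"
    have "(\<Sum>w\<in>?S. fscale (u w) w) T = 0" for T
    proof (cases "T \<in> nsets pts n")
      case True
      have "w T = 0" if w: "w \<in> S - ?S" for w
      proof -
        obtain n' i' where w': "w = b n' i'" "i' < num n'" using w S(1) by blast
        then have "n' \<noteq> n" using w by blast
        then show ?thesis using zero[OF w'(2) True] w'(1) by simp
      qed
      then have "(\<Sum>w\<in>?S. fscale (u w) w T) = (\<Sum>w\<in>S. fscale (u w) w T)"
        by (intro sum.mono_neutral_left S(2)) auto
      then show ?thesis using fun_cong[OF s, of T] by (simp add: sum_fun_apply)
    next
      case False
      then show ?thesis using zero' by (auto simp: sum_fun_apply intro!: sum.neutral)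
    qed
    then have "(\<Sum>w\<in>?S. fscale (u w) w) = 0" by (simp add: fun_eq_iff)
    moreover have "v \<in> ?S" "?S \<subseteq> ?B n" "finite ?S" using v n S(2) by auto
    ultimately show "u v = 0"
      using ind[of n] unfolding fs.independent_explicit_finite_subsets by blast
  qed
  show "fs.span {b n i | n i. i < num n} = orbit_algebra Y"
  proof
    show "orbit_algebra Y \<subseteq> fs.span {b n i | n i. i < num n}"
    proof
      fix x assume "x \<in> orbit_algebra Y"
      then obtain N v where x: "x = (\<lambda>T. \<Sum>n\<le>N. v n T)" "\<And>n. v n \<in> Hn n"
        unfolding orbit_algebra_def by blast
      have eq: "x = (\<Sum>n\<le>N. v n)" unfolding x(1) by (simp add: fun_eq_iff sum_fun_apply)
      have "v n \<in> fs.span {b n i | n i. i < num n}" for n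
      proof -
        have "fs.span (?B n) \<subseteq> fs.span {b n i | n i. i < num n}" by (intro fs.span_mono) auto
        then show ?thesis using x(2)[of n] span[of n] by blast
      qed
      then show "x \<in> fs.span {b n i | n i. i < num n}" unfolding eq by (intro fs.span_sum)
    qed
    show "fs.span {b n i | n i. i < num n} \<subseteq> orbit_algebra Y"
    proof
      fix x assume "x \<in> fs.span {b n i | n i. i < num n}"
      then show "x \<in> orbit_algebra Y"
      proof (induction rule: fs.span_induct_alt)
        case base
        have "0 \<in> Hn n" for n by (rule fs.subspace_0[OF subspace_Hn])
        then show ?case unfolding orbit_algebra_def by (intro CollectI exI[of _ 0] exI[of _ "\<lambda>n. 0"]) auto
      next
        case (step a x y)
        then obtain k i where x: "x = b k i" "i < num k" by blast
        obtain N v where y: "y = (\<lambda>T. \<Sum>n\<le>N. v n T)" "\<And>n. v n \<in> Hn n"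
          using step.IH unfolding orbit_algebra_def by blast
        \<comment> \<open>The components \<open>v n\<close> beyond \<open>N\<close> may be nonzero
          although they do not enter \<open>y\<close>; they are cut off because the new sum can run
          further than \<open>N\<close>.\<close>
        define w where "w n = (if n \<le> N then v n else 0) + (if n = k then fscale a x else 0)" for n
        have "w n \<in> Hn n" for n
          unfolding w_def using y(2) bH[OF x(2)] x(1) subspace_Hn
          by (intro fs.subspace_add) (auto simp: fs.subspace_scale fs.subspace_0)
        moreover have "(fscale a x + y) T = (\<Sum>n\<le>max N k. w n T)" for T
        proof -
          have "(\<Sum>n\<le>max N k. w n T) = (\<Sum>n\<le>max N k. (if n \<le> N then v n T else 0)) + (\<Sum>n\<le>max N k. if n = k then a * x T else 0)"
            unfolding sum.distrib[symmetric] by (intro sum.cong) (auto simp: w_def)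
          also have "(\<Sum>n\<le>max N k. (if n \<le> N then v n T else 0)) = (\<Sum>n\<le>N. v n T)"
            by (intro sum.mono_neutral_cong_right) auto
          finally show ?thesis by (simp add: y(1))
        qed
        ultimately show ?case unfolding orbit_algebra_def by (intro CollectI exI[of _ "max N k"] exI[of _ w]) auto
      qed
    qed
  qed
qed

end

theorem theorem4p19:
  fixes X :: "'x set" and G :: "('x \<Rightarrow> 'x) set"
    and \<mu> :: "('x, 'x gset_univ) gset \<Rightarrow> complex"
    and Y :: "('x, 'y) gset"
  assumes "oligomorphic X G"
    and "ghat_measure X G \<mu>"
    and "ghat_set X G Y" and "gs_grp Y = G" and "infinite (gs_pts Y)"
  shows "(\<exists>(N::enat) (F :: nat \<Rightarrow> ('y set \<Rightarrow> complex) set) (l :: nat \<Rightarrow> complex).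
            F 0 = {\<zero>\<^bsub>orbit_rep X G \<mu> Y\<^esub>} \<and>
            (\<forall>n. enat n \<le> N \<longrightarrow> sl2_subrep (F n) (orbit_rep X G \<mu> Y)) \<and>
            (\<forall>n. enat n < N \<longrightarrow> F n \<subseteq> F (Suc n) \<and>
               sl2_iso (quot_rep ((orbit_rep X G \<mu> Y)\<lparr>carrier := F (Suc n)\<rparr>) (F n))
                 (verma_minus (l n))) \<and>
            (\<Union>n \<in> {n. enat n \<le> N}. F n) = carrier (orbit_rep X G \<mu> Y))
       \<and> (\<forall>n. finite (subset_orbits X Y n))
       \<and> (\<exists>(I :: nat set) (d :: nat \<Rightarrow> nat). \<forall>n.
            finite {i \<in> I. shifted_ones (d i) n \<noteq> 0} \<and>
            card (subset_orbits X Y n) =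
              (\<Sum>i \<in> {i \<in> I. shifted_ones (d i) n \<noteq> 0}. shifted_ones (d i) n))"
proof -
  interpret infinite_measured_gset X G \<mu> Y
    using assms by unfold_locales
  obtain b where basis: "\<And>n. is_basis n (b n)" and b_Suc: "\<And>n i. i < num n \<Longrightarrow> b (Suc n) i = E (b n i)"
    using basis_sequence by blast
  have b_Hn: "b n i \<in> Hn n" if "i < num n" for n i
    using basis[of n] fs.span_base[of "b n i" "b n ` {..<num n}"] that by (simp add: is_basis_def)
  note union = basis_union[OF basis]
  interpret g: graded_sl2 fscale num b E F H "meas Y"
  proof (rule graded_sl2.intro[OF fs.vector_space_axioms graded_sl2_axioms.intro])
    show "fs.independent {b n i | n i. i < num n}" by (rule union(1))
    show "F (b 0 i) = 0" if "i < num 0" for i using F_H0[OF b_Hn[OF that]] .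
    show "F (b (Suc n) i) \<in> fs.span (b n ` {..<num n})" if "i < num (Suc n)" for n i
      using F_Hn[OF b_Hn[OF that]] basis[of n] by (simp add: is_basis_def)
    show "n = n' \<and> i = i'" if "i < num n" "i' < num n'" "b n i = b n' i'" for n n' i i'
      by (rule union(2)[OF that])
  qed (use num_mono b_Suc H_Hn[OF b_Hn] E_F_Hn[OF b_Hn] linear_EFH in simp_all)
  let ?R = "orbit_rep X G \<mu> Y"
  have total: "g.total = orbit_algebra Y" unfolding g.total_def by (rule union(3))
  have R: "carrier ?R = g.total" "add ?R = (+)" "ring.zero ?R = 0" "module.smult ?R = fscale"
    "rep_act ?R = g.act"
    by (auto simp: orbit_rep_def total g.act_def fun_eq_iff)
  \<comment> \<open>The number of generators: an index occurs exactly if it is below some number of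
    orbits. It is infinite when these numbers are unbounded.\<close>
  let ?N = "SUP n. enat (num n)"
  have "\<exists>N F l. F 0 = {\<zero>\<^bsub>?R\<^esub>} \<and> (\<forall>n. enat n \<le> N \<longrightarrow> sl2_subrep (F n) ?R) \<and>
      (\<forall>n. enat n < N \<longrightarrow> F n \<subseteq> F (Suc n) \<and>
         sl2_iso (quot_rep (?R\<lparr>carrier := F (Suc n)\<rparr>) (F n)) (verma_minus (l n))) \<and>
      (\<Union>n \<in> {n. enat n \<le> N}. F n) = carrier ?R"
  \<comment> \<open>The weight of the quotient with index \<open>m\<close> is the eigenvalue of
    \<open>h\<close> on its generator, twice the degree minus the measure of
    \<open>Y\<close>.\<close>
  proof (intro exI[of _ ?N] exI[of _ g.filt] exI[of _ "\<lambda>m. 2 * of_nat (g.start m) - meas Y"] conjI allI impI)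
    show "g.filt 0 = {\<zero>\<^bsub>?R\<^esub>}" by (simp add: g.filt_0 R(3))
    show "sl2_subrep (g.filt m) ?R" for m by (rule g.sl2_subrep_filt[OF R])
    show "g.filt m \<subseteq> g.filt (Suc m)" for m by (rule g.filt_mono) simp
    show "(\<Union>n \<in> {n. enat n \<le> ?N}. g.filt n) = carrier ?R" unfolding R(1) by (rule g.Union_filt)
    fix m assume "enat m < ?N"
    then obtain n where "m < num n" by (auto simp: less_SUP_iff)
    then show "sl2_iso (quot_rep (?R\<lparr>carrier := g.filt (Suc m)\<rparr>) (g.filt m))
        (verma_minus (2 * of_nat (g.start m) - meas Y))"
      by (intro g.sl2_iso_filt_quotient) (simp_all add: R)
  qed
  moreover have "\<exists>(I :: nat set) (d :: nat \<Rightarrow> nat). \<forall>n. finite {i \<in> I. shifted_ones (d i) n \<noteq> 0} \<and>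
      num n = (\<Sum>i \<in> {i \<in> I. shifted_ones (d i) n \<noteq> 0}. shifted_ones (d i) n)"
  \<comment> \<open>One sequence for each generator, shifted to the degree in which the generator
    appears.\<close>
  proof (intro exI[of _ "{i. \<exists>n. i < num n}"] exI[of _ g.start] allI conjI)
    fix n
    let ?J = "{i \<in> {i. \<exists>n. i < num n}. shifted_ones (g.start i) n \<noteq> 0}"
    show "finite ?J" unfolding g.dimension_count by simp
    have "(\<Sum>i\<in>?J. shifted_ones (g.start i) n) = (\<Sum>i\<in>?J. 1)"
      by (intro sum.cong) (auto simp: shifted_ones_def split: if_splits)
    then show "num n = (\<Sum>i\<in>?J. shifted_ones (g.start i) n)"
      unfolding g.dimension_count by simp
  qed
  ultimately show ?thesis using finite_subset_orbits by blast
qed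

end
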